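(* Let $U$ be hyperbolic Dehn filling space of the figure-eight knot complement $M$, let $F$ be the once-punctured torus fiber, and for $u\in U$ let $\mathfrak{v}_u$ be the associated $\pi_1(M)$-module. For each $u\in U$ let $I_u$ denote the image of the map of $x$-modules $H^1(F,\partial F;\mathfrak{v}_u)\to H^1(F;\mathfrak{v}_u)$ from the long exact sequence of the pair $(F,\partial F)$. Then $$0\to I_u\to H^1(F;\mathfrak{v}_u)\to H^1(\partial F;\mathfrak{v}_u)\to 0$$ is a short exact sequence of $x$-modules. Moreover, for a sufficiently small neighborhood $V\subset U$ of $0$, $H^1(F;\mathfrak{v}_v)^x$ is isomorphic to $H^1(l;\mathfrak{v}_v)^x$ for all $v\in V$. In particular, $\dim H^1(F;\mathfrak{v}_v)^x=1$ for all $v\in V$.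
   Context: $\pi_1(M)=\langle x,y\mid ax=ya\rangle$, $a=xy^{-1}x^{-1}y$, $b=xy^{-1}$, $l=b^{-1}a^{-1}ba$; $x$ and $l$ are a meridian and longitude generating $\pi_1(\partial M)\cong\mathbb{Z}^2$. Equivalently $\pi_1(M)=\langle a,b,x\mid xax^{-1}=ba,\ xbx^{-1}=bab\rangle$; $M$ fibers over $S^1$ with fiber a once-punctured torus $F$, $\pi_1(F)=F_2=\langle a,b\rangle$ free and normal, $\partial F$ represented by $l$, and monodromy induced by conjugation by $x$. Representations: $z_1,z_2\in\mathbb{C}$ have positive imaginary part and satisfy $2\mathrm{Log} z_1+\mathrm{Log}\frac1{1-z_1}+\mathrm{Log} z_2+2\mathrm{Log}(1-\frac1{z_2})=2\pi i$ and $\mathrm{Log}\frac1{1-z_1}+2\mathrm{Log}(1-\frac1{z_1})+\mathrm{Log} z_2+2\mathrm{Log}\frac1{1-z_2}=2\pi i$; with $k=z_1(1-z_2)$ and $u=\mathrm{Log}\,k$ (branch with $u=0$ at $z_1=z_2=e^{\pi i/3}$), $\rho_u:\pi_1(M)\to \mathrm{PSL}(2,\mathbb{C})$ is $\rho_u(x)=\begin{pmatrix}k^{-1/2}&-k^{-1/2}\\0&k^{1/2}\end{pmatrix}$, $\rho_u(y)=\begin{pmatrix}k^{1/2}&0\\-z_2k^{-1/2}&k^{-1/2}\end{pmatrix}$. It is the holonomy of a hyperbolic structure on $M$, complete exactly when $u=0$. $U\subset\mathbb{C}$ (hyperbolic Dehn filling space) is the connected open neighborhood of $0$ parametrizing these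 holonomies, on which $u\mapsto$ generalized Dehn filling coefficients ($\infty$ for $u=0$; for $u\ne0$ the unique real solution $(p,q)$ of $pu+qv=2\pi i$, where $v=2\mathrm{Log}(-(1-z_2)^2/z_2)$, $v=0$ at $u=0$) is a diffeomorphism onto a neighborhood of $\infty\in S^2=\mathbb{R}^2\cup\{\infty\}$. Via $\mathrm{PSL}(2,\mathbb{C})\cong\mathrm{PSO}(3,1)\subset\mathrm{PGL}(4,\mathbb{R})$, $\pi_1(M)$ acts by conjugation ($\mathrm{Ad}\,\rho_u$) on $\mathfrak{sl}(4,\mathbb{R})=\mathfrak{so}(3,1)\oplus\mathfrak{v}$, with $\mathfrak{v}$ the $9$-dimensional orthogonal complement of $\mathfrak{so}(3,1)$ under the Killing form; $\mathfrak{v}_u$ is $\mathfrak{v}$ with this action. Cohomology is twisted (equivalently group) cohomology; $H^*(l;\cdot)$ means $H^*(\langle l\rangle;\cdot)=H^*(\partial F;\cdot)$. Conjugation by $x$ preserves $\pi_1(F)$ and $\langle l\rangle$ and acts on crossed homomorphisms by $(xf)(h)=x\,f(x^{-1}hx)$ (and analogously on the other cohomology groups, being $v\mapsto xv$ on $H^0$), making them $x$-modules; a superscript $x$ denotes the invariants. *)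

theory Defs
  imports
    "HOL-Analysis.Analysis"
    "HOL-Algebra.AbelCoset"
    "HOL-Algebra.Generated_Groups"
    "Jordan_Normal_Form.Missing_VectorSpace"
begin

section \<open>Groups given by generators and relators\<close>

text \<open>A word is a list of letters \<open>(g, e)\<close>, which stands for \<open>g\<close> if \<open>e\<close> holds and for the
  inverse of \<open>g\<close> otherwise.\<close>

type_synonym 'g word = "('g \<times> bool) list"

definition word_inv :: "'g word \<Rightarrow> 'g word" where
  "word_inv w = rev (map (\<lambda>(g, e). (g, \<not> e)) w)"

inductive word_eq :: "'g word set \<Rightarrow> 'g word \<Rightarrow> 'g word \<Rightarrow> bool" for R where
  refl: "word_eq R w w"
| sym: "word_eq R v w \<Longrightarrow> word_eq R w v"
| trans: "word_eq R u v \<Longrightarrow> word_eq R v w \<Longrightarrow> word_eq R u w"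
| cancel: "word_eq R (v @ [(g, e), (g, \<not> e)] @ w) (v @ w)"
| relator: "r \<in> R \<Longrightarrow> word_eq R (v @ r @ w) (v @ w)"

definition word_rel :: "'g word set \<Rightarrow> ('g word \<times> 'g word) set" where
  "word_rel R = {(v, w). word_eq R v w}"

definition presented_group :: "'g word set \<Rightarrow> 'g word set monoid" where
  "presented_group R =
    \<lparr>carrier = UNIV // word_rel R,
     mult = (\<lambda>A B. \<Union>v\<in>A. \<Union>w\<in>B. word_rel R `` {v @ w}),
     one = word_rel R `` {[]}\<rparr>"


section \<open>The figure-eight knot group\<close>

datatype gen = gen_x | gen_y

definition word_x :: "gen word" where "word_x = [(gen_x, True)]"
definition word_y :: "gen word" where "word_y = [(gen_y, True)]"

definition word_a :: "gen word" where
  "word_a = word_x @ word_inv word_y @ word_inv word_x @ word_y"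

definition word_b :: "gen word" where
  "word_b = word_x @ word_inv word_y"

definition word_l :: "gen word" where
  "word_l = word_inv word_b @ word_inv word_a @ word_b @ word_a"

text \<open>The single relation is \<open>a x = y a\<close>.\<close>

definition fig8_relators :: "gen word set" where
  "fig8_relators = {word_a @ word_x @ word_inv (word_y @ word_a)}"

definition \<pi>M :: "gen word set monoid" where
  "\<pi>M = presented_group fig8_relators"

definition \<pi>M_class :: "gen word \<Rightarrow> gen word set" where
  "\<pi>M_class w = word_rel fig8_relators `` {w}"

definition elt_x :: "gen word set" where
  "elt_x = \<pi>M_class word_x"

text \<open>The subgroup of the fiber \<open>F\<close>, and the subgroup of its boundary curve.\<close>

definition \<pi>F :: "gen word set set" where
  "\<pi>F = generate \<pi>M {\<pi>M_class word_a, \<pi>M_class word_b}"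

definition \<pi>dF :: "gen word set set" where
  "\<pi>dF = generate \<pi>M {\<pi>M_class word_l}"


section \<open>The representations into \<open>PSL(2,\<complex>)\<close>\<close>

definition SL2C :: "(complex^2^2) monoid" where
  "SL2C = \<lparr>carrier = {A. det A = 1}, mult = (**), one = mat 1\<rparr>"

definition PSL2C :: "(complex^2^2) set monoid" where
  "PSL2C = SL2C Mod {mat 1, - mat 1}"

definition PSL2C_class :: "complex^2^2 \<Rightarrow> (complex^2^2) set" where
  "PSL2C_class A = {mat 1, - mat 1} #>\<^bsub>SL2C\<^esub> A"

text \<open>Here \<open>z\<close> is the second shape parameter \<open>z\<^sub>2\<close>; the square root of \<open>k = exp u\<close> is taken to be
  \<open>exp (u / 2)\<close>, the other choice giving the same elements of \<open>PSL(2,\<complex>)\<close>.\<close>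

definition mat_x :: "complex \<Rightarrow> complex^2^2" where
  "mat_x u = vector [vector [exp (- u / 2), - exp (- u / 2)],
                     vector [0,              exp (u / 2)]]"

definition mat_y :: "complex \<Rightarrow> complex \<Rightarrow> complex^2^2" where
  "mat_y u z = vector [vector [exp (u / 2),        0],
                       vector [- z * exp (- u / 2), exp (- u / 2)]]"

fun mat_letter :: "complex \<Rightarrow> complex \<Rightarrow> gen \<times> bool \<Rightarrow> complex^2^2" where
  "mat_letter u z (gen_x, e) = (if e then mat_x u else matrix_inv (mat_x u))"
| "mat_letter u z (gen_y, e) = (if e then mat_y u z else matrix_inv (mat_y u z))"

definition mat_word :: "complex \<Rightarrow> complex \<Rightarrow> gen word \<Rightarrow> complex^2^2" where
  "mat_word u z w = foldr (\<lambda>c A. mat_letter u z c ** A) w (mat 1)"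

definition rho :: "complex \<Rightarrow> complex \<Rightarrow> gen word set \<Rightarrow> (complex^2^2) set" where
  "rho u z g = the_elem ((\<lambda>w. PSL2C_class (mat_word u z w)) ` g)"


section \<open>Hyperbolic Dehn filling space\<close>

definition gluing_equations :: "complex \<Rightarrow> complex \<Rightarrow> bool" where
  "gluing_equations z1 z2 \<longleftrightarrow>
     2 * Ln z1 + Ln (1 / (1 - z1)) + Ln z2 + 2 * Ln (1 - 1 / z2) = 2 * pi * \<i> \<and>
     Ln (1 / (1 - z1)) + 2 * Ln (1 - 1 / z1) + Ln z2 + 2 * Ln (1 / (1 - z2)) = 2 * pi * \<i>"

text \<open>For \<open>z1\<close>, \<open>z2\<close> in the upper half plane neither \<open>z1 * (1 - z2)\<close> nor \<open>-(1 - z2)\<^sup>2 / z2\<close> lies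
  on the nonpositive real axis, and both equal \<open>1\<close> at \<open>z1 = z2 = cis (pi / 3)\<close>.  Hence the principal
  logarithm is the required continuous branch both for \<open>u\<close> and for \<open>v\<close>.\<close>

definition u_of :: "complex \<Rightarrow> complex \<Rightarrow> complex" where
  "u_of z1 z2 = Ln (z1 * (1 - z2))"

definition v_of :: "complex \<Rightarrow> complex" where
  "v_of z2 = 2 * Ln (- (1 - z2)\<^sup>2 / z2)"

definition is_filling_coeff :: "complex \<Rightarrow> complex \<Rightarrow> real \<times> real \<Rightarrow> bool" where
  "is_filling_coeff u v pq \<longleftrightarrow>
     complex_of_real (fst pq) * u + complex_of_real (snd pq) * v = 2 * pi * \<i>"

text \<open>\<open>None\<close> is the point at infinity of the one-point compactification of the plane.\<close>

definition filling_coeff :: "(complex \<Rightarrow> complex) \<Rightarrow> complex \<Rightarrow> (real \<times> real) option" where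
  "filling_coeff z2 u = (if u = 0 then None else Some (THE pq. is_filling_coeff u (v_of (z2 u)) pq))"

definition plane_compactification :: "(real \<times> real) option topology" where
  "plane_compactification = Alexandroff_compactification euclidean"

text \<open>Continuous differentiability of all orders, for functions on an open set.\<close>

primrec Ck_on :: "nat \<Rightarrow> ('a::euclidean_space \<Rightarrow> 'b::real_normed_vector) \<Rightarrow> 'a set \<Rightarrow> bool" where
  "Ck_on 0 f S \<longleftrightarrow> continuous_on S f"
| "Ck_on (Suc k) f S \<longleftrightarrow>
     f differentiable_on S \<and> (\<forall>i\<in>Basis. Ck_on k (\<lambda>x. frechet_derivative f (at x) i) S)"

definition smooth_diffeo_onto_image ::
  "('a::euclidean_space \<Rightarrow> 'b::euclidean_space) \<Rightarrow> 'a set \<Rightarrow> bool" where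
  "smooth_diffeo_onto_image f S \<longleftrightarrow>
     open S \<and> open (f ` S) \<and> inj_on f S \<and>
     (\<forall>k. Ck_on k f S) \<and> (\<forall>k. Ck_on k (inv_into S f) (f ` S))"

text \<open>\<open>U\<close> is a hyperbolic Dehn filling space, with \<open>z1 u\<close>, \<open>z2 u\<close> the shape parameters of the
  structure with parameter \<open>u\<close>.  The map \<open>filling_coeff z2\<close> is required to be a homeomorphism onto
  an open neighborhood of infinity, and a smooth diffeomorphism off \<open>0\<close>.  At \<open>u = 0\<close> smoothness
  would depend on the choice of a chart around infinity: with \<open>v = c u + O(u\<^sup>3)\<close>, the map is
  continuously differentiable in the chart \<open>1 / (p + q c)\<close>, but not even differentiable in
  \<open>1 / (p + q \<i>)\<close>, since \<open>c \<noteq> \<plusminus>\<i>\<close>.\<close>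

definition hyperbolic_Dehn_filling_space ::
  "complex set \<Rightarrow> (complex \<Rightarrow> complex) \<Rightarrow> (complex \<Rightarrow> complex) \<Rightarrow> bool" where
  "hyperbolic_Dehn_filling_space U z1 z2 \<longleftrightarrow>
     open U \<and> connected U \<and> 0 \<in> U \<and>
     continuous_on U z1 \<and> continuous_on U z2 \<and>
     z1 0 = cis (pi / 3) \<and> z2 0 = cis (pi / 3) \<and>
     (\<forall>u\<in>U. Im (z1 u) > 0 \<and> Im (z2 u) > 0 \<and> gluing_equations (z1 u) (z2 u) \<and>
            u_of (z1 u) (z2 u) = u) \<and>
     (\<forall>u\<in>U - {0}. \<exists>!pq. is_filling_coeff u (v_of (z2 u)) pq) \<and>
     (\<exists>N. openin plane_compactification N \<and> None \<in> N \<and>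
          homeomorphic_map (top_of_set U) (subtopology plane_compactification N)
            (filling_coeff z2)) \<and>
     smooth_diffeo_onto_image (\<lambda>u. the (filling_coeff z2 u)) (U - {0})"


section \<open>The module \<open>\<vv>\<^sub>u\<close>\<close>

text \<open>\<open>PSL(2,\<complex>)\<close> acts on the Hermitian matrices by \<open>X \<mapsto> A X A\<^sup>*\<close>, preserving the determinant
  \<open>p\<^sub>4\<^sup>2 - p\<^sub>1\<^sup>2 - p\<^sub>2\<^sup>2 - p\<^sub>3\<^sup>2\<close>.\<close>

definition hermitian :: "real^4 \<Rightarrow> complex^2^2" where
  "hermitian p = vector [vector [Complex (p$4 + p$3) 0, Complex (p$1) (- p$2)],
                         vector [Complex (p$1) (p$2),   Complex (p$4 - p$3) 0]]"

definition hermitian_coords :: "complex^2^2 \<Rightarrow> real^4" where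
  "hermitian_coords X =
     vector [Re (X$2$1), Im (X$2$1), (Re (X$1$1) - Re (X$2$2)) / 2, (Re (X$1$1) + Re (X$2$2)) / 2]"

definition conj_transpose :: "complex^2^2 \<Rightarrow> complex^2^2" where
  "conj_transpose A = (\<chi> i j. cnj (A$j$i))"

definition lorentz :: "complex^2^2 \<Rightarrow> real^4^4" where
  "lorentz A = matrix (\<lambda>p. hermitian_coords (A ** hermitian p ** conj_transpose A))"

definition minkowski :: "real^4^4" where
  "minkowski = (\<chi> i j. if i = j then (if i = 4 then - 1 else 1) else 0)"

definition so31 :: "(real^4^4) set" where
  "so31 = {X. transpose X ** minkowski + minkowski ** X = 0}"

definition sl4 :: "(real^4^4) set" where
  "sl4 = {X. trace X = 0}"

definition lie_bracket :: "real^4^4 \<Rightarrow> real^4^4 \<Rightarrow> real^4^4" where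
  "lie_bracket X Y = X ** Y - Y ** X"

text \<open>The trace of \<open>ad X \<circ> ad Y\<close>, computed over all of \<open>gl(4,\<real>)\<close>: this agrees with the trace over
  \<open>sl(4,\<real>)\<close>, because \<open>ad Y\<close> kills the scalar matrices and \<open>ad X\<close> takes values in \<open>sl(4,\<real>)\<close>.\<close>

definition killing_form :: "real^4^4 \<Rightarrow> real^4^4 \<Rightarrow> real" where
  "killing_form X Y = (\<Sum>E\<in>Basis. lie_bracket X (lie_bracket Y E) \<bullet> E)"

definition v_space :: "(real^4^4) set" where
  "v_space = {X \<in> sl4. \<forall>Y\<in>so31. killing_form X Y = 0}"

definition Ad_rho :: "complex \<Rightarrow> complex \<Rightarrow> gen word set \<Rightarrow> real^4^4 \<Rightarrow> real^4^4" where
  "Ad_rho u z g X = (let L = the_elem (lorentz ` rho u z g) in L ** X ** matrix_inv L)"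


section \<open>Real vector spaces as modules, quotients, and \<open>x\<close>-modules\<close>

definition real_ring :: "real ring" where
  "real_ring = \<lparr>carrier = UNIV, mult = (*), one = 1, zero = 0, add = (+)\<rparr>"

text \<open>The fields \<open>mult\<close> and \<open>one\<close> of a \<open>module\<close> record play no role.\<close>

definition quotient_module :: "(real, 'a) module \<Rightarrow> 'a set \<Rightarrow> (real, 'a set) module" where
  "quotient_module M B =
    \<lparr>carrier = a_rcosets\<^bsub>M\<^esub> B, mult = undefined, one = undefined,
     zero = B, add = (<+>\<^bsub>M\<^esub>),
     smult = (\<lambda>c C. \<Union>f\<in>C. B +>\<^bsub>M\<^esub> (c \<odot>\<^bsub>M\<^esub> f))\<rparr>"

text \<open>The map into \<open>quotient_module N B\<close> induced by a map \<open>\<phi>\<close> into \<open>N\<close>.\<close>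

definition induced :: "(real, 'b) module \<Rightarrow> 'b set \<Rightarrow> ('a \<Rightarrow> 'b) \<Rightarrow> 'a set \<Rightarrow> 'b set" where
  "induced N B \<phi> C = (\<Union>f\<in>C. B +>\<^bsub>N\<^esub> \<phi> f)"

text \<open>An \<open>x\<close>-module is a vector space \<open>M\<close> with an automorphism \<open>T\<close>, the action of \<open>x\<close>.\<close>

definition x_module :: "(real, 'a) module \<Rightarrow> ('a \<Rightarrow> 'a) \<Rightarrow> bool" where
  "x_module M T \<longleftrightarrow>
     vectorspace real_ring M \<and> T \<in> module_hom real_ring M M \<and> bij_betw T (carrier M) (carrier M)"

definition x_module_hom ::
  "(real, 'a) module \<Rightarrow> ('a \<Rightarrow> 'a) \<Rightarrow> (real, 'b) module \<Rightarrow> ('b \<Rightarrow> 'b) \<Rightarrow> ('a \<Rightarrow> 'b) \<Rightarrow> bool" where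
  "x_module_hom M S N T \<phi> \<longleftrightarrow>
     x_module M S \<and> x_module N T \<and> \<phi> \<in> module_hom real_ring M N \<and>
     (\<forall>m\<in>carrier M. \<phi> (S m) = T (\<phi> m))"

definition x_short_exact ::
  "(real, 'a) module \<Rightarrow> ('a \<Rightarrow> 'a) \<Rightarrow> ('a \<Rightarrow> 'b) \<Rightarrow>
   (real, 'b) module \<Rightarrow> ('b \<Rightarrow> 'b) \<Rightarrow> ('b \<Rightarrow> 'c) \<Rightarrow>
   (real, 'c) module \<Rightarrow> ('c \<Rightarrow> 'c) \<Rightarrow> bool" where
  "x_short_exact L R \<phi> M S \<psi> N T \<longleftrightarrow>
     x_module_hom L R M S \<phi> \<and> x_module_hom M S N T \<psi> \<and>
     inj_on \<phi> (carrier L) \<and>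
     \<phi> ` carrier L = {m \<in> carrier M. \<psi> m = \<zero>\<^bsub>N\<^esub>} \<and>
     \<psi> ` carrier M = carrier N"

definition x_invariants :: "(real, 'a) module \<Rightarrow> ('a \<Rightarrow> 'a) \<Rightarrow> (real, 'a) module" where
  "x_invariants M T = M\<lparr>carrier := {m \<in> carrier M. T m = m}\<rparr>"

definition isomorphic_spaces :: "(real, 'a) module \<Rightarrow> (real, 'b) module \<Rightarrow> bool" where
  "isomorphic_spaces M N \<longleftrightarrow>
     vectorspace real_ring M \<and> vectorspace real_ring N \<and>
     (\<exists>\<phi>\<in>module_hom real_ring M N. bij_betw \<phi> (carrier M) (carrier N))"


section \<open>First cohomology of a subgroup \<open>H\<close> of \<open>G\<close>, and of a pair \<open>K \<subseteq> H\<close>\<close>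

definition Z1 :: "('g, 'm) monoid_scheme \<Rightarrow> 'g set \<Rightarrow> 'v::real_vector set \<Rightarrow> ('g \<Rightarrow> 'v \<Rightarrow> 'v) \<Rightarrow>
    (real, 'g \<Rightarrow> 'v) module" where
  "Z1 G H V act =
    \<lparr>carrier = {f \<in> H \<rightarrow>\<^sub>E V. \<forall>g\<in>H. \<forall>h\<in>H. f (g \<otimes>\<^bsub>G\<^esub> h) = f g + act g (f h)},
     mult = undefined, one = undefined,
     zero = (\<lambda>h\<in>H. 0), add = (\<lambda>f f'. \<lambda>h\<in>H. f h + f' h),
     smult = (\<lambda>c f. \<lambda>h\<in>H. c *\<^sub>R f h)\<rparr>"

definition B1 :: "'g set \<Rightarrow> 'v::real_vector set \<Rightarrow> ('g \<Rightarrow> 'v \<Rightarrow> 'v) \<Rightarrow> ('g \<Rightarrow> 'v) set" where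
  "B1 H V act = (\<lambda>v. \<lambda>h\<in>H. act h v - v) ` V"

definition H1 :: "('g, 'm) monoid_scheme \<Rightarrow> 'g set \<Rightarrow> 'v::real_vector set \<Rightarrow> ('g \<Rightarrow> 'v \<Rightarrow> 'v) \<Rightarrow>
    (real, ('g \<Rightarrow> 'v) set) module" where
  "H1 G H V act = quotient_module (Z1 G H V act) (B1 H V act)"

text \<open>Relative cochains are the cochains on \<open>H\<close> that restrict to zero on \<open>K\<close>.  In degree \<open>0\<close> the
  restriction is the identity of \<open>V\<close>, so the only relative \<open>0\<close>-cochain, and hence the only relative
  \<open>1\<close>-coboundary, is zero.\<close>

definition Z1_rel :: "('g, 'm) monoid_scheme \<Rightarrow> 'g set \<Rightarrow> 'g set \<Rightarrow> 'v::real_vector set \<Rightarrow>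
    ('g \<Rightarrow> 'v \<Rightarrow> 'v) \<Rightarrow> (real, 'g \<Rightarrow> 'v) module" where
  "Z1_rel G H K V act =
     (Z1 G H V act)\<lparr>carrier := {f \<in> carrier (Z1 G H V act). \<forall>k\<in>K. f k = 0}\<rparr>"

definition B1_rel :: "'g set \<Rightarrow> ('g \<Rightarrow> 'v::real_vector) set" where
  "B1_rel H = {\<lambda>h\<in>H. 0}"

definition H1_rel :: "('g, 'm) monoid_scheme \<Rightarrow> 'g set \<Rightarrow> 'g set \<Rightarrow> 'v::real_vector set \<Rightarrow>
    ('g \<Rightarrow> 'v \<Rightarrow> 'v) \<Rightarrow> (real, ('g \<Rightarrow> 'v) set) module" where
  "H1_rel G H K V act = quotient_module (Z1_rel G H K V act) (B1_rel H)"

text \<open>The action of \<open>x\<close> on cochains on a subgroup normalized by \<open>x\<close>.\<close>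

definition x_cochain :: "('g, 'm) monoid_scheme \<Rightarrow> 'g set \<Rightarrow> ('g \<Rightarrow> 'v \<Rightarrow> 'v) \<Rightarrow> 'g \<Rightarrow>
    ('g \<Rightarrow> 'v) \<Rightarrow> ('g \<Rightarrow> 'v)" where
  "x_cochain G H act x f = (\<lambda>h\<in>H. act x (f (inv\<^bsub>G\<^esub> x \<otimes>\<^bsub>G\<^esub> h \<otimes>\<^bsub>G\<^esub> x)))"


section \<open>The \<open>x\<close>-modules of the pair \<open>(F, \<partial>F)\<close>\<close>

type_synonym cohomology_class = "(gen word set \<Rightarrow> real^4^4) set"

definition H1_F :: "complex \<Rightarrow> complex \<Rightarrow> (real, cohomology_class) module" where
  "H1_F u z = H1 \<pi>M \<pi>F v_space (Ad_rho u z)"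

definition H1_dF :: "complex \<Rightarrow> complex \<Rightarrow> (real, cohomology_class) module" where
  "H1_dF u z = H1 \<pi>M \<pi>dF v_space (Ad_rho u z)"

definition H1_F_dF :: "complex \<Rightarrow> complex \<Rightarrow> (real, cohomology_class) module" where
  "H1_F_dF u z = H1_rel \<pi>M \<pi>F \<pi>dF v_space (Ad_rho u z)"

definition x_F :: "complex \<Rightarrow> complex \<Rightarrow> cohomology_class \<Rightarrow> cohomology_class" where
  "x_F u z = induced (Z1 \<pi>M \<pi>F v_space (Ad_rho u z)) (B1 \<pi>F v_space (Ad_rho u z))
               (x_cochain \<pi>M \<pi>F (Ad_rho u z) elt_x)"

definition x_dF :: "complex \<Rightarrow> complex \<Rightarrow> cohomology_class \<Rightarrow> cohomology_class" where
  "x_dF u z = induced (Z1 \<pi>M \<pi>dF v_space (Ad_rho u z)) (B1 \<pi>dF v_space (Ad_rho u z))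
                (x_cochain \<pi>M \<pi>dF (Ad_rho u z) elt_x)"

definition x_F_dF :: "complex \<Rightarrow> complex \<Rightarrow> cohomology_class \<Rightarrow> cohomology_class" where
  "x_F_dF u z = induced (Z1_rel \<pi>M \<pi>F \<pi>dF v_space (Ad_rho u z)) (B1_rel \<pi>F)
                  (x_cochain \<pi>M \<pi>F (Ad_rho u z) elt_x)"

text \<open>The two maps \<open>H\<^sup>1(F, \<partial>F) \<rightarrow> H\<^sup>1(F) \<rightarrow> H\<^sup>1(\<partial>F)\<close> of the long exact sequence: induced by the
  inclusion of relative cochains and by restriction.\<close>

definition rel_to_F :: "complex \<Rightarrow> complex \<Rightarrow> cohomology_class \<Rightarrow> cohomology_class" where
  "rel_to_F u z = induced (Z1 \<pi>M \<pi>F v_space (Ad_rho u z)) (B1 \<pi>F v_space (Ad_rho u z)) (\<lambda>f. f)"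

definition F_to_dF :: "complex \<Rightarrow> complex \<Rightarrow> cohomology_class \<Rightarrow> cohomology_class" where
  "F_to_dF u z = induced (Z1 \<pi>M \<pi>dF v_space (Ad_rho u z)) (B1 \<pi>dF v_space (Ad_rho u z))
                   (\<lambda>f. restrict f \<pi>dF)"

definition I_F :: "complex \<Rightarrow> complex \<Rightarrow> (real, cohomology_class) module" where
  "I_F u z = (H1_F u z)\<lparr>carrier := rel_to_F u z ` carrier (H1_F_dF u z)\<rparr>"

end

theory Submission
  imports Defs
begin

text \<open>Let \<open>k = exp u\<close>, let \<open>V\<close> be the nine-dimensional module, and let \<open>a\<close>, \<open>b\<close> generate the group of
  the fiber.

  The group of the fiber is free on \<open>a\<close> and \<open>b\<close>, so a crossed homomorphism \<open>f\<close> on it is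
  the same thing as the pair \<open>(A, B) = (f a, f b)\<close> in \<open>V \<times> V\<close>, which can be prescribed arbitrarily
  (\<open>fiber_cocycle_exists\<close>).  The coboundaries are the pairs \<open>(a w - w, b w - w)\<close>, the action of \<open>x\<close> is
  an explicit linear map of \<open>V \<times> V\<close> (\<open>x_cochain_fiber\<close>), and the value at the boundary is
  \<open>f l = b\<inverse> a\<inverse> ((b - 1) A + (1 - a) B)\<close> (\<open>fiber_cocycle_l\<close>).  All claims turn into linear algebra on
  \<open>V \<times> V\<close>.

  Exactness in the middle holds for every pair of groups, by correcting a
  cocycle with a coboundary.  Surjectivity on the right says that \<open>(b - 1) V + (1 - a) V = V\<close>, that is, that
  the fiber group has no coinvariants in \<open>V\<close>.  The trace form on \<open>V\<close> is invariant and nondegenerate, so this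
  is equivalent to the absence of invariants.  An invariant is a matrix that commutes with the Lorentz
  transformations of \<open>a\<close> and \<open>b\<close>.  The traces of \<open>a\<close> and \<open>b\<close> in \<open>SL(2,\<complex>)\<close> are \<open>1 + t\<close> and
  \<open>1 + 1 / t\<close> with \<open>t = z\<^sub>2 / k\<close>, and \<open>t\<close> is never real because both tetrahedra are positively oriented.
  This suffices to show that the commutant consists of scalars (\<open>fiber_commutant\<close>), and the only trace-free scalar matrix
  is zero.

  On the finite-dimensional space \<open>H\<^sup>1(F; V)\<close> the kernel and the cokernel of
  \<open>x - 1\<close> have the same dimension, which is the codimension in \<open>V \<times> V\<close> of the space \<open>S\<close> spanned by all
  \<open>x e - e\<close> and the coboundaries.  The boundary value maps \<open>V \<times> V\<close> onto \<open>V\<close> and \<open>S\<close> into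
  \<open>(x - 1) V + (l - 1) V\<close>, a proper subspace: its annihilator contains the operator \<open>H \<mapsto> n H n\<^sup>*\<close> with
  \<open>n = x - x\<inverse>\<close>, which is fixed by \<open>x\<close> and \<open>l\<close> (\<open>boundary_coinvariants_nonzero\<close>).  So the codimension of
  \<open>S\<close> is at least \<open>1\<close>, and if it is \<open>1\<close> then so is the codimension of \<open>(x - 1) V + (l - 1) V\<close>; in that case
  the invariants of \<open>H\<^sup>1(F; V)\<close> and of \<open>H\<^sup>1(\<partial>F; V)\<close> are both lines (\<open>invariants_one_dimensional\<close>).
  Codimension at most \<open>1\<close> is an open condition on \<open>u\<close> (\<open>eventually_trivial_annihilator\<close>).  At \<open>u = 0\<close> it is
  an explicit computation: the image of the knot group has entries in the Eisenstein integers, hence acts by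
  integer matrices on the lattice of Hermitian matrices over them, and the annihilator of \<open>S\<close> is the solution
  space of an integral linear system of rank \<open>8\<close> in \<open>9\<close> unknowns (\<open>complete_annihilator\<close>).\<close>

section \<open>Words and presented groups\<close>

lemma word_eq_context: "word_eq R v w \<Longrightarrow> word_eq R (p @ v @ s) (p @ w @ s)"
proof (induction rule: word_eq.induct)
  case (cancel v g e w)
  show ?case using word_eq.cancel[of R "p @ v" g e "w @ s"] by simp
next
  case (relator r v w)
  show ?case using word_eq.relator[OF relator, of "p @ v" "w @ s"] by simp
qed (blast intro: word_eq.intros)+

lemma word_eq_append:
  assumes "word_eq R v v'" "word_eq R w w'"
  shows "word_eq R (v @ w) (v' @ w')"
  using word_eq_context[OF assms(1), of "[]" w] word_eq_context[OF assms(2), of v' "[]"]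
  by (auto intro: word_eq.trans)

lemma equiv_word_rel: "equiv UNIV (word_rel R)"
  by (auto intro!: equivI refl_onI symI transI simp: word_rel_def
      intro: word_eq.refl word_eq.sym word_eq.trans)

lemma word_class_eq_iff: "word_rel R `` {v} = word_rel R `` {w} \<longleftrightarrow> word_eq R v w"
  using eq_equiv_class_iff[OF equiv_word_rel, of v w R] by (simp add: word_rel_def)

lemma presented_group_mult:
  "word_rel R `` {v} \<otimes>\<^bsub>presented_group R\<^esub> word_rel R `` {w} = word_rel R `` {v @ w}"
proof -
  have "word_rel R `` {v' @ w'} = word_rel R `` {v @ w}"
    if "v' \<in> word_rel R `` {v}" "w' \<in> word_rel R `` {w}" for v' w'
  proof -
    have "word_eq R v v'" "word_eq R w w'" using that by (simp_all add: word_rel_def)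
    from word_eq_append[OF this] show ?thesis unfolding word_class_eq_iff by (rule word_eq.sym)
  qed
  then have "(\<Union>v'\<in>word_rel R `` {v}. \<Union>w'\<in>word_rel R `` {w}. word_rel R `` {v' @ w'})
      = (\<Union>v'\<in>word_rel R `` {v}. \<Union>w'\<in>word_rel R `` {w}. word_rel R `` {v @ w})" by simp
  also have "\<dots> = word_rel R `` {v @ w}"
  proof -
    have "v \<in> word_rel R `` {v}" "w \<in> word_rel R `` {w}" by (simp_all add: word_rel_def word_eq.refl)
    then show ?thesis by blast
  qed
  finally show ?thesis by (simp add: presented_group_def)
qed

lemma presented_group_carrier:
  "g \<in> carrier (presented_group R) \<longleftrightarrow> (\<exists>w. g = word_rel R `` {w})"
  unfolding presented_group_def quotient_def by auto

lemma class_in_carrier: "word_rel R `` {w} \<in> carrier (presented_group R)"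
  by (auto simp: presented_group_carrier)

lemma presented_group_one: "\<one>\<^bsub>presented_group R\<^esub> = word_rel R `` {[]}"
  by (simp add: presented_group_def)

lemma word_inv_simps: "word_inv [] = []" "word_inv ((g, e) # w) = word_inv w @ [(g, \<not> e)]"
  "word_inv (v @ w) = word_inv w @ word_inv v"
  by (auto simp: word_inv_def)

lemma word_inv_left: "word_eq R (word_inv w @ w) []"
proof (induction w)
  case Nil
  show ?case by (simp add: word_inv_simps word_eq.refl)
next
  case (Cons c w)
  obtain g e where c: "c = (g, e)" by force
  have "word_eq R (word_inv w @ [(g, \<not> e), (g, \<not> \<not> e)] @ w) (word_inv w @ w)"
    by (rule word_eq.cancel)
  then show ?case using Cons by (auto simp: c word_inv_simps intro: word_eq.trans)
qed

lemma presented_group_group: "group (presented_group R)"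
proof (rule groupI)
  fix g assume "g \<in> carrier (presented_group R)"
  then obtain w where w: "g = word_rel R `` {w}" by (auto simp: presented_group_carrier)
  have "word_rel R `` {word_inv w} \<otimes>\<^bsub>presented_group R\<^esub> g = \<one>\<^bsub>presented_group R\<^esub>"
    unfolding w presented_group_mult presented_group_one word_class_eq_iff by (rule word_inv_left)
  then show "\<exists>h\<in>carrier (presented_group R). h \<otimes>\<^bsub>presented_group R\<^esub> g = \<one>\<^bsub>presented_group R\<^esub>"
    using class_in_carrier by blast
next
  fix f g h
  assume "f \<in> carrier (presented_group R)" "g \<in> carrier (presented_group R)" "h \<in> carrier (presented_group R)"
  then show "f \<otimes>\<^bsub>presented_group R\<^esub> g \<otimes>\<^bsub>presented_group R\<^esub> h =
     f \<otimes>\<^bsub>presented_group R\<^esub> (g \<otimes>\<^bsub>presented_group R\<^esub> h)"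
    by (auto simp only: presented_group_carrier presented_group_mult append_assoc)
next
  fix f g
  assume "f \<in> carrier (presented_group R)" "g \<in> carrier (presented_group R)"
  then show "f \<otimes>\<^bsub>presented_group R\<^esub> g \<in> carrier (presented_group R)"
    by (auto simp only: presented_group_carrier presented_group_mult)
next
  fix f assume "f \<in> carrier (presented_group R)"
  then show "\<one>\<^bsub>presented_group R\<^esub> \<otimes>\<^bsub>presented_group R\<^esub> f = f"
    by (auto simp only: presented_group_carrier presented_group_mult presented_group_one append_Nil)
qed (simp add: presented_group_one class_in_carrier)

lemma presented_group_inv:
  "inv\<^bsub>presented_group R\<^esub> (word_rel R `` {w}) = word_rel R `` {word_inv w}"
proof (rule group.inv_equality[OF presented_group_group])
  show "word_rel R `` {word_inv w} \<otimes>\<^bsub>presented_group R\<^esub> (word_rel R `` {w}) = \<one>\<^bsub>presented_group R\<^esub>"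
    unfolding presented_group_mult presented_group_one word_class_eq_iff by (rule word_inv_left)
qed (rule class_in_carrier)+

text \<open>The universal property: letting each letter act by an invertible map defines an action of the presented
  group once the relators act trivially.  It is used for the matrices of the representation and for the
  affine action from which crossed homomorphisms are built.\<close>

lemma word_eq_foldr:
  assumes "word_eq R v w"
    and "\<And>g e s. act (g, e) (act (g, \<not> e) s) = s"
    and "\<And>r s. r \<in> R \<Longrightarrow> foldr act r s = s"
  shows "foldr act v s = foldr act w s"
  using assms(1) by (induction arbitrary: s rule: word_eq.induct) (auto simp: assms(2,3))

section \<open>The monodromy of the figure-eight knot\<close>

text \<open>Substituting \<open>y = b\<inverse> x\<close> in \<open>a x = y a\<close> and in the definition of \<open>a\<close> turns them into formulas for
  conjugation by \<open>x\<close>, the monodromy of the fiber.  Since \<open>a b l = b a\<close>, these formulas in turn give that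
  \<open>x\<close> commutes with \<open>l\<close>.\<close>

lemma (in group) fig8_relations:
  assumes x: "x \<in> carrier G" and y: "y \<in> carrier G"
    and a: "a = x \<otimes> inv y \<otimes> inv x \<otimes> y" and b: "b = x \<otimes> inv y"
    and l: "l = inv b \<otimes> inv a \<otimes> b \<otimes> a" and rel: "a \<otimes> x = y \<otimes> a"
  shows "x \<otimes> a = b \<otimes> a \<otimes> x" "x \<otimes> b = b \<otimes> a \<otimes> b \<otimes> x" "x \<otimes> l = l \<otimes> x"
proof -
  have ab: "a \<in> carrier G" "b \<in> carrier G" using x y a b by auto
  have cancel: "inv p \<otimes> (p \<otimes> q) = q" "p \<otimes> (inv p \<otimes> q) = q" if "p \<in> carrier G" "q \<in> carrier G" for p q
    using that by (simp_all add: m_assoc[symmetric])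
  have bya: "b \<otimes> y = x" using x y by (simp add: b m_assoc)
  have "x \<otimes> a = b \<otimes> (y \<otimes> a)" using x y ab bya by (simp add: m_assoc[symmetric])
  also have "\<dots> = b \<otimes> a \<otimes> x" using x y ab by (simp add: rel[symmetric] m_assoc)
  finally show 1: "x \<otimes> a = b \<otimes> a \<otimes> x" .
  have "y \<otimes> b = y \<otimes> a \<otimes> inv y \<otimes> x" unfolding a b using x y by (simp add: m_assoc cancel)
  also have "\<dots> = a \<otimes> b \<otimes> x" using x y ab unfolding rel[symmetric] b by (simp add: m_assoc)
  finally have 3: "y \<otimes> b = a \<otimes> b \<otimes> x" .
  have "x \<otimes> b = b \<otimes> (y \<otimes> b)" using x y ab bya by (simp add: m_assoc[symmetric])
  then show 2: "x \<otimes> b = b \<otimes> a \<otimes> b \<otimes> x" using x y ab by (simp add: 3 m_assoc[symmetric])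
  have l': "a \<otimes> b \<otimes> l = b \<otimes> a" "l \<in> carrier G" using ab unfolding l by (simp_all add: m_assoc cancel)
  have "x \<otimes> (a \<otimes> b) = b \<otimes> a \<otimes> b \<otimes> a \<otimes> b \<otimes> x"
    using 1 2 x ab by (simp add: m_assoc[symmetric]) (simp add: m_assoc)
  have "b \<otimes> a \<otimes> b \<otimes> a \<otimes> b \<otimes> (x \<otimes> l) = x \<otimes> (a \<otimes> b) \<otimes> l"
    using x ab l' \<open>x \<otimes> (a \<otimes> b) = _\<close> by (simp add: m_assoc)
  also have "\<dots> = x \<otimes> b \<otimes> a" using l' x ab by (simp add: m_assoc)
  also have "\<dots> = b \<otimes> a \<otimes> b \<otimes> (x \<otimes> a)" using 2 x ab by (simp add: m_assoc)
  also have "\<dots> = b \<otimes> a \<otimes> b \<otimes> (a \<otimes> b \<otimes> l) \<otimes> x" using x ab l' 1 by (simp add: m_assoc)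
  also have "\<dots> = b \<otimes> a \<otimes> b \<otimes> a \<otimes> b \<otimes> (l \<otimes> x)" using x ab l'(2) by (simp add: m_assoc)
  finally show "x \<otimes> l = l \<otimes> x" using x ab l'(2) by simp
qed

section \<open>Real vector spaces given by records\<close>

lemma real_ring_field: "field real_ring"
proof -
  have "cring real_ring"
  proof (rule cringI)
    show "abelian_group real_ring"
    proof (rule abelian_groupI)
      fix x assume "x \<in> carrier real_ring"
      show "\<exists>y\<in>carrier real_ring. y \<oplus>\<^bsub>real_ring\<^esub> x = \<zero>\<^bsub>real_ring\<^esub>"
        by (intro bexI[of _ "-x"]) (simp_all add: real_ring_def)
    qed (simp_all add: real_ring_def)
    show "Group.comm_monoid real_ring"
      by (rule comm_monoidI) (simp_all add: real_ring_def)
  qed (simp add: real_ring_def algebra_simps)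
  then show ?thesis
  proof (rule cring.cring_fieldI2)
    fix x assume "x \<in> carrier real_ring" "x \<noteq> \<zero>\<^bsub>real_ring\<^esub>"
    then show "\<exists>y\<in>carrier real_ring. x \<otimes>\<^bsub>real_ring\<^esub> y = \<one>\<^bsub>real_ring\<^esub>"
      by (intro bexI[of _ "1/x"]) (simp_all add: real_ring_def)
  qed (simp add: real_ring_def)
qed

lemma vectorspace_realI:
  fixes M :: "(real, 'a) module"
  assumes "\<And>f g. f \<in> carrier M \<Longrightarrow> g \<in> carrier M \<Longrightarrow> f \<oplus>\<^bsub>M\<^esub> g \<in> carrier M"
    "\<zero>\<^bsub>M\<^esub> \<in> carrier M"
    "\<And>c f. f \<in> carrier M \<Longrightarrow> c \<odot>\<^bsub>M\<^esub> f \<in> carrier M"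
    "\<And>f g h. f \<in> carrier M \<Longrightarrow> g \<in> carrier M \<Longrightarrow> h \<in> carrier M \<Longrightarrow>
      f \<oplus>\<^bsub>M\<^esub> g \<oplus>\<^bsub>M\<^esub> h = f \<oplus>\<^bsub>M\<^esub> (g \<oplus>\<^bsub>M\<^esub> h)"
    "\<And>f g. f \<in> carrier M \<Longrightarrow> g \<in> carrier M \<Longrightarrow> f \<oplus>\<^bsub>M\<^esub> g = g \<oplus>\<^bsub>M\<^esub> f"
    "\<And>f. f \<in> carrier M \<Longrightarrow> \<zero>\<^bsub>M\<^esub> \<oplus>\<^bsub>M\<^esub> f = f"
    "\<And>f. f \<in> carrier M \<Longrightarrow> (-1) \<odot>\<^bsub>M\<^esub> f \<oplus>\<^bsub>M\<^esub> f = \<zero>\<^bsub>M\<^esub>"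
    "\<And>c d f. f \<in> carrier M \<Longrightarrow> (c + d) \<odot>\<^bsub>M\<^esub> f = c \<odot>\<^bsub>M\<^esub> f \<oplus>\<^bsub>M\<^esub> d \<odot>\<^bsub>M\<^esub> f"
    "\<And>c f g. f \<in> carrier M \<Longrightarrow> g \<in> carrier M \<Longrightarrow> c \<odot>\<^bsub>M\<^esub> (f \<oplus>\<^bsub>M\<^esub> g) = c \<odot>\<^bsub>M\<^esub> f \<oplus>\<^bsub>M\<^esub> c \<odot>\<^bsub>M\<^esub> g"
    "\<And>c d f. f \<in> carrier M \<Longrightarrow> (c * d) \<odot>\<^bsub>M\<^esub> f = c \<odot>\<^bsub>M\<^esub> (d \<odot>\<^bsub>M\<^esub> f)"
    "\<And>f. f \<in> carrier M \<Longrightarrow> 1 \<odot>\<^bsub>M\<^esub> f = f"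
  shows "vectorspace real_ring M"
proof -
  have "module real_ring M"
  proof (rule moduleI)
    show "cring real_ring" using real_ring_field by (simp add: field_def domain_def)
    show "abelian_group M"
      by (rule abelian_groupI) (use assms in blast)+
  qed (use assms in \<open>simp_all add: real_ring_def\<close>)
  then show ?thesis using real_ring_field by (simp add: vectorspace_def)
qed

lemma vectorspace_realD:
  fixes M :: "(real, 'a) module"
  assumes "vectorspace real_ring M"
  shows "abelian_group M"
    "\<And>c f. f \<in> carrier M \<Longrightarrow> c \<odot>\<^bsub>M\<^esub> f \<in> carrier M"
    "\<And>c d f. f \<in> carrier M \<Longrightarrow> (c + d) \<odot>\<^bsub>M\<^esub> f = c \<odot>\<^bsub>M\<^esub> f \<oplus>\<^bsub>M\<^esub> d \<odot>\<^bsub>M\<^esub> f"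
    "\<And>c f g. f \<in> carrier M \<Longrightarrow> g \<in> carrier M \<Longrightarrow> c \<odot>\<^bsub>M\<^esub> (f \<oplus>\<^bsub>M\<^esub> g) = c \<odot>\<^bsub>M\<^esub> f \<oplus>\<^bsub>M\<^esub> c \<odot>\<^bsub>M\<^esub> g"
    "\<And>c d f. f \<in> carrier M \<Longrightarrow> (c * d) \<odot>\<^bsub>M\<^esub> f = c \<odot>\<^bsub>M\<^esub> (d \<odot>\<^bsub>M\<^esub> f)"
    "\<And>f. f \<in> carrier M \<Longrightarrow> 1 \<odot>\<^bsub>M\<^esub> f = f"
    "\<And>f. f \<in> carrier M \<Longrightarrow> (-1) \<odot>\<^bsub>M\<^esub> f = \<ominus>\<^bsub>M\<^esub> f"
    "\<And>c. c \<odot>\<^bsub>M\<^esub> \<zero>\<^bsub>M\<^esub> = \<zero>\<^bsub>M\<^esub>"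
    "\<And>f. f \<in> carrier M \<Longrightarrow> 0 \<odot>\<^bsub>M\<^esub> f = \<zero>\<^bsub>M\<^esub>"
proof -
  interpret vectorspace real_ring M by fact
  have R: "\<one>\<^bsub>real_ring\<^esub> = 1" "\<zero>\<^bsub>real_ring\<^esub> = 0" "carrier real_ring = UNIV" "\<And>c d. c \<oplus>\<^bsub>real_ring\<^esub> d = c + d"
     "\<And>c d. c \<otimes>\<^bsub>real_ring\<^esub> d = c * d"
    by (simp_all add: real_ring_def)
  have "\<ominus>\<^bsub>real_ring\<^esub> 1 = -1"
    by (rule sum_zero_eq_neg[symmetric]) (auto simp: R)
  show "abelian_group M" ..
  show cl: "\<And>c f. f \<in> carrier M \<Longrightarrow> c \<odot>\<^bsub>M\<^esub> f \<in> carrier M" using smult_closed by (simp add: R)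
  show "\<And>c d f. f \<in> carrier M \<Longrightarrow> (c + d) \<odot>\<^bsub>M\<^esub> f = c \<odot>\<^bsub>M\<^esub> f \<oplus>\<^bsub>M\<^esub> d \<odot>\<^bsub>M\<^esub> f"
    using smult_l_distr by (simp add: R)
  show "\<And>c f g. f \<in> carrier M \<Longrightarrow> g \<in> carrier M \<Longrightarrow> c \<odot>\<^bsub>M\<^esub> (f \<oplus>\<^bsub>M\<^esub> g) = c \<odot>\<^bsub>M\<^esub> f \<oplus>\<^bsub>M\<^esub> c \<odot>\<^bsub>M\<^esub> g"
    using smult_r_distr by (simp add: R)
  show "\<And>c d f. f \<in> carrier M \<Longrightarrow> (c * d) \<odot>\<^bsub>M\<^esub> f = c \<odot>\<^bsub>M\<^esub> (d \<odot>\<^bsub>M\<^esub> f)"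
    using smult_assoc1 by (simp add: R)
  show "\<And>f. f \<in> carrier M \<Longrightarrow> 1 \<odot>\<^bsub>M\<^esub> f = f"
    using smult_one by (simp add: R)
  show "\<And>f. f \<in> carrier M \<Longrightarrow> (-1) \<odot>\<^bsub>M\<^esub> f = \<ominus>\<^bsub>M\<^esub> f"
    using smult_minus_1 \<open>\<ominus>\<^bsub>real_ring\<^esub> 1 = -1\<close> by (simp add: R)
  show "\<And>c. c \<odot>\<^bsub>M\<^esub> \<zero>\<^bsub>M\<^esub> = \<zero>\<^bsub>M\<^esub>" using smult_r_null by (simp add: R)
  show "\<And>f. f \<in> carrier M \<Longrightarrow> 0 \<odot>\<^bsub>M\<^esub> f = \<zero>\<^bsub>M\<^esub>" using smult_l_null by (simp add: R)
qed

lemma module_hom_realI: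
  assumes "\<And>f. f \<in> carrier M \<Longrightarrow> \<phi> f \<in> carrier N"
    "\<And>f g. f \<in> carrier M \<Longrightarrow> g \<in> carrier M \<Longrightarrow> \<phi> (f \<oplus>\<^bsub>M\<^esub> g) = \<phi> f \<oplus>\<^bsub>N\<^esub> \<phi> g"
    "\<And>c f. f \<in> carrier M \<Longrightarrow> \<phi> (c \<odot>\<^bsub>M\<^esub> f) = c \<odot>\<^bsub>N\<^esub> \<phi> f"
  shows "\<phi> \<in> module_hom real_ring M N"
  using assms by (auto simp: module_hom_def)

lemma module_hom_realD:
  assumes "\<phi> \<in> module_hom real_ring M N"
  shows "\<And>f. f \<in> carrier M \<Longrightarrow> \<phi> f \<in> carrier N"
    "\<And>f g. f \<in> carrier M \<Longrightarrow> g \<in> carrier M \<Longrightarrow> \<phi> (f \<oplus>\<^bsub>M\<^esub> g) = \<phi> f \<oplus>\<^bsub>N\<^esub> \<phi> g"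
    "\<And>c f. f \<in> carrier M \<Longrightarrow> \<phi> (c \<odot>\<^bsub>M\<^esub> f) = c \<odot>\<^bsub>N\<^esub> \<phi> f"
  using assms by (auto simp: module_hom_def real_ring_def)

lemma module_hom_zero:
  fixes M :: "(real, 'a) module" and N :: "(real, 'b) module"
  assumes "vectorspace real_ring M" "vectorspace real_ring N" "\<phi> \<in> module_hom real_ring M N"
  shows "\<phi> \<zero>\<^bsub>M\<^esub> = \<zero>\<^bsub>N\<^esub>"
proof -
  have z: "\<zero>\<^bsub>M\<^esub> \<in> carrier M" using vectorspace_realD(1)[OF assms(1)]
    by (simp add: abelian_group.axioms(1) abelian_monoid.zero_closed)
  have "\<phi> (0 \<odot>\<^bsub>M\<^esub> \<zero>\<^bsub>M\<^esub>) = 0 \<odot>\<^bsub>N\<^esub> \<phi> \<zero>\<^bsub>M\<^esub>"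
    by (rule module_hom_realD(3)[OF assms(3) z])
  then show ?thesis
    using vectorspace_realD(9)[OF assms(1) z] vectorspace_realD(9)[OF assms(2) module_hom_realD(1)[OF assms(3) z]]
    by simp
qed

definition linear_subset :: "(real, 'a) module \<Rightarrow> 'a set \<Rightarrow> bool" where
  "linear_subset M B \<longleftrightarrow> B \<subseteq> carrier M \<and> \<zero>\<^bsub>M\<^esub> \<in> B \<and>
     (\<forall>f\<in>B. \<forall>g\<in>B. f \<oplus>\<^bsub>M\<^esub> g \<in> B) \<and> (\<forall>c. \<forall>f\<in>B. c \<odot>\<^bsub>M\<^esub> f \<in> B)"

lemma linear_subset_vectorspace:
  assumes M: "vectorspace real_ring M" and B: "linear_subset M B"
  shows "vectorspace real_ring (M\<lparr>carrier := B\<rparr>)"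
proof -
  interpret vectorspace real_ring M by fact
  have "submodule real_ring B M"
    by (rule submodule.intro) (use B in \<open>auto simp: linear_subset_def module_axioms\<close>)
  then show ?thesis using M by (intro subspace_is_vs VectorSpace.subspace.intro)
qed

text \<open>With the coset map as \<open>\<phi>\<close> this makes a quotient a vector space, and with a linear map it does the same
  for its image.\<close>

lemma vectorspace_image:
  fixes M :: "(real, 'a) module" and N :: "(real, 'b) module"
  assumes M: "vectorspace real_ring M"
    and surj: "carrier N = \<phi> ` carrier M" and z: "\<phi> \<zero>\<^bsub>M\<^esub> = \<zero>\<^bsub>N\<^esub>"
    and add: "\<And>f g. f \<in> carrier M \<Longrightarrow> g \<in> carrier M \<Longrightarrow> \<phi> f \<oplus>\<^bsub>N\<^esub> \<phi> g = \<phi> (f \<oplus>\<^bsub>M\<^esub> g)"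
    and smult: "\<And>c f. f \<in> carrier M \<Longrightarrow> c \<odot>\<^bsub>N\<^esub> \<phi> f = \<phi> (c \<odot>\<^bsub>M\<^esub> f)"
  shows "vectorspace real_ring N"
proof -
  note D = vectorspace_realD[OF M]
  interpret abelian_group M by (rule D(1))
  show ?thesis
  proof (rule vectorspace_realI)
    fix f g assume "f \<in> carrier N" "g \<in> carrier N"
    then obtain f' g' where "f = \<phi> f'" "g = \<phi> g'" "f' \<in> carrier M" "g' \<in> carrier M" by (auto simp: surj)
    then show "f \<oplus>\<^bsub>N\<^esub> g = g \<oplus>\<^bsub>N\<^esub> f" by (simp add: add a_comm)
  qed (auto simp: surj z[symmetric] add smult D a_assoc l_neg)
qed

lemma linear_subset_abelian_subgroup:
  assumes M: "vectorspace real_ring M" and B: "linear_subset M B"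
  shows "abelian_subgroup B M"
proof -
  note D = vectorspace_realD[OF M]
  interpret abelian_group M by (rule D(1))
  have "\<ominus>\<^bsub>M\<^esub> f \<in> B" if "f \<in> B" for f
  proof -
    have "f \<in> carrier M" "(-1) \<odot>\<^bsub>M\<^esub> f \<in> B" using that B by (auto simp: linear_subset_def)
    then show ?thesis using D(7)[of f] by simp
  qed
  then have "additive_subgroup B M"
    using B by (auto simp: linear_subset_def additive_subgroup_def a_inv_def intro!: add.subgroupI)
  then show ?thesis using D(1) by (rule abelian_subgroupI3)
qed

lemma UN_const_on:
  assumes "\<And>y. y \<in> A \<Longrightarrow> F y = F x" "x \<in> A"
  shows "(\<Union>y\<in>A. F y) = F x"
  using assms by blast

lemma (in abelian_group) minus_zero_eq: "\<ominus> \<zero> = \<zero>"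
  using r_neg[of \<zero>] by simp

lemma coset_absorb:
  assumes M: "vectorspace real_ring M" and B: "linear_subset M B"
    and "b \<in> B" "f \<in> carrier M" shows "B +>\<^bsub>M\<^esub> (b \<oplus>\<^bsub>M\<^esub> f) = B +>\<^bsub>M\<^esub> f"
proof -
  interpret abelian_subgroup B M
    by (rule linear_subset_abelian_subgroup[OF M B])
  have "B +>\<^bsub>M\<^esub> (b \<oplus>\<^bsub>M\<^esub> f) = (B +>\<^bsub>M\<^esub> b) +>\<^bsub>M\<^esub> f"
    by (rule a_coset_add_assoc[symmetric]) (use assms a_subset in auto)
  then show ?thesis using a_rcos_const[OF assms(3)] by simp
qed

context
  fixes M :: "(real, 'a) module" and B
  assumes M: "vectorspace real_ring M" and B: "linear_subset M B"
begin

interpretation abelian_subgroup B M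
  by (rule linear_subset_abelian_subgroup[OF M B])

lemma coset_eq_iff:
  assumes "f \<in> carrier M" "g \<in> carrier M"
  shows "B +>\<^bsub>M\<^esub> f = B +>\<^bsub>M\<^esub> g \<longleftrightarrow> f \<ominus>\<^bsub>M\<^esub> g \<in> B"
proof
  assume "B +>\<^bsub>M\<^esub> f = B +>\<^bsub>M\<^esub> g"
  then have "f \<in> B +>\<^bsub>M\<^esub> g" using a_rcos_self[OF assms(1)] by simp
  then show "f \<ominus>\<^bsub>M\<^esub> g \<in> B"
    using a_rcos_module_imp[OF assms(2)] by (simp add: a_minus_def)
next
  assume *: "f \<ominus>\<^bsub>M\<^esub> g \<in> B"
  have "f = (f \<ominus>\<^bsub>M\<^esub> g) \<oplus>\<^bsub>M\<^esub> g" using assms by (simp add: a_minus_def a_assoc l_neg)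
  with coset_absorb[OF M B * assms(2)] show "B +>\<^bsub>M\<^esub> f = B +>\<^bsub>M\<^esub> g" by simp
qed

lemma quotient_carrier: "carrier (quotient_module M B) = (\<lambda>f. B +>\<^bsub>M\<^esub> f) ` carrier M"
  by (auto simp: quotient_module_def A_RCOSETS_def')

lemma quotient_zero: "\<zero>\<^bsub>quotient_module M B\<^esub> = B +>\<^bsub>M\<^esub> \<zero>\<^bsub>M\<^esub>"
  by (simp add: quotient_module_def a_coset_add_zero a_subset)

lemma quotient_add:
  "f \<in> carrier M \<Longrightarrow> g \<in> carrier M \<Longrightarrow>
   (B +>\<^bsub>M\<^esub> f) \<oplus>\<^bsub>quotient_module M B\<^esub> (B +>\<^bsub>M\<^esub> g) = B +>\<^bsub>M\<^esub> (f \<oplus>\<^bsub>M\<^esub> g)"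
  by (simp add: quotient_module_def a_rcos_sum)

lemma coset_memD: "f' \<in> B +>\<^bsub>M\<^esub> f \<Longrightarrow> f \<in> carrier M \<Longrightarrow> \<exists>b\<in>B. f' = b \<oplus>\<^bsub>M\<^esub> f"
  by (auto simp: a_r_coset_def')

lemma quotient_smult:
  assumes f: "f \<in> carrier M"
  shows "c \<odot>\<^bsub>quotient_module M B\<^esub> (B +>\<^bsub>M\<^esub> f) = B +>\<^bsub>M\<^esub> (c \<odot>\<^bsub>M\<^esub> f)"
proof -
  note D = vectorspace_realD[OF M]
  have "B +>\<^bsub>M\<^esub> (c \<odot>\<^bsub>M\<^esub> f') = B +>\<^bsub>M\<^esub> (c \<odot>\<^bsub>M\<^esub> f)" if f': "f' \<in> B +>\<^bsub>M\<^esub> f" for f'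
  proof -
    obtain b where b: "b \<in> B" "f' = b \<oplus>\<^bsub>M\<^esub> f" using coset_memD[OF f' f] by auto
    then show ?thesis using D(4)[of b f c] B f coset_absorb[OF M B, of "c \<odot>\<^bsub>M\<^esub> b" "c \<odot>\<^bsub>M\<^esub> f"]
      by (auto simp: linear_subset_def a_Hcarr D(2))
  qed
  moreover have "f \<in> B +>\<^bsub>M\<^esub> f" by (rule a_rcos_self[OF f])
  ultimately have "(\<Union>f'\<in>B +>\<^bsub>M\<^esub> f. B +>\<^bsub>M\<^esub> (c \<odot>\<^bsub>M\<^esub> f')) = B +>\<^bsub>M\<^esub> (c \<odot>\<^bsub>M\<^esub> f)"
    by (rule UN_const_on)
  then show ?thesis by (simp add: quotient_module_def)
qed

lemma quotient_vectorspace: "vectorspace real_ring (quotient_module M B)"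
  by (rule vectorspace_image[OF M, of _ "\<lambda>f. B +>\<^bsub>M\<^esub> f"])
    (simp_all add: quotient_carrier quotient_zero quotient_add quotient_smult)

lemma coset_eq_zero_iff:
  assumes "f \<in> carrier M"
  shows "B +>\<^bsub>M\<^esub> f = \<zero>\<^bsub>quotient_module M B\<^esub> \<longleftrightarrow> f \<in> B"
  using assms coset_eq_iff[OF assms, of "\<zero>\<^bsub>M\<^esub>"] by (simp add: quotient_zero a_minus_def minus_zero_eq)

end

context
  fixes M :: "(real, 'a) module" and B
  assumes M: "vectorspace real_ring M" and B: "linear_subset M B"
begin

interpretation abelian_subgroup B M
  by (rule linear_subset_abelian_subgroup[OF M B])

lemma induced_coset:
  assumes "\<phi> \<in> module_hom real_ring M N" "vectorspace real_ring N" "linear_subset N C" "\<phi> ` B \<subseteq> C"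
    and f: "f \<in> carrier M"
  shows "induced N C \<phi> (B +>\<^bsub>M\<^esub> f) = C +>\<^bsub>N\<^esub> \<phi> f"
proof -
  interpret N: abelian_subgroup C N
    by (rule linear_subset_abelian_subgroup[OF assms(2,3)])
  note hom = module_hom_realD[OF assms(1)]
  have "C +>\<^bsub>N\<^esub> \<phi> f' = C +>\<^bsub>N\<^esub> \<phi> f" if f': "f' \<in> B +>\<^bsub>M\<^esub> f" for f'
  proof -
    obtain b where b: "b \<in> B" "f' = b \<oplus>\<^bsub>M\<^esub> f" using coset_memD[OF M B f' f] by auto
    then have "\<phi> f' = \<phi> b \<oplus>\<^bsub>N\<^esub> \<phi> f" using f by (simp add: hom a_Hcarr)
    moreover have "\<phi> b \<in> C" using b assms(4) by auto
    ultimately show ?thesis using hom(1)[OF f] coset_absorb[OF assms(2,3)] by simp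
  qed
  then show ?thesis unfolding induced_def using a_rcos_self[OF f] by (rule UN_const_on)
qed

lemma induced_module_hom:
  assumes \<phi>: "\<phi> \<in> module_hom real_ring M N" and N: "vectorspace real_ring N" "linear_subset N C"
    and BC: "\<phi> ` B \<subseteq> C"
  shows "induced N C \<phi> \<in> module_hom real_ring (quotient_module M B) (quotient_module N C)"
proof -
  note ind = induced_coset[OF \<phi> N BC] and hom = module_hom_realD[OF \<phi>] and D = vectorspace_realD[OF M]
  interpret MM: abelian_group M by (rule D(1))
  show ?thesis
  proof (rule module_hom_realI)
    fix X Y assume "X \<in> carrier (quotient_module M B)" "Y \<in> carrier (quotient_module M B)"
    then obtain f g where fg: "X = B +>\<^bsub>M\<^esub> f" "Y = B +>\<^bsub>M\<^esub> g" "f \<in> carrier M" "g \<in> carrier M"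
      by (auto simp: quotient_carrier[OF M B])
    then have "f \<oplus>\<^bsub>M\<^esub> g \<in> carrier M" by simp
    with fg show "induced N C \<phi> (X \<oplus>\<^bsub>quotient_module M B\<^esub> Y)
       = induced N C \<phi> X \<oplus>\<^bsub>quotient_module N C\<^esub> induced N C \<phi> Y"
      by (simp add: quotient_add[OF M B] ind hom quotient_add[OF N])
  next
    fix X c assume "X \<in> carrier (quotient_module M B)"
    then obtain f where f: "X = B +>\<^bsub>M\<^esub> f" "f \<in> carrier M" by (auto simp: quotient_carrier[OF M B])
    then have "c \<odot>\<^bsub>M\<^esub> f \<in> carrier M" by (simp add: D)
    with f show "induced N C \<phi> (c \<odot>\<^bsub>quotient_module M B\<^esub> X)
       = c \<odot>\<^bsub>quotient_module N C\<^esub> induced N C \<phi> X"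
      by (simp add: quotient_smult[OF M B] ind hom quotient_smult[OF N])
    show "induced N C \<phi> X \<in> carrier (quotient_module N C)"
      using f by (simp add: ind hom quotient_carrier[OF N])
  qed
qed

end

text \<open>The inverse of the induced map is induced by the inverse of \<open>T\<close>, which is why both maps have to preserve
  \<open>B\<close>.\<close>

lemma quotient_x_module:
  fixes M :: "(real, 'a) module"
  assumes M: "vectorspace real_ring M" and B: "linear_subset M B"
    and T: "T \<in> module_hom real_ring M M" "T ` B \<subseteq> B"
    and T': "T' \<in> module_hom real_ring M M" "T' ` B \<subseteq> B"
    and inv: "\<And>f. f \<in> carrier M \<Longrightarrow> T (T' f) = f" "\<And>f. f \<in> carrier M \<Longrightarrow> T' (T f) = f"
  shows "x_module (quotient_module M B) (induced M B T)"
proof -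
  note Q = quotient_carrier[OF M B] and ind = induced_coset[OF M B T(1) M B T(2)] induced_coset[OF M B T'(1) M B T'(2)]
  note hom = module_hom_realD(1)[OF T(1)] module_hom_realD(1)[OF T'(1)]
  have "bij_betw (induced M B T) (carrier (quotient_module M B)) (carrier (quotient_module M B))"
    by (rule bij_betw_byWitness[where f' = "induced M B T'"]) (auto simp: Q ind hom inv)
  then show ?thesis
    using quotient_vectorspace[OF M B] induced_module_hom[OF M B T(1) M B T(2)] by (simp add: x_module_def)
qed

lemma induced_x_module_hom:
  fixes M :: "(real, 'a) module" and N :: "(real, 'b) module"
  assumes M: "vectorspace real_ring M" and B: "linear_subset M B"
    and N: "vectorspace real_ring N" and C: "linear_subset N C"
    and S: "S \<in> module_hom real_ring M M" "S ` B \<subseteq> B"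
    and T: "T \<in> module_hom real_ring N N" "T ` C \<subseteq> C"
    and xm: "x_module (quotient_module M B) (induced M B S)" "x_module (quotient_module N C) (induced N C T)"
    and \<phi>: "\<phi> \<in> module_hom real_ring M N" "\<phi> ` B \<subseteq> C"
    and comm: "\<And>f. f \<in> carrier M \<Longrightarrow> \<phi> (S f) = T (\<phi> f)"
  shows "x_module_hom (quotient_module M B) (induced M B S) (quotient_module N C) (induced N C T) (induced N C \<phi>)"
  using xm induced_module_hom[OF M B \<phi>(1) N C \<phi>(2)] module_hom_realD(1)[OF \<phi>(1)] module_hom_realD(1)[OF S(1)]
    induced_coset[OF M B \<phi>(1) N C \<phi>(2)] induced_coset[OF M B S(1) M B S(2)] induced_coset[OF N C T(1) N C T(2)]
  by (auto simp: x_module_hom_def quotient_carrier[OF M B] comm)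

lemma image_x_module:
  fixes M :: "(real, 'a) module" and N :: "(real, 'b) module"
  assumes "x_module_hom M S N T \<phi>"
  shows "x_module (N\<lparr>carrier := \<phi> ` carrier M\<rparr>) T"
proof -
  have M: "vectorspace real_ring M" and N: "vectorspace real_ring N"
    and S: "S \<in> module_hom real_ring M M" "bij_betw S (carrier M) (carrier M)"
    and T: "T \<in> module_hom real_ring N N" "bij_betw T (carrier N) (carrier N)"
    and \<phi>: "\<phi> \<in> module_hom real_ring M N" and comm: "\<And>m. m \<in> carrier M \<Longrightarrow> \<phi> (S m) = T (\<phi> m)"
    using assms by (auto simp: x_module_hom_def x_module_def)
  note hom = module_hom_realD[OF \<phi>]
  have vs: "vectorspace real_ring (N\<lparr>carrier := \<phi> ` carrier M\<rparr>)"
    by (rule vectorspace_image[OF M, of _ \<phi>]) (simp_all add: hom module_hom_zero[OF M N \<phi>])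
  have sub: "\<phi> ` carrier M \<subseteq> carrier N" using hom(1) by auto
  have "T ` \<phi> ` carrier M = \<phi> ` S ` carrier M"
    unfolding image_image by (rule image_cong) (simp_all add: comm)
  then have im: "T ` \<phi> ` carrier M = \<phi> ` carrier M" using S(2) by (simp add: bij_betw_def)
  have "bij_betw T (\<phi> ` carrier M) (\<phi> ` carrier M)"
    using im T(2) sub by (auto simp: bij_betw_def intro: inj_on_subset)
  moreover have "T \<in> module_hom real_ring (N\<lparr>carrier := \<phi> ` carrier M\<rparr>) (N\<lparr>carrier := \<phi> ` carrier M\<rparr>)"
    by (rule module_hom_realI) (use im sub in \<open>auto simp: subset_iff module_hom_realD[OF T(1)]\<close>)
  ultimately show ?thesis using vs by (simp add: x_module_def)
qed

text \<open>Replacing \<open>L\<close> by its image in \<open>M\<close> makes the left-hand map injective and changes neither its image nor the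
  rest of the sequence.\<close>

lemma image_short_exact:
  fixes M :: "(real, 'a) module" and N :: "(real, 'b) module" and L :: "(real, 'c) module"
  assumes i: "x_module_hom L R M S i" and p: "x_module_hom M S N T p"
    and ker: "i ` carrier L = {m \<in> carrier M. p m = \<zero>\<^bsub>N\<^esub>}" and surj: "p ` carrier M = carrier N"
  shows "x_short_exact (M\<lparr>carrier := i ` carrier L\<rparr>) S (\<lambda>c. c) M S p N T"
proof -
  have "i ` carrier L \<subseteq> carrier M" using ker by auto
  then have "(\<lambda>c. c) \<in> module_hom real_ring (M\<lparr>carrier := i ` carrier L\<rparr>) M"
    by (intro module_hom_realI) auto
  then show ?thesis
    using image_x_module[OF i] p ker surj by (auto simp: x_short_exact_def x_module_hom_def)
qed

lemma x_invariants_vectorspace: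
  fixes M :: "(real, 'a) module"
  assumes "x_module M T" shows "vectorspace real_ring (x_invariants M T)"
proof -
  have M: "vectorspace real_ring M" and T: "T \<in> module_hom real_ring M M" using assms by (auto simp: x_module_def)
  interpret abelian_group M by (rule vectorspace_realD(1)[OF M])
  show ?thesis unfolding x_invariants_def
    by (rule linear_subset_vectorspace[OF M])
       (auto simp: linear_subset_def module_hom_zero[OF M M T] module_hom_realD[OF T] vectorspace_realD(2)[OF M])
qed

lemma one_dimensional:
  fixes M :: "(real, 'a) module"
  assumes M: "vectorspace real_ring M" and c: "c \<in> carrier M" "c \<noteq> \<zero>\<^bsub>M\<^esub>"
    and gen: "\<And>m. m \<in> carrier M \<Longrightarrow> \<exists>r. m = r \<odot>\<^bsub>M\<^esub> c"
  shows "vectorspace.fin_dim real_ring M \<and> vectorspace.dim real_ring M = 1"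
proof -
  interpret vectorspace real_ring M by fact
  note D = vectorspace_realD[OF M]
  have R: "carrier real_ring = UNIV" "\<zero>\<^bsub>real_ring\<^esub> = 0" by (simp_all add: real_ring_def)
  have lc: "lincomb a {c} = a c \<odot>\<^bsub>M\<^esub> c" for a
    using c D(2)[OF c(1)] by (simp add: lincomb_def)
  have "span {c} = {lincomb a {c} |a. a \<in> {c} \<rightarrow> carrier real_ring}"
    by (rule finite_span) (use c in auto)
  also have "\<dots> = range (\<lambda>r. r \<odot>\<^bsub>M\<^esub> c)"
  proof -
    have "\<exists>a. r \<odot>\<^bsub>M\<^esub> c = a c \<odot>\<^bsub>M\<^esub> c" for r :: real by (rule exI[of _ "\<lambda>_. r"]) simp
    then show ?thesis by (auto simp: lc R)
  qed
  also have "\<dots> = carrier M" using gen D(2)[OF c(1)] by blast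
  finally have g: "gen_set {c}" .
  have "lin_indpt {c}"
  proof (rule finite_lin_indpt2)
    fix a assume "lincomb a {c} = \<zero>\<^bsub>M\<^esub>"
    then have ac: "a c \<odot>\<^bsub>M\<^esub> c = \<zero>\<^bsub>M\<^esub>" by (simp add: lc)
    have "a c = 0"
    proof (rule ccontr)
      assume "a c \<noteq> 0"
      then have "c = (1 / a c) \<odot>\<^bsub>M\<^esub> (a c \<odot>\<^bsub>M\<^esub> c)" using D(5)[OF c(1), of "1 / a c" "a c"] D(6)[OF c(1)] by simp
      then show False using ac D(8) c by simp
    qed
    then show "\<forall>v\<in>{c}. a v = \<zero>\<^bsub>real_ring\<^esub>" by (simp add: R)
  qed (use c in auto)
  then have "basis {c}" using g c by (simp add: basis_def)
  then have "dim = 1" using dim_basis[of "{c}"] by simp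
  moreover have "fin_dim" unfolding fin_dim_def using g c by (intro exI[of _ "{c}"]) auto
  ultimately show ?thesis by simp
qed

lemma one_dimensional_isomorphic:
  fixes M :: "(real, 'a) module" and N :: "(real, 'b) module"
  assumes M: "vectorspace real_ring M" and c: "c \<in> carrier M" "c \<noteq> \<zero>\<^bsub>M\<^esub>"
    and genM: "\<And>m. m \<in> carrier M \<Longrightarrow> \<exists>r. m = r \<odot>\<^bsub>M\<^esub> c"
    and N: "vectorspace real_ring N" and d: "d \<in> carrier N" "d \<noteq> \<zero>\<^bsub>N\<^esub>"
    and genN: "\<And>m. m \<in> carrier N \<Longrightarrow> \<exists>r. m = r \<odot>\<^bsub>N\<^esub> d"
  shows "isomorphic_spaces M N"
proof -
  have line: "r = s" if K: "vectorspace real_ring K" "e \<in> carrier K" "e \<noteq> \<zero>\<^bsub>K\<^esub>"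
    and eq: "r \<odot>\<^bsub>K\<^esub> e = s \<odot>\<^bsub>K\<^esub> e" for K :: "(real, 'z) module" and e r s
  proof (rule ccontr)
    assume "r \<noteq> s"
    note D = vectorspace_realD[OF K(1)]
    interpret abelian_group K by (rule D(1))
    have "(r - s) \<odot>\<^bsub>K\<^esub> e = r \<odot>\<^bsub>K\<^esub> e \<oplus>\<^bsub>K\<^esub> (-1) \<odot>\<^bsub>K\<^esub> (s \<odot>\<^bsub>K\<^esub> e)"
      using D(3)[OF K(2), of r "- s"] D(5)[OF K(2), of "-1" s] by simp
    also have "\<dots> = \<zero>\<^bsub>K\<^esub>" by (simp add: eq D(7) D(2) K(2) r_neg)
    finally have z: "(r - s) \<odot>\<^bsub>K\<^esub> e = \<zero>\<^bsub>K\<^esub>" .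
    have "e = (1 / (r - s)) \<odot>\<^bsub>K\<^esub> ((r - s) \<odot>\<^bsub>K\<^esub> e)"
      using D(5)[OF K(2), of "1 / (r - s)" "r - s"] D(6)[OF K(2)] \<open>r \<noteq> s\<close> by simp
    then show False using z D(8) K(3) by simp
  qed
  note DM = vectorspace_realD[OF M] and DN = vectorspace_realD[OF N]
  interpret N: abelian_group N by (rule DN(1))
  define coeff where "coeff m = (THE r. m = r \<odot>\<^bsub>M\<^esub> c)" for m
  have coeff: "coeff (r \<odot>\<^bsub>M\<^esub> c) = r" for r
    unfolding coeff_def by (rule the_equality) (use line[OF M c] in auto)
  have bij: "bij_betw (\<lambda>m. coeff m \<odot>\<^bsub>N\<^esub> d) (carrier M) (carrier N)"
    unfolding bij_betw_def inj_on_def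
  proof (intro conjI ballI impI equalityI subsetI)
    fix m m' assume m: "m \<in> carrier M" "m' \<in> carrier M" and eq: "coeff m \<odot>\<^bsub>N\<^esub> d = coeff m' \<odot>\<^bsub>N\<^esub> d"
    obtain r r' where r: "m = r \<odot>\<^bsub>M\<^esub> c" "m' = r' \<odot>\<^bsub>M\<^esub> c" using genM m by meson
    then show "m = m'" using line[OF N d, of r r'] eq by (simp add: coeff)
  next
    fix n assume "n \<in> carrier N"
    then obtain r where "n = r \<odot>\<^bsub>N\<^esub> d" using genN by blast
    then show "n \<in> (\<lambda>m. coeff m \<odot>\<^bsub>N\<^esub> d) ` carrier M"
      using DM(2)[OF c(1), of r] by (intro image_eqI[of _ _ "r \<odot>\<^bsub>M\<^esub> c"]) (simp_all add: coeff)
  qed (auto simp: DN(2)[OF d(1)])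
  have "(\<lambda>m. coeff m \<odot>\<^bsub>N\<^esub> d) \<in> module_hom real_ring M N"
  proof (rule module_hom_realI)
    fix f g assume "f \<in> carrier M" "g \<in> carrier M"
    then obtain r s where rs: "f = r \<odot>\<^bsub>M\<^esub> c" "g = s \<odot>\<^bsub>M\<^esub> c" using genM by meson
    then have "f \<oplus>\<^bsub>M\<^esub> g = (r + s) \<odot>\<^bsub>M\<^esub> c" by (simp add: DM(3)[OF c(1)])
    then show "coeff (f \<oplus>\<^bsub>M\<^esub> g) \<odot>\<^bsub>N\<^esub> d = coeff f \<odot>\<^bsub>N\<^esub> d \<oplus>\<^bsub>N\<^esub> coeff g \<odot>\<^bsub>N\<^esub> d"
      by (simp only: rs coeff DN(3)[OF d(1)])
  next
    fix f k assume "f \<in> carrier M"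
    then obtain r where r: "f = r \<odot>\<^bsub>M\<^esub> c" using genM by blast
    then have "k \<odot>\<^bsub>M\<^esub> f = (k * r) \<odot>\<^bsub>M\<^esub> c" by (simp add: DM(5)[OF c(1)])
    then show "coeff (k \<odot>\<^bsub>M\<^esub> f) \<odot>\<^bsub>N\<^esub> d = k \<odot>\<^bsub>N\<^esub> (coeff f \<odot>\<^bsub>N\<^esub> d)"
      by (simp only: r coeff DN(5)[OF d(1)])
  qed (simp add: DN(2)[OF d(1)])
  then show ?thesis using M N bij by (auto simp: isomorphic_spaces_def)
qed

section \<open>First cohomology\<close>

locale linear_action = group G for G (structure) +
  fixes V :: "'v::real_vector set" and act :: "'a \<Rightarrow> 'v \<Rightarrow> 'v"
  assumes V: "Real_Vector_Spaces.subspace V"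
    and act_linear: "g \<in> carrier G \<Longrightarrow> linear (act g)"
    and act_closed: "g \<in> carrier G \<Longrightarrow> v \<in> V \<Longrightarrow> act g v \<in> V"
    and act_mult: "g \<in> carrier G \<Longrightarrow> h \<in> carrier G \<Longrightarrow> act (g \<otimes> h) v = act g (act h v)"
    and act_one: "act \<one> v = v"
begin

abbreviation "\<Z> H \<equiv> Z1 G H V act"
abbreviation "\<B> H \<equiv> B1 H V act"
abbreviation "x_class H x \<equiv> induced (\<Z> H) (\<B> H) (x_cochain G H act x)"

lemma V_closed: "0 \<in> V" "v \<in> V \<Longrightarrow> w \<in> V \<Longrightarrow> v + w \<in> V" "v \<in> V \<Longrightarrow> c *\<^sub>R v \<in> V"
   "v \<in> V \<Longrightarrow> w \<in> V \<Longrightarrow> v - w \<in> V" "v \<in> V \<Longrightarrow> - v \<in> V"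
  using V by (auto simp: real_vector.subspace_def real_vector.subspace_diff real_vector.subspace_neg)

lemma act_simps:
  assumes "g \<in> carrier G"
  shows "act g (v + w) = act g v + act g w" "act g (c *\<^sub>R v) = c *\<^sub>R act g v" "act g 0 = 0"
    "act g (v - w) = act g v - act g w" "act g (- v) = - act g v"
  using act_linear[OF assms]
  by (simp_all add: linear_add linear_scale linear_0 linear_diff linear_neg)

lemma act_inv:
  assumes "g \<in> carrier G" shows "act (inv g) (act g v) = v" "act g (act (inv g) v) = v"
  using assms act_mult[of "inv g" g v] act_mult[of g "inv g" v] by (simp_all add: act_one)

lemma Z1_simps:
  "f \<in> carrier (\<Z> H) \<longleftrightarrow>
     f \<in> H \<rightarrow>\<^sub>E V \<and> (\<forall>g\<in>H. \<forall>h\<in>H. f (g \<otimes> h) = f g + act g (f h))"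
  "\<zero>\<^bsub>\<Z> H\<^esub> = (\<lambda>h\<in>H. 0)"
  "f \<oplus>\<^bsub>\<Z> H\<^esub> f' = (\<lambda>h\<in>H. f h + f' h)"
  "c \<odot>\<^bsub>\<Z> H\<^esub> f = (\<lambda>h\<in>H. c *\<^sub>R f h)"
  by (simp_all add: Z1_def)

lemma cocycle_cong:
  assumes "f \<in> carrier (\<Z> H)" "f' \<in> carrier (\<Z> H)" "\<And>h. h \<in> H \<Longrightarrow> f h = f' h"
  shows "f = f'"
  using assms(1,2) by (intro PiE_ext[of f H "\<lambda>_. V" f']) (simp_all add: Z1_simps assms(3))

lemma cocycleD:
  assumes "f \<in> carrier (\<Z> H)"
  shows "h \<in> H \<Longrightarrow> f h \<in> V" "g \<in> H \<Longrightarrow> h \<in> H \<Longrightarrow> f (g \<otimes> h) = f g + act g (f h)"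
    "f \<in> extensional H"
  using assms by (auto simp: Z1_simps PiE_def)

lemma cocycleI:
  assumes "f \<in> extensional H" "\<And>h. h \<in> H \<Longrightarrow> f h \<in> V"
    "\<And>g h. g \<in> H \<Longrightarrow> h \<in> H \<Longrightarrow> f (g \<otimes> h) = f g + act g (f h)"
  shows "f \<in> carrier (\<Z> H)"
  using assms by (auto simp: Z1_simps PiE_def)

lemma Z1_vectorspace:
  assumes H: "subgroup H G"
  shows "vectorspace real_ring (\<Z> H)"
proof -
  note cl = subgroup.m_closed[OF H] subgroup.mem_carrier[OF H]
  show ?thesis
  proof (rule vectorspace_realI, goal_cases)
    case (1 f g)
    then show ?case
      by (intro cocycleI) (auto simp: Z1_simps(2-) cocycleD cl V_closed act_simps algebra_simps)
  next
    case 2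
    then show ?case
      by (intro cocycleI) (auto simp: Z1_simps(2-) cl V_closed act_simps)
  next
    case (3 c f)
    then show ?case
      by (intro cocycleI) (auto simp: Z1_simps(2-) cocycleD cl V_closed act_simps algebra_simps)
  next
    case (6 f)
    show ?case by (rule extensionalityI[of _ H]) (auto simp: Z1_simps(2-) cocycleD(3)[OF 6])
  next
    case (11 f)
    show ?case by (rule extensionalityI[of _ H]) (auto simp: Z1_simps(2-) cocycleD(3)[OF 11])
  qed (auto simp: Z1_simps(2-) restrict_def fun_eq_iff algebra_simps)
qed

lemma B1_linear_subset:
  assumes H: "subgroup H G"
  shows "linear_subset (\<Z> H) (\<B> H)"
proof -
  note cl = subgroup.m_closed[OF H] subgroup.mem_carrier[OF H]
  have "(\<lambda>h\<in>H. act h v - v) \<in> carrier (\<Z> H)" if "v \<in> V" for v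
    by (rule cocycleI) (use that in \<open>auto simp: cl V_closed act_closed act_mult act_simps\<close>)
  moreover have "\<zero>\<^bsub>\<Z> H\<^esub> \<in> \<B> H" unfolding B1_def
    by (rule image_eqI[of _ _ 0]) (auto simp: Z1_simps V_closed act_simps cl restrict_def)
  moreover have "(\<lambda>h\<in>H. act h v - v) \<oplus>\<^bsub>\<Z> H\<^esub> (\<lambda>h\<in>H. act h w - w) \<in> \<B> H" if "v \<in> V" "w \<in> V" for v w
    unfolding B1_def using that
    by (intro image_eqI[of _ _ "v + w"]) (auto simp: Z1_simps V_closed act_simps cl restrict_def fun_eq_iff)
  moreover have "c \<odot>\<^bsub>\<Z> H\<^esub> (\<lambda>h\<in>H. act h v - v) \<in> \<B> H" if "v \<in> V" for v c
    unfolding B1_def using that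
    by (intro image_eqI[of _ _ "c *\<^sub>R v"]) (auto simp: Z1_simps V_closed act_simps cl restrict_def fun_eq_iff algebra_simps)
  ultimately show ?thesis unfolding linear_subset_def by (auto simp: B1_def)
qed

definition normalizes :: "'a \<Rightarrow> 'a set \<Rightarrow> bool" where
  "normalizes x H \<longleftrightarrow> x \<in> carrier G \<and> (\<forall>h\<in>H. inv x \<otimes> h \<otimes> x \<in> H \<and> x \<otimes> h \<otimes> inv x \<in> H)"

lemma normalizes_inv: "normalizes x H \<Longrightarrow> normalizes (inv x) H"
  by (auto simp: normalizes_def)

context
  fixes H x assumes H: "subgroup H G" and x: "normalizes x H"
begin

lemma x_carrier: "x \<in> carrier G" "\<And>h. h \<in> H \<Longrightarrow> inv x \<otimes> h \<otimes> x \<in> H" "\<And>h. h \<in> H \<Longrightarrow> x \<otimes> h \<otimes> inv x \<in> H"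
  using x by (auto simp: normalizes_def)

lemma x_cochain_hom:
  "x_cochain G H act x \<in> module_hom real_ring (\<Z> H) (\<Z> H)"
proof -
  note cl = subgroup.m_closed[OF H] subgroup.mem_carrier[OF H]
  have conj: "inv x \<otimes> (g \<otimes> h) \<otimes> x = (inv x \<otimes> g \<otimes> x) \<otimes> (inv x \<otimes> h \<otimes> x)" if "g \<in> H" "h \<in> H" for g h
  proof -
    have "x \<otimes> (inv x \<otimes> (h \<otimes> x)) = h \<otimes> x"
      using that x_carrier(1) cl(2) by (simp add: m_assoc[symmetric])
    then show ?thesis using that x_carrier(1) cl(2) by (simp add: m_assoc)
  qed
  have actconj: "act x (act (inv x \<otimes> g \<otimes> x) v) = act g (act x v)" if "g \<in> H" for g v
    using that x_carrier(1) cl(2) by (simp add: act_mult act_inv)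
  show ?thesis
  proof (rule module_hom_realI)
    fix f assume "f \<in> carrier (\<Z> H)"
    note f = cocycleD[OF this]
    show "x_cochain G H act x f \<in> carrier (\<Z> H)"
      by (rule cocycleI)
        (auto simp: x_cochain_def f act_closed x_carrier cl conj act_simps actconj)
  qed (auto simp: x_cochain_def Z1_simps restrict_def fun_eq_iff x_carrier act_simps)
qed

lemma x_cochain_B1: "x_cochain G H act x ` \<B> H \<subseteq> \<B> H"
proof -
  note cl = subgroup.mem_carrier[OF H]
  have "x_cochain G H act x (\<lambda>h\<in>H. act h v - v) = (\<lambda>h\<in>H. act h (act x v) - act x v)" for v
    by (auto simp: x_cochain_def restrict_def fun_eq_iff x_carrier act_simps act_mult act_inv cl)
  then show ?thesis using x_carrier(1) by (auto simp: B1_def act_closed)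
qed

lemma x_cochain_inverse:
  assumes "f \<in> carrier (\<Z> H)"
  shows "x_cochain G H act (inv x) (x_cochain G H act x f) = f"
proof -
  note cl = subgroup.mem_carrier[OF H]
  have "inv x \<otimes> (x \<otimes> h \<otimes> inv x) \<otimes> x = h" if "h \<in> H" for h
    using that cl x_carrier(1) by (simp add: m_assoc) (simp add: m_assoc[symmetric])
  then show ?thesis
    using cocycleD(3)[OF assms]
    by (intro extensionalityI[of _ H]) (auto simp: x_cochain_def x_carrier act_inv)
qed

end

lemma H1_x_module:
  assumes H: "subgroup H G" and x: "normalizes x H"
  shows "x_module (H1 G H V act) (x_class H x)"
  unfolding H1_def
proof (rule quotient_x_module[OF Z1_vectorspace[OF H] B1_linear_subset[OF H]
     x_cochain_hom[OF H x] x_cochain_B1[OF H x]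
     x_cochain_hom[OF H normalizes_inv[OF x]] x_cochain_B1[OF H normalizes_inv[OF x]]])
  fix f assume "f \<in> carrier (\<Z> H)"
  then show "x_cochain G H act (inv x) (x_cochain G H act x f) = f"
    "x_cochain G H act x (x_cochain G H act (inv x) f) = f"
    using x_cochain_inverse[OF H x] x_cochain_inverse[OF H normalizes_inv[OF x]] x
    by (auto simp: normalizes_def)
qed

context
  fixes H K x
  assumes H: "subgroup H G" and xH: "normalizes x H"
    and K: "subgroup K G" and xK: "normalizes x K" and KH: "K \<subseteq> H"
begin

lemma Z1_rel_linear_subset: "linear_subset (\<Z> H) (carrier (Z1_rel G H K V act))"
proof -
  interpret abelian_group "\<Z> H" by (rule vectorspace_realD(1)[OF Z1_vectorspace[OF H]])
  have "f h + g h = 0" if "f h = 0" "g h = 0" for f g :: "'a \<Rightarrow> 'v" and h using that by simp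
  then show ?thesis
    unfolding linear_subset_def Z1_rel_def
    using a_closed zero_closed vectorspace_realD(2)[OF Z1_vectorspace[OF H]] KH
    by (auto simp: Z1_simps(2-) subset_iff)
qed

lemma Z1_rel_vectorspace: "vectorspace real_ring (Z1_rel G H K V act)"
  using linear_subset_vectorspace[OF Z1_vectorspace[OF H] Z1_rel_linear_subset] by (simp add: Z1_rel_def)

lemma B1_rel_linear_subset: "linear_subset (Z1_rel G H K V act) (B1_rel H)"
  using Z1_rel_linear_subset
  by (auto simp: linear_subset_def B1_rel_def Z1_rel_def Z1_simps(2-) restrict_def fun_eq_iff)

lemma x_cochain_rel_hom:
  assumes x: "normalizes z H" "normalizes z K"
  shows "x_cochain G H act z \<in> module_hom real_ring (Z1_rel G H K V act) (Z1_rel G H K V act)"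
proof -
  note hom = module_hom_realD[OF x_cochain_hom[OF H x(1)]]
  show ?thesis
  proof (rule module_hom_realI)
    fix f assume f: "f \<in> carrier (Z1_rel G H K V act)"
    have "x_cochain G H act z f k = 0" if "k \<in> K" for k
      using that f x KH by (auto simp: Z1_rel_def normalizes_def x_cochain_def act_simps)
    then show "x_cochain G H act z f \<in> carrier (Z1_rel G H K V act)"
      using f hom(1) by (simp add: Z1_rel_def)
  qed (simp_all add: Z1_rel_def hom(2,3))
qed

lemma x_cochain_B1_rel:
  assumes x: "normalizes z H"
  shows "x_cochain G H act z ` B1_rel H \<subseteq> B1_rel H"
  using x by (auto simp: B1_rel_def x_cochain_def normalizes_def act_simps restrict_def fun_eq_iff)

lemma H1_rel_x_module:
  "x_module (H1_rel G H K V act) (induced (Z1_rel G H K V act) (B1_rel H) (x_cochain G H act x))"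
  unfolding H1_rel_def
proof (rule quotient_x_module[OF Z1_rel_vectorspace B1_rel_linear_subset
     x_cochain_rel_hom[OF xH xK] x_cochain_B1_rel[OF xH]
     x_cochain_rel_hom[OF normalizes_inv[OF xH] normalizes_inv[OF xK]] x_cochain_B1_rel[OF normalizes_inv[OF xH]]])
  fix f assume "f \<in> carrier (Z1_rel G H K V act)"
  then have "f \<in> carrier (\<Z> H)" by (simp add: Z1_rel_def)
  then show "x_cochain G H act (inv x) (x_cochain G H act x f) = f"
    "x_cochain G H act x (x_cochain G H act (inv x) f) = f"
    using x_cochain_inverse[OF H xH] x_cochain_inverse[OF H normalizes_inv[OF xH]] xH
    by (auto simp: normalizes_def)
qed

lemma rel_hom: "(\<lambda>f. f) \<in> module_hom real_ring (Z1_rel G H K V act) (\<Z> H)"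
  by (rule module_hom_realI) (auto simp: Z1_rel_def)

lemma rel_B1: "(\<lambda>f. f) ` B1_rel H \<subseteq> \<B> H"
  using B1_linear_subset[OF H] by (auto simp: B1_rel_def linear_subset_def Z1_simps(2-))

lemma restrict_hom: "(\<lambda>f. restrict f K) \<in> module_hom real_ring (\<Z> H) (\<Z> K)"
proof (rule module_hom_realI)
  fix f assume "f \<in> carrier (\<Z> H)"
  note f = cocycleD[OF this]
  show "restrict f K \<in> carrier (\<Z> K)"
    using KH subgroup.m_closed[OF K] by (intro cocycleI) (auto simp: f subset_iff)
qed (use KH in \<open>auto simp: Z1_simps(2-) restrict_def fun_eq_iff subset_iff\<close>)

lemma restrict_B1: "(\<lambda>f. restrict f K) ` \<B> H \<subseteq> \<B> K"
proof
  fix f assume "f \<in> (\<lambda>f. restrict f K) ` \<B> H"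
  then obtain v where v: "v \<in> V" "f = restrict (\<lambda>h\<in>H. act h v - v) K" by (auto simp: B1_def)
  then have "f = (\<lambda>h\<in>K. act h v - v)" using KH by (auto simp: restrict_def fun_eq_iff)
  then show "f \<in> \<B> K" using v(1) by (auto simp: B1_def)
qed

lemma rel_x_module_hom:
  "x_module_hom (H1_rel G H K V act) (induced (Z1_rel G H K V act) (B1_rel H) (x_cochain G H act x))
     (H1 G H V act) (x_class H x)
     (induced (\<Z> H) (\<B> H) (\<lambda>f. f))"
  using H1_rel_x_module H1_x_module[OF H xH] unfolding H1_def H1_rel_def
  by (intro induced_x_module_hom[OF Z1_rel_vectorspace B1_rel_linear_subset Z1_vectorspace[OF H] B1_linear_subset[OF H]
    x_cochain_rel_hom[OF xH xK] x_cochain_B1_rel[OF xH] x_cochain_hom[OF H xH] x_cochain_B1[OF H xH]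
    _ _ rel_hom rel_B1]) auto

lemma restrict_x_module_hom:
  "x_module_hom (H1 G H V act) (x_class H x)
     (H1 G K V act) (x_class K x)
     (induced (\<Z> K) (\<B> K) (\<lambda>f. restrict f K))"
  using H1_x_module[OF K xK] H1_x_module[OF H xH] unfolding H1_def
proof (intro induced_x_module_hom[OF Z1_vectorspace[OF H] B1_linear_subset[OF H] Z1_vectorspace[OF K] B1_linear_subset[OF K]
    x_cochain_hom[OF H xH] x_cochain_B1[OF H xH] x_cochain_hom[OF K xK] x_cochain_B1[OF K xK]
    _ _ restrict_hom restrict_B1])
  fix f assume "f \<in> carrier (\<Z> H)"
  show "restrict (x_cochain G H act x f) K = x_cochain G K act x (restrict f K)"
    using KH xK by (auto simp: x_cochain_def restrict_def fun_eq_iff normalizes_def subset_iff)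
qed

text \<open>If the restriction of \<open>f\<close> to \<open>K\<close> is the coboundary of \<open>v\<close>, then \<open>f\<close> minus the coboundary of \<open>v\<close> on
  all of \<open>H\<close> vanishes on \<open>K\<close> and represents the same class.\<close>

lemma rel_exact:
  "induced (\<Z> H) (\<B> H) (\<lambda>f. f) ` carrier (H1_rel G H K V act) =
   {m \<in> carrier (H1 G H V act).
      induced (\<Z> K) (\<B> K) (\<lambda>f. restrict f K) m = \<zero>\<^bsub>H1 G K V act\<^esub>}" (is "?L = ?R")
proof -
  note ZH = Z1_vectorspace[OF H] and BH = B1_linear_subset[OF H]
  note ZK = Z1_vectorspace[OF K] and BK = B1_linear_subset[OF K]
  have incl: "induced (\<Z> H) (\<B> H) (\<lambda>f. f) (B1_rel H +>\<^bsub>Z1_rel G H K V act\<^esub> f)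
      = \<B> H +>\<^bsub>\<Z> H\<^esub> f" if "f \<in> carrier (Z1_rel G H K V act)" for f
    by (rule induced_coset[OF Z1_rel_vectorspace B1_rel_linear_subset rel_hom ZH BH rel_B1 that])
  have res: "induced (\<Z> K) (\<B> K) (\<lambda>f. restrict f K) (\<B> H +>\<^bsub>\<Z> H\<^esub> f)
      = \<B> K +>\<^bsub>\<Z> K\<^esub> restrict f K" if "f \<in> carrier (\<Z> H)" for f
    by (rule induced_coset[OF ZH BH restrict_hom ZK BK restrict_B1 that])
  have L: "?L = (\<lambda>f. \<B> H +>\<^bsub>\<Z> H\<^esub> f) ` carrier (Z1_rel G H K V act)"
    by (auto simp: H1_rel_def quotient_carrier[OF Z1_rel_vectorspace B1_rel_linear_subset] incl image_image)
  have R: "?R = (\<lambda>f. \<B> H +>\<^bsub>\<Z> H\<^esub> f) ` {f \<in> carrier (\<Z> H). restrict f K \<in> \<B> K}"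
  proof -
    have "induced (\<Z> K) (\<B> K) (\<lambda>f. restrict f K) (\<B> H +>\<^bsub>\<Z> H\<^esub> f)
       = \<zero>\<^bsub>H1 G K V act\<^esub> \<longleftrightarrow> restrict f K \<in> \<B> K" if "f \<in> carrier (\<Z> H)" for f
      unfolding res[OF that] H1_def
      by (rule coset_eq_zero_iff[OF ZK BK module_hom_realD(1)[OF restrict_hom that]])
    then show ?thesis by (auto simp: H1_def quotient_carrier[OF ZH BH])
  qed
  show ?thesis unfolding L R
  proof (intro equalityI subsetI; elim imageE)
    fix X f assume f: "f \<in> carrier (Z1_rel G H K V act)" and X: "X = \<B> H +>\<^bsub>\<Z> H\<^esub> f"
    have "restrict f K = (\<lambda>h\<in>K. 0)" using f by (auto simp: Z1_rel_def restrict_def)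
    also have "\<dots> \<in> \<B> K" using BK by (simp add: linear_subset_def Z1_simps(2-))
    finally show "X \<in> (\<lambda>f. \<B> H +>\<^bsub>\<Z> H\<^esub> f) ` {f \<in> carrier (\<Z> H). restrict f K \<in> \<B> K}"
      using f X by (auto simp: Z1_rel_def)
  next
    fix X f assume f: "f \<in> {f \<in> carrier (\<Z> H). restrict f K \<in> \<B> K}"
      and X: "X = \<B> H +>\<^bsub>\<Z> H\<^esub> f"
    then obtain v where v: "v \<in> V" "restrict f K = (\<lambda>h\<in>K. act h v - v)" by (auto simp: B1_def)
    define b where "b = (\<lambda>h\<in>H. act h (- v) - (- v))"
    have b: "b \<in> \<B> H" unfolding b_def B1_def using v(1) by (intro image_eqI[of _ _ "- v"]) (simp_all add: V_closed)
    have fb: "b \<oplus>\<^bsub>\<Z> H\<^esub> f \<in> carrier (\<Z> H)"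
      using b f BH abelian_monoid.a_closed[OF abelian_group.axioms(1)[OF vectorspace_realD(1)[OF ZH]]]
      by (auto simp: linear_subset_def)
    have "f k = act k v - v" if "k \<in> K" for k using v(2) that by (auto simp: restrict_def fun_eq_iff split: if_splits)
    then have "b \<oplus>\<^bsub>\<Z> H\<^esub> f \<in> carrier (Z1_rel G H K V act)"
      using fb KH subgroup.mem_carrier[OF H] by (auto simp: Z1_rel_def b_def Z1_simps(2-) subset_iff act_simps)
    moreover have "X = \<B> H +>\<^bsub>\<Z> H\<^esub> (b \<oplus>\<^bsub>\<Z> H\<^esub> f)"
      using coset_absorb[OF ZH BH b] f X by simp
    ultimately show "X \<in> (\<lambda>f. \<B> H +>\<^bsub>\<Z> H\<^esub> f) ` carrier (Z1_rel G H K V act)" by blast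
  qed
qed

text \<open>The assumption says, in terms of representatives, that the connecting map to the second relative cohomology
  group vanishes.\<close>

lemma pair_short_exact:
  assumes surj: "\<And>f. f \<in> carrier (\<Z> K) \<Longrightarrow> \<exists>g\<in>carrier (\<Z> H).
      restrict g K \<ominus>\<^bsub>\<Z> K\<^esub> f \<in> \<B> K"
  shows "x_short_exact
     ((H1 G H V act)\<lparr>carrier := induced (\<Z> H) (\<B> H) (\<lambda>f. f) ` carrier (H1_rel G H K V act)\<rparr>)
     (x_class H x) (\<lambda>c. c)
     (H1 G H V act) (x_class H x)
     (induced (\<Z> K) (\<B> K) (\<lambda>f. restrict f K))
     (H1 G K V act) (x_class K x)"
proof (rule image_short_exact[OF rel_x_module_hom restrict_x_module_hom rel_exact])
  note ZH = Z1_vectorspace[OF H] and BH = B1_linear_subset[OF H]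
  note ZK = Z1_vectorspace[OF K] and BK = B1_linear_subset[OF K]
  note r = module_hom_realD(1)[OF restrict_hom]
  have res: "induced (\<Z> K) (\<B> K) (\<lambda>f. restrict f K) (\<B> H +>\<^bsub>\<Z> H\<^esub> f)
      = \<B> K +>\<^bsub>\<Z> K\<^esub> restrict f K" if "f \<in> carrier (\<Z> H)" for f
    by (rule induced_coset[OF ZH BH restrict_hom ZK BK restrict_B1 that])
  show "induced (\<Z> K) (\<B> K) (\<lambda>f. restrict f K) ` carrier (H1 G H V act) = carrier (H1 G K V act)"
  proof (intro equalityI subsetI)
    fix X assume "X \<in> carrier (H1 G K V act)"
    then obtain f where f: "f \<in> carrier (\<Z> K)" "X = \<B> K +>\<^bsub>\<Z> K\<^esub> f"
      by (auto simp: H1_def quotient_carrier[OF ZK BK])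
    then obtain g where g: "g \<in> carrier (\<Z> H)" "restrict g K \<ominus>\<^bsub>\<Z> K\<^esub> f \<in> \<B> K"
      using surj by blast
    then have "X = \<B> K +>\<^bsub>\<Z> K\<^esub> restrict g K"
      using coset_eq_iff[OF ZK BK r[OF g(1)] f(1)] f(2) by simp
    then show "X \<in> induced (\<Z> K) (\<B> K) (\<lambda>f. restrict f K) ` carrier (H1 G H V act)"
      using res[OF g(1)] g(1) by (auto simp: H1_def quotient_carrier[OF ZH BH] image_iff)
  next
    fix X assume "X \<in> induced (\<Z> K) (\<B> K) (\<lambda>f. restrict f K) ` carrier (H1 G H V act)"
    then show "X \<in> carrier (H1 G K V act)"
      using r res by (auto simp: H1_def quotient_carrier[OF ZK BK] quotient_carrier[OF ZH BH])
  qed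
qed

end

lemma minus_cocycle:
  assumes H: "subgroup H G" and "f \<in> carrier (\<Z> H)" "g \<in> carrier (\<Z> H)"
  shows "f \<ominus>\<^bsub>\<Z> H\<^esub> g = (\<lambda>h\<in>H. f h - g h)"
proof -
  note D = vectorspace_realD[OF Z1_vectorspace[OF H]]
  have "f \<ominus>\<^bsub>\<Z> H\<^esub> g = f \<oplus>\<^bsub>\<Z> H\<^esub> (-1) \<odot>\<^bsub>\<Z> H\<^esub> g"
    using D(7)[OF assms(3)] by (simp add: a_minus_def)
  then show ?thesis by (auto simp: Z1_simps(2-) restrict_def fun_eq_iff)
qed

text \<open>The class of \<open>f\<close> is invariant exactly when \<open>x f - f\<close> is a coboundary, so invariant classes can be handled
  through representatives, without mentioning cosets.\<close>

lemma H1_invariants_line: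
  assumes H: "subgroup H G" and x: "normalizes x H"
    and f0: "f0 \<in> carrier (\<Z> H)" "f0 \<notin> \<B> H"
      "(\<lambda>h\<in>H. x_cochain G H act x f0 h - f0 h) \<in> \<B> H"
    and gen: "\<And>f. f \<in> carrier (\<Z> H) \<Longrightarrow> (\<lambda>h\<in>H. x_cochain G H act x f h - f h) \<in> \<B> H
       \<Longrightarrow> \<exists>r. (\<lambda>h\<in>H. f h - r *\<^sub>R f0 h) \<in> \<B> H"
  defines "I \<equiv> x_invariants (H1 G H V act) (x_class H x)"
  shows "vectorspace real_ring I" "\<exists>c\<in>carrier I. c \<noteq> \<zero>\<^bsub>I\<^esub> \<and> (\<forall>m\<in>carrier I. \<exists>r. m = r \<odot>\<^bsub>I\<^esub> c)"
proof -
  note Z = Z1_vectorspace[OF H] and B = B1_linear_subset[OF H]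
  note D = vectorspace_realD[OF Z] and hom = module_hom_realD[OF x_cochain_hom[OF H x]]
  show "vectorspace real_ring I" unfolding I_def by (rule x_invariants_vectorspace[OF H1_x_module[OF H x]])
  have ind: "x_class H x (\<B> H +>\<^bsub>\<Z> H\<^esub> f)
     = \<B> H +>\<^bsub>\<Z> H\<^esub> x_cochain G H act x f" if "f \<in> carrier (\<Z> H)" for f
    by (rule induced_coset[OF Z B x_cochain_hom[OF H x] Z B x_cochain_B1[OF H x] that])
  have I: "\<B> H +>\<^bsub>\<Z> H\<^esub> f \<in> carrier I \<longleftrightarrow>
      (\<lambda>h\<in>H. x_cochain G H act x f h - f h) \<in> \<B> H" if f: "f \<in> carrier (\<Z> H)" for f
    using f by (auto simp: I_def x_invariants_def H1_def quotient_carrier[OF Z B] ind coset_eq_iff[OF Z B] hom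
        minus_cocycle[OF H])
  have ops: "\<zero>\<^bsub>I\<^esub> = \<zero>\<^bsub>quotient_module (\<Z> H) (\<B> H)\<^esub>"
    "r \<odot>\<^bsub>I\<^esub> X = r \<odot>\<^bsub>quotient_module (\<Z> H) (\<B> H)\<^esub> X" for r X
    by (simp_all add: I_def x_invariants_def H1_def)
  show "\<exists>c\<in>carrier I. c \<noteq> \<zero>\<^bsub>I\<^esub> \<and> (\<forall>m\<in>carrier I. \<exists>r. m = r \<odot>\<^bsub>I\<^esub> c)"
  proof (intro bexI[of _ "\<B> H +>\<^bsub>\<Z> H\<^esub> f0"] conjI ballI)
    show "\<B> H +>\<^bsub>\<Z> H\<^esub> f0 \<in> carrier I" using I[OF f0(1)] f0(3) by simp
    show "\<B> H +>\<^bsub>\<Z> H\<^esub> f0 \<noteq> \<zero>\<^bsub>I\<^esub>"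
      using coset_eq_zero_iff[OF Z B f0(1)] f0(2) by (simp add: ops)
  next
    fix m assume m: "m \<in> carrier I"
    then obtain f where f: "f \<in> carrier (\<Z> H)" "m = \<B> H +>\<^bsub>\<Z> H\<^esub> f"
      by (auto simp: I_def x_invariants_def H1_def quotient_carrier[OF Z B])
    then obtain r where r: "(\<lambda>h\<in>H. f h - r *\<^sub>R f0 h) \<in> \<B> H" using gen[OF f(1)] I[OF f(1)] m by auto
    have rf0: "r \<odot>\<^bsub>\<Z> H\<^esub> f0 \<in> carrier (\<Z> H)" by (rule D(2)[OF f0(1)])
    have "f \<ominus>\<^bsub>\<Z> H\<^esub> (r \<odot>\<^bsub>\<Z> H\<^esub> f0) = (\<lambda>h\<in>H. f h - r *\<^sub>R f0 h)"
      unfolding minus_cocycle[OF H f(1) rf0] by (auto simp: Z1_simps(2-) restrict_def)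
    then have "m = \<B> H +>\<^bsub>\<Z> H\<^esub> (r \<odot>\<^bsub>\<Z> H\<^esub> f0)"
      using coset_eq_iff[OF Z B f(1) rf0] r f(2) by simp
    then show "\<exists>r. m = r \<odot>\<^bsub>I\<^esub> (\<B> H +>\<^bsub>\<Z> H\<^esub> f0)"
      using quotient_smult[OF Z B f0(1), of r] by (auto simp: ops)
  qed
qed

end

section \<open>The groups of the fiber and of its boundary\<close>

lemma \<pi>M_group: "group \<pi>M"
  unfolding \<pi>M_def by (rule presented_group_group)

lemma \<pi>M_class_mult: "\<pi>M_class v \<otimes>\<^bsub>\<pi>M\<^esub> \<pi>M_class w = \<pi>M_class (v @ w)"
  unfolding \<pi>M_def \<pi>M_class_def by (rule presented_group_mult)

lemma \<pi>M_class_inv: "inv\<^bsub>\<pi>M\<^esub> (\<pi>M_class w) = \<pi>M_class (word_inv w)"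
  unfolding \<pi>M_def \<pi>M_class_def by (rule presented_group_inv)

lemma \<pi>M_class_one: "\<one>\<^bsub>\<pi>M\<^esub> = \<pi>M_class []"
  unfolding \<pi>M_def \<pi>M_class_def by (rule presented_group_one)

lemma \<pi>M_carrier: "g \<in> carrier \<pi>M \<longleftrightarrow> (\<exists>w. g = \<pi>M_class w)"
  unfolding \<pi>M_def \<pi>M_class_def by (rule presented_group_carrier)

lemma \<pi>M_class_carrier [simp]: "\<pi>M_class w \<in> carrier \<pi>M"
  by (auto simp: \<pi>M_carrier)

lemma \<pi>M_class_eq_iff: "\<pi>M_class v = \<pi>M_class w \<longleftrightarrow> word_eq fig8_relators v w"
  unfolding \<pi>M_class_def by (rule word_class_eq_iff)

lemma mem_\<pi>M_class: "v \<in> \<pi>M_class w \<longleftrightarrow> word_eq fig8_relators w v"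
  by (simp add: \<pi>M_class_def word_rel_def)

abbreviation "elt_y \<equiv> \<pi>M_class word_y"
abbreviation "elt_a \<equiv> \<pi>M_class word_a"
abbreviation "elt_b \<equiv> \<pi>M_class word_b"
abbreviation "elt_l \<equiv> \<pi>M_class word_l"

lemma elt_relations:
  "elt_x \<otimes>\<^bsub>\<pi>M\<^esub> elt_a = elt_b \<otimes>\<^bsub>\<pi>M\<^esub> elt_a \<otimes>\<^bsub>\<pi>M\<^esub> elt_x"
  "elt_x \<otimes>\<^bsub>\<pi>M\<^esub> elt_b = elt_b \<otimes>\<^bsub>\<pi>M\<^esub> elt_a \<otimes>\<^bsub>\<pi>M\<^esub> elt_b \<otimes>\<^bsub>\<pi>M\<^esub> elt_x"
  "elt_x \<otimes>\<^bsub>\<pi>M\<^esub> elt_l = elt_l \<otimes>\<^bsub>\<pi>M\<^esub> elt_x"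
proof -
  interpret group \<pi>M by (rule \<pi>M_group)
  have "elt_a \<otimes>\<^bsub>\<pi>M\<^esub> elt_x \<otimes>\<^bsub>\<pi>M\<^esub> inv\<^bsub>\<pi>M\<^esub> (elt_y \<otimes>\<^bsub>\<pi>M\<^esub> elt_a) = \<one>\<^bsub>\<pi>M\<^esub>"
    unfolding elt_x_def \<pi>M_class_mult \<pi>M_class_inv \<pi>M_class_one \<pi>M_class_eq_iff
    using word_eq.relator[of "word_a @ word_x @ word_inv (word_y @ word_a)" fig8_relators "[]" "[]"]
    by (simp add: fig8_relators_def)
  then have rel: "elt_a \<otimes>\<^bsub>\<pi>M\<^esub> elt_x = elt_y \<otimes>\<^bsub>\<pi>M\<^esub> elt_a"
    by (metis \<pi>M_class_carrier \<pi>M_class_mult elt_x_def inv_closed inv_inv inv_equality)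
  have b: "elt_b = elt_x \<otimes>\<^bsub>\<pi>M\<^esub> inv\<^bsub>\<pi>M\<^esub> elt_y"
    and a: "elt_a = elt_x \<otimes>\<^bsub>\<pi>M\<^esub> inv\<^bsub>\<pi>M\<^esub> elt_y \<otimes>\<^bsub>\<pi>M\<^esub> inv\<^bsub>\<pi>M\<^esub> elt_x \<otimes>\<^bsub>\<pi>M\<^esub> elt_y"
    and l: "elt_l = inv\<^bsub>\<pi>M\<^esub> elt_b \<otimes>\<^bsub>\<pi>M\<^esub> inv\<^bsub>\<pi>M\<^esub> elt_a \<otimes>\<^bsub>\<pi>M\<^esub> elt_b \<otimes>\<^bsub>\<pi>M\<^esub> elt_a"
    by (simp_all add: elt_x_def \<pi>M_class_mult \<pi>M_class_inv word_a_def word_b_def word_l_def)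
  show "elt_x \<otimes>\<^bsub>\<pi>M\<^esub> elt_a = elt_b \<otimes>\<^bsub>\<pi>M\<^esub> elt_a \<otimes>\<^bsub>\<pi>M\<^esub> elt_x"
    "elt_x \<otimes>\<^bsub>\<pi>M\<^esub> elt_b = elt_b \<otimes>\<^bsub>\<pi>M\<^esub> elt_a \<otimes>\<^bsub>\<pi>M\<^esub> elt_b \<otimes>\<^bsub>\<pi>M\<^esub> elt_x"
    "elt_x \<otimes>\<^bsub>\<pi>M\<^esub> elt_l = elt_l \<otimes>\<^bsub>\<pi>M\<^esub> elt_x"
    using fig8_relations[OF _ _ a b l rel] by (simp_all add: elt_x_def)
qed

lemma (in group) generate_conj:
  assumes z: "z \<in> carrier G" and S: "S \<subseteq> carrier G"
    and gen: "\<And>s. s \<in> S \<Longrightarrow> z \<otimes> s \<otimes> inv z \<in> generate G S"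
    and h: "h \<in> generate G S"
  shows "z \<otimes> h \<otimes> inv z \<in> generate G S"
  using h
proof (induction rule: generate.induct)
  case one
  then show ?case using z generate.one by simp
next
  case (incl h)
  then show ?case by (rule gen)
next
  case (inv h)
  have "inv (z \<otimes> h \<otimes> inv z) = z \<otimes> inv h \<otimes> inv z"
    using z S inv by (auto simp: inv_mult_group m_assoc)
  then show ?case using generate_m_inv_closed[OF S gen[OF inv]] by simp
next
  case (eng h1 h2)
  have c: "h1 \<in> carrier G" "h2 \<in> carrier G" using eng generate_in_carrier[OF S] by auto
  have "z \<otimes> (h1 \<otimes> h2) \<otimes> inv z = (z \<otimes> h1 \<otimes> inv z) \<otimes> (z \<otimes> h2 \<otimes> inv z)"
  proof -
    have "inv z \<otimes> (z \<otimes> (h2 \<otimes> inv z)) = h2 \<otimes> inv z" using z c by (simp add: m_assoc[symmetric])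
    then show ?thesis using z c by (simp add: m_assoc)
  qed
  then show ?case using generate.eng[OF eng.IH] by simp
qed

lemma \<pi>F_subgroup: "subgroup \<pi>F \<pi>M"
  unfolding \<pi>F_def by (rule group.generate_is_subgroup[OF \<pi>M_group]) auto

lemma \<pi>dF_subgroup: "subgroup \<pi>dF \<pi>M"
  unfolding \<pi>dF_def by (rule group.generate_is_subgroup[OF \<pi>M_group]) auto

lemma elt_in_\<pi>F: "elt_a \<in> \<pi>F" "elt_b \<in> \<pi>F" and elt_l_in_\<pi>dF: "elt_l \<in> \<pi>dF"
  by (auto simp: \<pi>F_def \<pi>dF_def intro: generate.incl)

lemma elt_l_eq: "elt_l = inv\<^bsub>\<pi>M\<^esub> elt_b \<otimes>\<^bsub>\<pi>M\<^esub> inv\<^bsub>\<pi>M\<^esub> elt_a \<otimes>\<^bsub>\<pi>M\<^esub> elt_b \<otimes>\<^bsub>\<pi>M\<^esub> elt_a"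
  by (simp add: \<pi>M_class_mult \<pi>M_class_inv word_l_def)

lemma \<pi>dF_subset: "\<pi>dF \<subseteq> \<pi>F"
proof -
  note H = \<pi>F_subgroup
  have "elt_l \<in> \<pi>F" unfolding elt_l_eq
    by (intro subgroup.m_closed[OF H] subgroup.m_inv_closed[OF H] elt_in_\<pi>F)
  then show ?thesis unfolding \<pi>dF_def
    by (intro group.generate_subgroup_incl[OF \<pi>M_group _ H]) auto
qed

text \<open>Conjugation by \<open>x\<close> and by its inverse both carry the generators \<open>a\<close> and \<open>b\<close> into the subgroup that they
  generate, so \<open>x\<close> normalizes it; the formulas for \<open>x\<inverse>\<close> also describe how \<open>x\<close> acts on crossed homomorphisms.\<close>

lemma (in group) inverse_conj_relations:
  assumes c: "a \<in> carrier G" "b \<in> carrier G" "x \<in> carrier G"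
    and 1: "x \<otimes> a = b \<otimes> a \<otimes> x" and 2: "x \<otimes> b = b \<otimes> a \<otimes> b \<otimes> x"
  shows "x \<otimes> a \<otimes> inv x = b \<otimes> a" "x \<otimes> b \<otimes> inv x = b \<otimes> a \<otimes> b"
    "inv x \<otimes> a \<otimes> x = inv b \<otimes> a \<otimes> a" "inv x \<otimes> b \<otimes> x = inv a \<otimes> b"
proof -
  have cancel: "inv p \<otimes> (p \<otimes> q) = q" "p \<otimes> (inv p \<otimes> q) = q" if "p \<in> carrier G" "q \<in> carrier G" for p q
    using that by (simp_all add: m_assoc[symmetric])
  show "x \<otimes> a \<otimes> inv x = b \<otimes> a" "x \<otimes> b \<otimes> inv x = b \<otimes> a \<otimes> b"
    unfolding 1 2 using c by (simp_all add: m_assoc)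
  have r: "b \<otimes> (a \<otimes> (x \<otimes> w)) = x \<otimes> (a \<otimes> w)" and s: "b \<otimes> (a \<otimes> (b \<otimes> (x \<otimes> w))) = x \<otimes> (b \<otimes> w)"
    if "w \<in> carrier G" for w
  proof -
    have "b \<otimes> (a \<otimes> (x \<otimes> w)) = (b \<otimes> a \<otimes> x) \<otimes> w" using c that by (simp add: m_assoc)
    then show "b \<otimes> (a \<otimes> (x \<otimes> w)) = x \<otimes> (a \<otimes> w)" using c that unfolding 1[symmetric] by (simp add: m_assoc)
    have "b \<otimes> (a \<otimes> (b \<otimes> (x \<otimes> w))) = (b \<otimes> a \<otimes> b \<otimes> x) \<otimes> w" using c that by (simp add: m_assoc)
    then show "b \<otimes> (a \<otimes> (b \<otimes> (x \<otimes> w))) = x \<otimes> (b \<otimes> w)"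
      using c that unfolding 2[symmetric] by (simp add: m_assoc)
  qed
  have "b \<otimes> (a \<otimes> (x \<otimes> (inv a \<otimes> b))) = x \<otimes> b" using c r[of "inv a \<otimes> b"] by (simp add: cancel)
  also have "\<dots> = b \<otimes> (a \<otimes> (b \<otimes> x))" using c unfolding 2 by (simp add: m_assoc)
  finally have 3: "x \<otimes> (inv a \<otimes> b) = b \<otimes> x" using c by simp
  have "inv x \<otimes> (b \<otimes> x) = inv a \<otimes> b" unfolding 3[symmetric] using c by (simp add: cancel)
  then show "inv x \<otimes> b \<otimes> x = inv a \<otimes> b" using c by (simp add: m_assoc)
  have "b \<otimes> (a \<otimes> (b \<otimes> (x \<otimes> (inv b \<otimes> (a \<otimes> a))))) = x \<otimes> (a \<otimes> a)"
    using c s[of "inv b \<otimes> (a \<otimes> a)"] by (simp add: cancel)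
  also have "\<dots> = b \<otimes> (a \<otimes> (x \<otimes> a))" using c r[of a] by simp
  also have "\<dots> = b \<otimes> (a \<otimes> (b \<otimes> (a \<otimes> x)))" unfolding 1 using c by (simp add: m_assoc)
  finally have 4: "x \<otimes> (inv b \<otimes> (a \<otimes> a)) = a \<otimes> x" using c by simp
  have "inv x \<otimes> (a \<otimes> x) = inv b \<otimes> (a \<otimes> a)" unfolding 4[symmetric] using c by (simp add: cancel)
  then show "inv x \<otimes> a \<otimes> x = inv b \<otimes> a \<otimes> a" using c by (simp add: m_assoc)
qed

lemmas elt_conj = group.inverse_conj_relations[OF \<pi>M_group \<pi>M_class_carrier \<pi>M_class_carrier
   \<pi>M_class_carrier elt_relations(1,2)[unfolded elt_x_def], folded elt_x_def]

lemma elt_x_carrier [simp]: "elt_x \<in> carrier \<pi>M" by (simp add: elt_x_def)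

lemma elt_x_normalizes_\<pi>F:
  assumes "h \<in> \<pi>F"
  shows "elt_x \<otimes>\<^bsub>\<pi>M\<^esub> h \<otimes>\<^bsub>\<pi>M\<^esub> inv\<^bsub>\<pi>M\<^esub> elt_x \<in> \<pi>F" "inv\<^bsub>\<pi>M\<^esub> elt_x \<otimes>\<^bsub>\<pi>M\<^esub> h \<otimes>\<^bsub>\<pi>M\<^esub> elt_x \<in> \<pi>F"
proof -
  interpret group \<pi>M by (rule \<pi>M_group)
  note H = \<pi>F_subgroup
  note cl = subgroup.m_closed[OF H] subgroup.m_inv_closed[OF H] elt_in_\<pi>F
  show "elt_x \<otimes>\<^bsub>\<pi>M\<^esub> h \<otimes>\<^bsub>\<pi>M\<^esub> inv\<^bsub>\<pi>M\<^esub> elt_x \<in> \<pi>F" unfolding \<pi>F_def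
    by (rule generate_conj) (use assms in \<open>auto simp: elt_conj \<pi>F_def[symmetric] cl\<close>)
  have "inv\<^bsub>\<pi>M\<^esub> elt_x \<otimes>\<^bsub>\<pi>M\<^esub> h \<otimes>\<^bsub>\<pi>M\<^esub> inv\<^bsub>\<pi>M\<^esub> (inv\<^bsub>\<pi>M\<^esub> elt_x) \<in> \<pi>F" unfolding \<pi>F_def
    by (rule generate_conj) (use assms in \<open>auto simp: elt_conj \<pi>F_def[symmetric] cl\<close>)
  then show "inv\<^bsub>\<pi>M\<^esub> elt_x \<otimes>\<^bsub>\<pi>M\<^esub> h \<otimes>\<^bsub>\<pi>M\<^esub> elt_x \<in> \<pi>F" by simp
qed

lemma elt_x_centralizes_l:
  "elt_x \<otimes>\<^bsub>\<pi>M\<^esub> elt_l \<otimes>\<^bsub>\<pi>M\<^esub> inv\<^bsub>\<pi>M\<^esub> elt_x = elt_l" "inv\<^bsub>\<pi>M\<^esub> elt_x \<otimes>\<^bsub>\<pi>M\<^esub> elt_l \<otimes>\<^bsub>\<pi>M\<^esub> elt_x = elt_l"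
proof -
  interpret group \<pi>M by (rule \<pi>M_group)
  show "elt_x \<otimes>\<^bsub>\<pi>M\<^esub> elt_l \<otimes>\<^bsub>\<pi>M\<^esub> inv\<^bsub>\<pi>M\<^esub> elt_x = elt_l" unfolding elt_relations(3) by (simp add: m_assoc)
  have "inv\<^bsub>\<pi>M\<^esub> elt_x \<otimes>\<^bsub>\<pi>M\<^esub> (elt_l \<otimes>\<^bsub>\<pi>M\<^esub> elt_x) = elt_l" unfolding elt_relations(3)[symmetric]
    by (simp add: m_assoc[symmetric])
  then show "inv\<^bsub>\<pi>M\<^esub> elt_x \<otimes>\<^bsub>\<pi>M\<^esub> elt_l \<otimes>\<^bsub>\<pi>M\<^esub> elt_x = elt_l" by (simp add: m_assoc)
qed

lemma elt_x_normalizes_\<pi>dF: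
  assumes "h \<in> \<pi>dF"
  shows "elt_x \<otimes>\<^bsub>\<pi>M\<^esub> h \<otimes>\<^bsub>\<pi>M\<^esub> inv\<^bsub>\<pi>M\<^esub> elt_x \<in> \<pi>dF" "inv\<^bsub>\<pi>M\<^esub> elt_x \<otimes>\<^bsub>\<pi>M\<^esub> h \<otimes>\<^bsub>\<pi>M\<^esub> elt_x \<in> \<pi>dF"
proof -
  interpret group \<pi>M by (rule \<pi>M_group)
  show "elt_x \<otimes>\<^bsub>\<pi>M\<^esub> h \<otimes>\<^bsub>\<pi>M\<^esub> inv\<^bsub>\<pi>M\<^esub> elt_x \<in> \<pi>dF" unfolding \<pi>dF_def
    by (rule generate_conj) (use assms in \<open>auto simp: elt_x_centralizes_l \<pi>dF_def generate.incl\<close>)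
  have "inv\<^bsub>\<pi>M\<^esub> elt_x \<otimes>\<^bsub>\<pi>M\<^esub> h \<otimes>\<^bsub>\<pi>M\<^esub> inv\<^bsub>\<pi>M\<^esub> (inv\<^bsub>\<pi>M\<^esub> elt_x) \<in> \<pi>dF" unfolding \<pi>dF_def
    by (rule generate_conj) (use assms in \<open>auto simp: elt_x_centralizes_l \<pi>dF_def generate.incl\<close>)
  then show "inv\<^bsub>\<pi>M\<^esub> elt_x \<otimes>\<^bsub>\<pi>M\<^esub> h \<otimes>\<^bsub>\<pi>M\<^esub> elt_x \<in> \<pi>dF" by simp
qed

context linear_action
begin

lemma cocycle_one_inv:
  assumes H: "subgroup H G" and f: "f \<in> carrier (\<Z> H)"
  shows "f \<one> = 0" "h \<in> H \<Longrightarrow> f (inv h) = - act (inv h) (f h)"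
proof -
  note f = cocycleD[OF f] and cl = subgroup.one_closed[OF H] subgroup.mem_carrier[OF H] subgroup.m_inv_closed[OF H]
  show 1: "f \<one> = 0" using f(2)[of \<one> \<one>] cl by (simp add: act_one)
  show "f (inv h) = - act (inv h) (f h)" if "h \<in> H"
    using f(2)[of "inv h" h] that cl 1 by (simp add: eq_neg_iff_add_eq_0)
qed

lemma cocycle_ext:
  assumes S: "S \<subseteq> carrier G"
    and f: "f \<in> carrier (\<Z> (generate G S))" and g: "g \<in> carrier (\<Z> (generate G S))"
    and eq: "\<And>s. s \<in> S \<Longrightarrow> f s = g s"
  shows "f = g"
proof (rule cocycle_cong[OF f g])
  fix h assume "h \<in> generate G S"
  note H = generate_is_subgroup[OF S]
  from \<open>h \<in> generate G S\<close> show "f h = g h"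
  proof (induction rule: generate.induct)
    case (inv h)
    then show ?case using cocycle_one_inv(2)[OF H f] cocycle_one_inv(2)[OF H g] eq generate.incl by metis
  qed (simp_all add: cocycle_one_inv[OF H f] cocycle_one_inv[OF H g] eq cocycleD(2)[OF f] cocycleD(2)[OF g])
qed

end

section \<open>Crossed homomorphisms in coordinates\<close>

text \<open>The operators of \<open>a\<close>, \<open>b\<close>, \<open>x\<close> and of their inverses (suffix \<open>i\<close>), without the group.  Moving
  \<open>x\<close> and \<open>xi\<close> to the left past the others gives normal forms, by which the simplifier decides the identities
  below.\<close>

locale fig8_operators =
  fixes a b x ai bi xi :: "'v::real_vector \<Rightarrow> 'v"
  assumes lin: "linear a" "linear b" "linear x" "linear ai" "linear bi" "linear xi"
    and cancel: "a (ai v) = v" "ai (a v) = v" "b (bi v) = v" "bi (b v) = v" "x (xi v) = v" "xi (x v) = v"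
    and rel_a: "x (a v) = b (a (x v))" and rel_b: "x (b v) = b (a (b (x v)))"
begin

lemmas linear_simps =
  lin[THEN linear_add] lin[THEN linear_diff] lin[THEN linear_neg] lin[THEN linear_0]

lemma commute_xi:
  "a (xi v) = xi (b (a v))" "b (xi v) = xi (b (a (b v)))"
  "ai (xi v) = xi (ai (bi v))" "bi (xi v) = xi (bi (ai (bi v)))"
proof -
  show 1: "a (xi v) = xi (b (a v))" for v using rel_a[of "xi v"] by (metis cancel)
  show 2: "b (xi v) = xi (b (a (b v)))" for v using rel_b[of "xi v"] by (metis cancel)
  show "ai (xi v) = xi (ai (bi v))" using 1[of "ai (bi v)"] by (metis cancel)
  show "bi (xi v) = xi (bi (ai (bi v)))" using 2[of "bi (ai (bi v))"] by (metis cancel)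
qed

lemma commute_x:
  "a (x v) = x (bi (a (a v)))" "b (x v) = x (ai (b v))"
  "ai (x v) = x (ai (ai (b v)))" "bi (x v) = x (bi (a v))"
proof -
  show 2: "b (x v) = x (ai (b v))" for v
    using rel_b[of v] rel_a[of "ai (b v)"] by (metis cancel)
  have 4: "bi (x v) = x (bi (a v))" for v using 2[of "bi (a v)"] by (metis cancel)
  show 1: "a (x v) = x (bi (a (a v)))" for v using rel_a[of "a v"] rel_a[of v] 4[of "a v"] by (metis cancel)
  show "ai (x v) = x (ai (ai (b v)))" using 1[of "ai (ai (b v))"] by (metis cancel)
  show "bi (x v) = x (bi (a v))" by (rule 4)
qed

text \<open>The crossed homomorphism \<open>f\<close> with \<open>f a = A\<close> and \<open>f b = B\<close> would make the fiber group act on \<open>V\<close> by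
  the affine maps \<open>v \<mapsto> f h + h v\<close>.  That it exists for all \<open>A\<close> and \<open>B\<close> expresses the freeness of the
  fiber group.  The affine action is constructed for all pairs at once, as an action of the whole knot group
  on triples \<open>(A, B, v)\<close>, which amounts to a check of the single relator: \<open>x\<close> moves the pair to that of
  the transformed crossed homomorphism and \<open>v\<close> to \<open>x v\<close>, and \<open>y = b\<inverse> x\<close>.\<close>

definition letter :: "gen \<times> bool \<Rightarrow> 'v \<times> 'v \<times> 'v \<Rightarrow> 'v \<times> 'v \<times> 'v" where
  "letter c = (\<lambda>(A, B, v). case c of
      (gen_x, e) \<Rightarrow> if e then (x (bi (A + a A - B)), x (ai (B - A)), x v)
                    else (xi (B + b A), xi (B + b A + b (a B)), xi v)
    | (gen_y, e) \<Rightarrow> if e then (x (bi (A + a A - B)), x (ai (B - A)), bi (x v - x (ai (B - A))))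
                    else (xi (B + b A), xi (B + b A + b (a B)), xi (B + b v)))"

lemma letter_simps:
  "letter (gen_x, True) (A, B, v) = (x (bi (A + a A - B)), x (ai (B - A)), x v)"
  "letter (gen_x, False) (A, B, v) = (xi (B + b A), xi (B + b A + b (a B)), xi v)"
  "letter (gen_y, True) (A, B, v) = (x (bi (A + a A - B)), x (ai (B - A)), bi (x v - x (ai (B - A))))"
  "letter (gen_y, False) (A, B, v) = (xi (B + b A), xi (B + b A + b (a B)), xi (B + b v))"
  by (simp_all add: letter_def)

lemmas normalize = letter_simps linear_simps cancel commute_x commute_xi

lemma letter_cancel: "letter (g, e) (letter (g, \<not> e) s) = s"
  by (cases s; cases g; cases e) (simp_all add: normalize algebra_simps)

lemma letter_word_b: "foldr letter word_b (A, B, v) = (A, B, B + b v)"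
  by (simp add: word_b_def word_x_def word_y_def word_inv_def normalize algebra_simps)

lemma letter_word_a: "foldr letter word_a (A, B, v) = (A, B, A + a v)"
  by (simp add: word_a_def word_x_def word_y_def word_inv_def normalize algebra_simps)

lemma letter_word_inv: "foldr letter w (foldr letter (word_inv w) s) = s"
proof (induction w arbitrary: s)
  case (Cons c w)
  obtain g e where "c = (g, e)" by force
  then show ?case using Cons[of "letter (g, \<not> e) s"] letter_cancel[of g e] by (simp add: word_inv_simps)
qed (simp add: word_inv_simps)

lemma letter_relators: "r \<in> fig8_relators \<Longrightarrow> foldr letter r s = s"
proof -
  assume "r \<in> fig8_relators"
  then have r: "r = (word_a @ word_x) @ word_inv (word_y @ word_a)" by (simp add: fig8_relators_def)
  have "foldr letter (word_a @ word_x) (A, B, v) = foldr letter (word_y @ word_a) (A, B, v)" for A B v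
    by (simp add: letter_word_a) (simp add: word_x_def word_y_def normalize letter_word_a algebra_simps)
  then have "foldr letter (word_a @ word_x) s = foldr letter (word_y @ word_a) s" for s by (cases s) blast
  then have "foldr letter r s = foldr letter (word_y @ word_a) (foldr letter (word_inv (word_y @ word_a)) s)"
    unfolding r foldr_append[of letter "word_a @ word_x"] by (simp del: foldr_append)
  then show "foldr letter r s = s" by (simp only: letter_word_inv)
qed

lemma letter_word_eq: "word_eq fig8_relators v w \<Longrightarrow> foldr letter v = foldr letter w"
  using word_eq_foldr[OF _ letter_cancel letter_relators] by blast

end

locale fig8_action = linear_action \<pi>M V act for V :: "'v::real_vector set" and act
begin

abbreviation "a \<equiv> act elt_a"
abbreviation "b \<equiv> act elt_b"
abbreviation "x \<equiv> act elt_x"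
abbreviation "ai \<equiv> act (inv\<^bsub>\<pi>M\<^esub> elt_a)"
abbreviation "bi \<equiv> act (inv\<^bsub>\<pi>M\<^esub> elt_b)"
abbreviation "xi \<equiv> act (inv\<^bsub>\<pi>M\<^esub> elt_x)"

sublocale op: fig8_operators a b x ai bi xi
proof (rule fig8_operators.intro)
  show "x (a v) = b (a (x v))" "x (b v) = b (a (b (x v)))" for v
    using arg_cong[OF elt_relations(1), of "\<lambda>g. act g v"] arg_cong[OF elt_relations(2), of "\<lambda>g. act g v"]
    by (simp_all add: act_mult)
qed (simp_all add: act_linear act_inv)

lemma x_normalizes: "normalizes elt_x \<pi>F" "normalizes elt_x \<pi>dF"
  using elt_x_normalizes_\<pi>F elt_x_normalizes_\<pi>dF by (auto simp: normalizes_def)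

text \<open>By \<open>letter_word_eq\<close> the choice of the representative word is immaterial.\<close>

definition triple_act :: "gen word set \<Rightarrow> 'v \<times> 'v \<times> 'v \<Rightarrow> 'v \<times> 'v \<times> 'v" where
  "triple_act g = foldr op.letter (SOME w. g = \<pi>M_class w)"

lemma triple_act_class: "triple_act (\<pi>M_class w) = foldr op.letter w"
proof -
  have "\<pi>M_class w = \<pi>M_class (SOME w'. \<pi>M_class w = \<pi>M_class w')"
    by (rule someI[of "\<lambda>w'. \<pi>M_class w = \<pi>M_class w'" w]) simp
  then have "word_eq fig8_relators w (SOME w'. \<pi>M_class w = \<pi>M_class w')"
    by (rule iffD1[OF \<pi>M_class_eq_iff])
  then show ?thesis unfolding triple_act_def by (rule op.letter_word_eq[symmetric])
qed

lemma triple_act_mult: "g \<in> carrier \<pi>M \<Longrightarrow> h \<in> carrier \<pi>M \<Longrightarrow> triple_act (g \<otimes>\<^bsub>\<pi>M\<^esub> h) s = triple_act g (triple_act h s)"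
  by (auto simp: \<pi>M_carrier \<pi>M_class_mult triple_act_class)

lemma triple_act_one: "triple_act \<one>\<^bsub>\<pi>M\<^esub> s = s"
  by (simp add: \<pi>M_class_one triple_act_class)

text \<open>The elements of the fiber group fix the pair, and act on the third component by affine maps whose linear
  part is the given action.\<close>

lemma triple_act_fiber:
  assumes AB: "A \<in> V" "B \<in> V" and h: "h \<in> \<pi>F"
  shows "\<exists>c\<in>V. \<forall>v. triple_act h (A, B, v) = (A, B, c + act h v)"
  using h unfolding \<pi>F_def
proof (induction rule: generate.induct)
  case one
  show ?case by (intro bexI[of _ 0]) (simp_all add: triple_act_one act_one V_closed)
next
  case (incl h)
  then show ?case
    using AB op.letter_word_a op.letter_word_b by (auto simp: triple_act_class)
next
  case (inv h)
  have hc: "h \<in> carrier \<pi>M" using inv by auto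
  obtain c where c: "c \<in> V" "\<And>v. triple_act h (A, B, v) = (A, B, c + act h v)"
    using inv AB op.letter_word_a op.letter_word_b by (auto simp: triple_act_class)
  have "triple_act (inv\<^bsub>\<pi>M\<^esub> h) (A, B, v) = (A, B, - act (inv\<^bsub>\<pi>M\<^esub> h) c + act (inv\<^bsub>\<pi>M\<^esub> h) v)" for v
  proof -
    have "triple_act h (A, B, - act (inv\<^bsub>\<pi>M\<^esub> h) c + act (inv\<^bsub>\<pi>M\<^esub> h) v) = (A, B, v)"
      using hc by (simp add: c act_simps act_inv)
    moreover have "triple_act (inv\<^bsub>\<pi>M\<^esub> h) (triple_act h s) = s" for s
      using hc triple_act_mult[of "inv\<^bsub>\<pi>M\<^esub> h" h s] by (simp add: triple_act_one)
    ultimately show ?thesis by metis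
  qed
  then show ?case using c(1) hc by (intro bexI[of _ "- act (inv\<^bsub>\<pi>M\<^esub> h) c"]) (simp_all add: V_closed act_closed)
next
  case (eng h1 h2)
  have hc: "h1 \<in> carrier \<pi>M" "h2 \<in> carrier \<pi>M"
    using eng subgroup.mem_carrier[OF \<pi>F_subgroup] by (auto simp: \<pi>F_def)
  obtain c1 c2 where "c1 \<in> V" "\<And>v. triple_act h1 (A, B, v) = (A, B, c1 + act h1 v)"
     "c2 \<in> V" "\<And>v. triple_act h2 (A, B, v) = (A, B, c2 + act h2 v)" using eng by blast
  then show ?case using hc
    by (intro bexI[of _ "c1 + act h1 c2"])
       (simp_all add: triple_act_mult act_mult act_simps V_closed act_closed add.assoc)
qed

text \<open>The translation part of an affine action is a crossed homomorphism.\<close>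

lemma fiber_cocycle_exists:
  assumes AB: "A \<in> V" "B \<in> V"
  shows "\<exists>f\<in>carrier (\<Z> \<pi>F). f elt_a = A \<and> f elt_b = B"
proof -
  define f where "f = (\<lambda>h\<in>\<pi>F. snd (snd (triple_act h (A, B, 0))))"
  have f: "triple_act h (A, B, v) = (A, B, f h + act h v)" "f h \<in> V" if h: "h \<in> \<pi>F" for h v
  proof -
    obtain c where c: "c \<in> V" "\<forall>v. triple_act h (A, B, v) = (A, B, c + act h v)"
      using triple_act_fiber[OF AB h] by blast
    have "h \<in> carrier \<pi>M" using subgroup.mem_carrier[OF \<pi>F_subgroup h] .
    then have "f h = c" using c h by (simp add: f_def act_simps)
    then show "triple_act h (A, B, v) = (A, B, f h + act h v)" "f h \<in> V" using c by auto
  qed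
  have "f \<in> carrier (\<Z> \<pi>F)"
  proof (rule cocycleI)
    show "f (g \<otimes>\<^bsub>\<pi>M\<^esub> h) = f g + act g (f h)" if gh: "g \<in> \<pi>F" "h \<in> \<pi>F" for g h
    proof -
    have c: "g \<in> carrier \<pi>M" "h \<in> carrier \<pi>M" "g \<otimes>\<^bsub>\<pi>M\<^esub> h \<in> \<pi>F"
      using gh subgroup.mem_carrier[OF \<pi>F_subgroup] subgroup.m_closed[OF \<pi>F_subgroup] by auto
    show ?thesis
      using f(1)[OF c(3), of 0] triple_act_mult[OF c(1,2), of "(A, B, 0)"] f(1)[OF gh(1)] f(1)[OF gh(2)] c
      by (simp add: act_simps)
    qed
    show "f \<in> extensional \<pi>F" by (simp add: f_def)
    show "f h \<in> V" if "h \<in> \<pi>F" for h using f(2)[OF that] .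
  qed
  moreover have "f elt_a = A" "f elt_b = B"
    using f(1)[OF elt_in_\<pi>F(1), of 0] f(1)[OF elt_in_\<pi>F(2), of 0] op.letter_word_a op.letter_word_b
    by (auto simp: triple_act_class act_simps)
  ultimately show ?thesis by blast
qed

lemma fiber_cocycle_ext:
  assumes "f \<in> carrier (\<Z> \<pi>F)" "g \<in> carrier (\<Z> \<pi>F)"
    and "f elt_a = g elt_a" "f elt_b = g elt_b"
  shows "f = g"
  using assms unfolding \<pi>F_def by (intro cocycle_ext[of "{elt_a, elt_b}" f g]) auto

lemma boundary_cocycle_ext:
  assumes "f \<in> carrier (\<Z> \<pi>dF)" "g \<in> carrier (\<Z> \<pi>dF)"
    and "f elt_l = g elt_l"
  shows "f = g"
  using assms unfolding \<pi>dF_def by (intro cocycle_ext[of "{elt_l}" f g]) auto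

text \<open>The coefficients of \<open>f a\<close> and \<open>f b\<close> are the Fox derivatives of \<open>l = b\<inverse> a\<inverse> b a\<close>.\<close>

lemma fiber_cocycle_l:
  assumes "f \<in> carrier (\<Z> \<pi>F)"
  shows "f elt_l = bi (ai (b (f elt_a) - f elt_a + f elt_b - a (f elt_b)))"
proof -
  note H = \<pi>F_subgroup
  note cl = subgroup.m_closed[OF H] subgroup.m_inv_closed[OF H] elt_in_\<pi>F
  show ?thesis unfolding elt_l_eq
    by (simp add: cocycleD(2)[OF assms] cl cocycle_one_inv(2)[OF H assms] act_mult act_simps act_inv algebra_simps)
qed

text \<open>The action of \<open>x\<close> on the pair of values at \<open>a\<close> and \<open>b\<close>; the formula comes from
  \<open>x\<inverse> a x = b\<inverse> a a\<close> and \<open>x\<inverse> b x = a\<inverse> b\<close>.\<close>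

definition twist :: "'v \<times> 'v \<Rightarrow> 'v \<times> 'v" where
  "twist = (\<lambda>(A, B). (x (bi (A + a A - B)), x (ai (B - A))))"

lemma x_cochain_fiber:
  assumes "f \<in> carrier (\<Z> \<pi>F)"
  shows "(x_cochain \<pi>M \<pi>F act elt_x f elt_a, x_cochain \<pi>M \<pi>F act elt_x f elt_b) = twist (f elt_a, f elt_b)"
proof -
  note H = \<pi>F_subgroup
  note cl = subgroup.m_closed[OF H] subgroup.m_inv_closed[OF H] elt_in_\<pi>F
  show ?thesis
    by (simp add: x_cochain_def cl elt_conj twist_def cocycleD(2)[OF assms] cocycle_one_inv(2)[OF H assms]
       act_mult act_simps algebra_simps)
qed

lemma x_cochain_boundary:
  "x_cochain \<pi>M \<pi>dF act elt_x f elt_l = x (f elt_l)"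
  by (simp add: x_cochain_def elt_l_in_\<pi>dF elt_x_centralizes_l)

lemma fiber_coboundary_iff:
  assumes "f \<in> carrier (\<Z> \<pi>F)"
  shows "f \<in> \<B> \<pi>F \<longleftrightarrow> (\<exists>w\<in>V. f elt_a = a w - w \<and> f elt_b = b w - w)"
proof
  assume "f \<in> \<B> \<pi>F"
  then show "\<exists>w\<in>V. f elt_a = a w - w \<and> f elt_b = b w - w" by (auto simp: B1_def elt_in_\<pi>F)
next
  assume "\<exists>w\<in>V. f elt_a = a w - w \<and> f elt_b = b w - w"
  then obtain w where w: "w \<in> V" "f elt_a = a w - w" "f elt_b = b w - w" by blast
  have d: "(\<lambda>h\<in>\<pi>F. act h w - w) \<in> \<B> \<pi>F" using w by (auto simp: B1_def)
  then have "(\<lambda>h\<in>\<pi>F. act h w - w) \<in> carrier (\<Z> \<pi>F)"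
    using B1_linear_subset[OF \<pi>F_subgroup] by (auto simp: linear_subset_def)
  then have "f = (\<lambda>h\<in>\<pi>F. act h w - w)" using w
    by (intro fiber_cocycle_ext[OF assms]) (simp_all add: elt_in_\<pi>F)
  then show "f \<in> \<B> \<pi>F" using d by simp
qed

lemma boundary_coboundary_iff:
  assumes "f \<in> carrier (\<Z> \<pi>dF)"
  shows "f \<in> \<B> \<pi>dF \<longleftrightarrow> (\<exists>w\<in>V. f elt_l = act elt_l w - w)"
proof
  assume "f \<in> \<B> \<pi>dF"
  then show "\<exists>w\<in>V. f elt_l = act elt_l w - w" by (auto simp: B1_def elt_l_in_\<pi>dF)
next
  assume "\<exists>w\<in>V. f elt_l = act elt_l w - w"
  then obtain w where w: "w \<in> V" "f elt_l = act elt_l w - w" by blast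
  have d: "(\<lambda>h\<in>\<pi>dF. act h w - w) \<in> \<B> \<pi>dF" using w by (auto simp: B1_def)
  then have "(\<lambda>h\<in>\<pi>dF. act h w - w) \<in> carrier (\<Z> \<pi>dF)"
    using B1_linear_subset[OF \<pi>dF_subgroup] by (auto simp: linear_subset_def)
  then have "f = (\<lambda>h\<in>\<pi>dF. act h w - w)" using w
    by (intro boundary_cocycle_ext[OF assms]) (simp_all add: elt_l_in_\<pi>dF)
  then show "f \<in> \<B> \<pi>dF" using d by simp
qed

lemma combination_cocycle:
  assumes H: "subgroup H \<pi>M" and "f \<in> carrier (\<Z> H)" "g \<in> carrier (\<Z> H)"
  shows "(\<lambda>h\<in>H. f h - r *\<^sub>R g h) \<in> carrier (\<Z> H)"
  by (rule cocycleI)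
     (use subgroup.m_closed[OF H] subgroup.mem_carrier[OF H] in
      \<open>auto simp: cocycleD[OF assms(2)] cocycleD[OF assms(3)] V_closed act_simps algebra_simps\<close>)

lemma fiber_invariants_line:
  fixes p0 :: "'v \<times> 'v"
  defines "C \<equiv> (\<lambda>w. (a w - w, b w - w)) ` V"
  assumes p0: "p0 \<in> V \<times> V" "p0 \<notin> C" "twist p0 - p0 \<in> C"
    and gen: "\<And>p. p \<in> V \<times> V \<Longrightarrow> twist p - p \<in> C \<Longrightarrow> \<exists>r. p - r *\<^sub>R p0 \<in> C"
  defines "I \<equiv> x_invariants (H1 \<pi>M \<pi>F V act) (x_class \<pi>F elt_x)"
  shows "vectorspace real_ring I" "\<exists>c\<in>carrier I. c \<noteq> \<zero>\<^bsub>I\<^esub> \<and> (\<forall>m\<in>carrier I. \<exists>r. m = r \<odot>\<^bsub>I\<^esub> c)"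
proof -
  have cob: "f \<in> \<B> \<pi>F \<longleftrightarrow> (f elt_a, f elt_b) \<in> C" if "f \<in> carrier (\<Z> \<pi>F)" for f
    using fiber_coboundary_iff[OF that] by (auto simp: C_def)
  have inv: "(\<lambda>h\<in>\<pi>F. x_cochain \<pi>M \<pi>F act elt_x f h - f h) \<in> \<B> \<pi>F \<longleftrightarrow>
      twist (f elt_a, f elt_b) - (f elt_a, f elt_b) \<in> C" if f: "f \<in> carrier (\<Z> \<pi>F)" for f
  proof -
    have xf: "x_cochain \<pi>M \<pi>F act elt_x f \<in> carrier (\<Z> \<pi>F)"
      by (rule module_hom_realD(1)[OF x_cochain_hom[OF \<pi>F_subgroup x_normalizes(1)] f])
    from combination_cocycle[OF \<pi>F_subgroup xf f, of 1]
    have d: "(\<lambda>h\<in>\<pi>F. x_cochain \<pi>M \<pi>F act elt_x f h - f h) \<in> carrier (\<Z> \<pi>F)" by simp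
    show ?thesis unfolding cob[OF d] x_cochain_fiber[OF f, symmetric] by (simp add: elt_in_\<pi>F)
  qed
  obtain f0 where f0: "f0 \<in> carrier (\<Z> \<pi>F)" "(f0 elt_a, f0 elt_b) = p0"
    using fiber_cocycle_exists[of "fst p0" "snd p0"] p0(1) by (metis mem_Times_iff prod.collapse)
  note * = H1_invariants_line[OF \<pi>F_subgroup x_normalizes(1) f0(1), folded I_def]
  have g: "\<exists>r. (\<lambda>h\<in>\<pi>F. f h - r *\<^sub>R f0 h) \<in> \<B> \<pi>F"
    if f: "f \<in> carrier (\<Z> \<pi>F)"
      and i: "(\<lambda>h\<in>\<pi>F. x_cochain \<pi>M \<pi>F act elt_x f h - f h) \<in> \<B> \<pi>F" for f
  proof -
    have "(f elt_a, f elt_b) \<in> V \<times> V" using cocycleD(1)[OF f] by (simp add: elt_in_\<pi>F)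
    then obtain r where "(f elt_a, f elt_b) - r *\<^sub>R p0 \<in> C" using gen i inv[OF f] by blast
    then show ?thesis
      using cob[OF combination_cocycle[OF \<pi>F_subgroup f f0(1)], of r] f0(2)
      by (intro exI[of _ r]) (auto simp: elt_in_\<pi>F)
  qed
  show "vectorspace real_ring I" "\<exists>c\<in>carrier I. c \<noteq> \<zero>\<^bsub>I\<^esub> \<and> (\<forall>m\<in>carrier I. \<exists>r. m = r \<odot>\<^bsub>I\<^esub> c)"
    using * g cob[OF f0(1)] inv[OF f0(1)] p0 f0(2) by auto
qed

context
  assumes coinv: "\<And>v. v \<in> V \<Longrightarrow> \<exists>A\<in>V. \<exists>B\<in>V. v = (b A - A) + (B - a B)"
begin

text \<open>Up to the invertible factor \<open>b\<inverse> a\<inverse>\<close> the possible values at \<open>l\<close> are the elements of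
  \<open>(b - 1) V + (1 - a) V\<close>.\<close>

lemma boundary_value_lifts:
  assumes v: "v \<in> V"
  shows "\<exists>g\<in>carrier (\<Z> \<pi>F). g elt_l = v"
proof -
  have "a (b v) \<in> V" using v by (simp add: act_closed)
  then obtain A B where AB: "A \<in> V" "B \<in> V" "a (b v) = (b A - A) + (B - a B)" using coinv by blast
  obtain g where g: "g \<in> carrier (\<Z> \<pi>F)" "g elt_a = A" "g elt_b = B"
    using fiber_cocycle_exists[OF AB(1,2)] by blast
  have "g elt_l = bi (ai (a (b v)))" unfolding fiber_cocycle_l[OF g(1)] AB(3) g(2,3) by (simp add: algebra_simps)
  then show ?thesis using g(1) by (auto simp: act_inv)
qed

lemma fiber_short_exact:
  "x_short_exact
     ((H1 \<pi>M \<pi>F V act)\<lparr>carrier := induced (\<Z> \<pi>F) (\<B> \<pi>F) (\<lambda>f. f) ` carrier (H1_rel \<pi>M \<pi>F \<pi>dF V act)\<rparr>)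
     (x_class \<pi>F elt_x) (\<lambda>c. c)
     (H1 \<pi>M \<pi>F V act) (x_class \<pi>F elt_x)
     (induced (\<Z> \<pi>dF) (\<B> \<pi>dF) (\<lambda>f. restrict f \<pi>dF))
     (H1 \<pi>M \<pi>dF V act) (x_class \<pi>dF elt_x)"
proof (rule pair_short_exact[OF \<pi>F_subgroup x_normalizes(1) \<pi>dF_subgroup x_normalizes(2) \<pi>dF_subset])
  fix f assume f: "f \<in> carrier (\<Z> \<pi>dF)"
  then obtain g where g: "g \<in> carrier (\<Z> \<pi>F)" "g elt_l = f elt_l"
    using boundary_value_lifts cocycleD(1)[OF f elt_l_in_\<pi>dF] by blast
  note r = module_hom_realD(1)[OF restrict_hom[OF \<pi>F_subgroup x_normalizes(1) \<pi>dF_subgroup x_normalizes(2) \<pi>dF_subset] g(1)]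
  have "restrict g \<pi>dF = f" using g(2) by (intro boundary_cocycle_ext[OF r f]) (simp add: elt_l_in_\<pi>dF)
  then have "restrict g \<pi>dF \<ominus>\<^bsub>\<Z> \<pi>dF\<^esub> f = \<zero>\<^bsub>\<Z> \<pi>dF\<^esub>"
    unfolding minus_cocycle[OF \<pi>dF_subgroup r f] by (simp add: Z1_simps(2))
  then show "\<exists>g\<in>carrier (\<Z> \<pi>F). restrict g \<pi>dF \<ominus>\<^bsub>\<Z> \<pi>dF\<^esub> f \<in> \<B> \<pi>dF"
    using g(1) B1_linear_subset[OF \<pi>dF_subgroup] by (intro bexI[of _ g]) (auto simp: linear_subset_def)
qed

text \<open>That \<open>l\<close> has infinite order is not visible from the presentation.  A cocycle on its powers with a prescribed
  value at \<open>l\<close> is instead obtained by restriction from the fiber group.\<close>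

lemma boundary_invariants_line:
  defines "C \<equiv> (\<lambda>w. act elt_l w - w) ` V"
  assumes v0: "v0 \<in> V" "v0 \<notin> C" "x v0 - v0 \<in> C"
    and gen: "\<And>v. v \<in> V \<Longrightarrow> x v - v \<in> C \<Longrightarrow> \<exists>r. v - r *\<^sub>R v0 \<in> C"
  defines "I \<equiv> x_invariants (H1 \<pi>M \<pi>dF V act) (x_class \<pi>dF elt_x)"
  shows "vectorspace real_ring I" "\<exists>c\<in>carrier I. c \<noteq> \<zero>\<^bsub>I\<^esub> \<and> (\<forall>m\<in>carrier I. \<exists>r. m = r \<odot>\<^bsub>I\<^esub> c)"
proof -
  have cob: "f \<in> \<B> \<pi>dF \<longleftrightarrow> f elt_l \<in> C" if "f \<in> carrier (\<Z> \<pi>dF)" for f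
    using boundary_coboundary_iff[OF that] by (auto simp: C_def)
  have inv: "(\<lambda>h\<in>\<pi>dF. x_cochain \<pi>M \<pi>dF act elt_x f h - f h) \<in> \<B> \<pi>dF \<longleftrightarrow>
      x (f elt_l) - f elt_l \<in> C" if f: "f \<in> carrier (\<Z> \<pi>dF)" for f
  proof -
    have xf: "x_cochain \<pi>M \<pi>dF act elt_x f \<in> carrier (\<Z> \<pi>dF)"
      by (rule module_hom_realD(1)[OF x_cochain_hom[OF \<pi>dF_subgroup x_normalizes(2)] f])
    from combination_cocycle[OF \<pi>dF_subgroup xf f, of 1]
    have d: "(\<lambda>h\<in>\<pi>dF. x_cochain \<pi>M \<pi>dF act elt_x f h - f h) \<in> carrier (\<Z> \<pi>dF)" by simp
    show ?thesis unfolding cob[OF d] x_cochain_boundary[of f, symmetric] by (simp add: elt_l_in_\<pi>dF)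
  qed
  obtain g where g: "g \<in> carrier (\<Z> \<pi>F)" "g elt_l = v0" using boundary_value_lifts[OF v0(1)] by blast
  define f0 where "f0 = restrict g \<pi>dF"
  have f0: "f0 \<in> carrier (\<Z> \<pi>dF)" "f0 elt_l = v0"
    using module_hom_realD(1)[OF restrict_hom[OF \<pi>F_subgroup x_normalizes(1) \<pi>dF_subgroup x_normalizes(2) \<pi>dF_subset] g(1)] g(2)
    by (simp_all add: f0_def elt_l_in_\<pi>dF)
  note * = H1_invariants_line[OF \<pi>dF_subgroup x_normalizes(2) f0(1), folded I_def]
  have ge: "\<exists>r. (\<lambda>h\<in>\<pi>dF. f h - r *\<^sub>R f0 h) \<in> \<B> \<pi>dF"
    if f: "f \<in> carrier (\<Z> \<pi>dF)"
      and i: "(\<lambda>h\<in>\<pi>dF. x_cochain \<pi>M \<pi>dF act elt_x f h - f h) \<in> \<B> \<pi>dF" for f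
  proof -
    have "f elt_l \<in> V" using cocycleD(1)[OF f] by (simp add: elt_l_in_\<pi>dF)
    then obtain r where "f elt_l - r *\<^sub>R v0 \<in> C" using gen i inv[OF f] by blast
    then show ?thesis
      using cob[OF combination_cocycle[OF \<pi>dF_subgroup f f0(1)], of r] f0(2)
      by (intro exI[of _ r]) (auto simp: elt_l_in_\<pi>dF)
  qed
  show "vectorspace real_ring I" "\<exists>c\<in>carrier I. c \<noteq> \<zero>\<^bsub>I\<^esub> \<and> (\<forall>m\<in>carrier I. \<exists>r. m = r \<odot>\<^bsub>I\<^esub> c)"
    using * ge cob[OF f0(1)] inv[OF f0(1)] v0 f0(2) by auto
qed

end

end

section \<open>The Lorentz representation\<close>

text \<open>The adjugate is the inverse in determinant \<open>1\<close>, but it depends linearly on the matrix and also applies to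
  singular matrices and to differences such as \<open>x - x\<inverse>\<close>.\<close>

definition adj2 :: "complex^2^2 \<Rightarrow> complex^2^2" where
  "adj2 A = vector [vector [A$2$2, - A$1$2], vector [- A$2$1, A$1$1]]"

lemmas matrix2_simps = vec_eq_iff forall_2 matrix_matrix_mult_def sum_2 mat_def det_2 adj2_def vector_2

lemma adj2_mult: "adj2 A ** A = mat (det A)" "A ** adj2 A = mat (det A)"
  by (simp_all add: matrix2_simps algebra_simps)

lemma adj2_adj2 [simp]: "adj2 (adj2 A) = A" by (simp add: matrix2_simps)

lemma det_adj2 [simp]: "det (adj2 A) = det A" by (simp add: matrix2_simps)

lemma matrix_inv_eqI:
  fixes A B :: "'a::field^'n^'n"
  assumes "A ** B = mat 1"
  shows "matrix_inv A = B"
proof -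
  have "B ** A = mat 1" using assms matrix_left_right_inverse by metis
  have "A ** matrix_inv A = mat 1 \<and> matrix_inv A ** A = mat 1"
    unfolding matrix_inv_def by (rule someI[of _ B]) (use assms \<open>B ** A = mat 1\<close> in blast)
  then have "matrix_inv A = (B ** A) ** matrix_inv A" "B = B ** (A ** matrix_inv A)"
    using \<open>B ** A = mat 1\<close> by simp_all
  then show ?thesis by (simp add: matrix_mul_assoc)
qed

lemma matrix_inv_det_1: "det A = 1 \<Longrightarrow> matrix_inv A = adj2 A"
  by (rule matrix_inv_eqI) (simp add: adj2_mult)

lemma vector_4 [simp]:
  "(vector [w, x, y, z] :: ('a::zero)^4) $ 1 = w" "(vector [w, x, y, z] :: ('a::zero)^4) $ 2 = x"
  "(vector [w, x, y, z] :: ('a::zero)^4) $ 3 = y" "(vector [w, x, y, z] :: ('a::zero)^4) $ 4 = z"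
  unfolding vector_def by simp_all

lemma matrix_add_rdistrib': "(A + B) ** C = A ** C + B ** C" for A B :: "'a::semiring_1^'n^'m"
  by (vector matrix_matrix_mult_def sum.distrib[symmetric] field_simps)

lemma matrix_sub_distrib:
  "(A - B) ** C = A ** C - B ** C" "D ** (A - B) = D ** A - D ** B" for A B :: "'a::ring_1^'n^'m"
  by (simp_all add: vec_eq_iff matrix_matrix_mult_def sum_subtractf left_diff_distrib right_diff_distrib)

lemma conj_transpose_mult: "conj_transpose (A ** B) = conj_transpose B ** conj_transpose A"
  by (simp add: matrix2_simps conj_transpose_def algebra_simps)

lemma conj_transpose_twice [simp]: "conj_transpose (conj_transpose A) = A"
  by (simp add: matrix2_simps conj_transpose_def)

lemma conj_transpose_hermitian [simp]: "conj_transpose (hermitian p) = hermitian p"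
  by (simp add: matrix2_simps conj_transpose_def hermitian_def complex_eq_iff)

lemma hermitian_coords_hermitian [simp]: "hermitian_coords (hermitian p) = p"
  by (simp add: hermitian_def hermitian_coords_def vec_eq_iff forall_4)

lemma hermitian_hermitian_coords:
  assumes "conj_transpose X = X" shows "hermitian (hermitian_coords X) = X"
proof -
  have "conj_transpose X $ i $ j = X $ i $ j" for i j by (simp add: assms)
  from this[of 1 1] this[of 1 2] this[of 2 2]
  have "Im (X$1$1) = 0" "Im (X$2$2) = 0" "Re (X$2$1) = Re (X$1$2)" "Im (X$2$1) = - Im (X$1$2)"
    by (auto simp: conj_transpose_def complex_eq_iff)
  then show ?thesis
    by (simp add: hermitian_def hermitian_coords_def vec_eq_iff forall_2 complex_eq_iff field_simps)
qed

lemma hermitian_linear: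
  "hermitian (p + q) = hermitian p + hermitian q" "hermitian (c *\<^sub>R p) = c *\<^sub>R hermitian p"
  by (simp_all add: hermitian_def vec_eq_iff forall_2 complex_eq_iff algebra_simps)

lemma hermitian_coords_linear:
  "hermitian_coords (X + Y) = hermitian_coords X + hermitian_coords Y"
  "hermitian_coords (c *\<^sub>R X) = c *\<^sub>R hermitian_coords X"
  by (simp_all add: hermitian_coords_def vec_eq_iff forall_4 field_simps)

lemma lorentz_apply: "lorentz A *v p = hermitian_coords (A ** hermitian p ** conj_transpose A)"
proof -
  have "linear (\<lambda>p. hermitian_coords (A ** hermitian p ** conj_transpose A))"
  proof (rule linearI)
    fix p q :: "real^4" and c
    show "hermitian_coords (A ** hermitian (p + q) ** conj_transpose A) =
      hermitian_coords (A ** hermitian p ** conj_transpose A) + hermitian_coords (A ** hermitian q ** conj_transpose A)"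
      by (simp add: hermitian_linear matrix_add_ldistrib matrix_add_rdistrib' hermitian_coords_linear)
    have "A ** (c *\<^sub>R hermitian p) ** conj_transpose A = c *\<^sub>R (A ** hermitian p ** conj_transpose A)"
      by (simp add: vec_eq_iff matrix_matrix_mult_def scaleR_sum_right sum_distrib_right)
    then show "hermitian_coords (A ** hermitian (c *\<^sub>R p) ** conj_transpose A) =
      c *\<^sub>R hermitian_coords (A ** hermitian p ** conj_transpose A)"
      by (simp add: hermitian_linear hermitian_coords_linear)
  qed
  then show ?thesis unfolding lorentz_def by (simp add: matrix_works)
qed

lemma hermitian_lorentz: "hermitian (lorentz A *v p) = A ** hermitian p ** conj_transpose A"
  unfolding lorentz_apply
  by (rule hermitian_hermitian_coords) (simp add: conj_transpose_mult matrix_mul_assoc)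

lemma lorentz_mult: "lorentz (A ** B) = lorentz A ** lorentz B"
proof -
  have "lorentz (A ** B) *v p = (lorentz A ** lorentz B) *v p" for p
    by (simp add: lorentz_apply[of "A ** B"] lorentz_apply[of A] hermitian_lorentz conj_transpose_mult matrix_mul_assoc
      flip: matrix_vector_mul_assoc)
  then show ?thesis using matrix_eq by blast
qed

lemma lorentz_one [simp]: "lorentz (mat 1) = mat 1"
proof -
  have "conj_transpose (mat 1) = mat 1" by (simp add: matrix2_simps conj_transpose_def)
  then have "lorentz (mat 1) *v p = mat 1 *v p" for p by (simp add: lorentz_apply)
  then show ?thesis using matrix_eq by blast
qed

lemma lorentz_minus: "lorentz (- A) = lorentz A"
proof -
  have "- A ** X ** conj_transpose (- A) = A ** X ** conj_transpose A" for X
    by (simp add: matrix2_simps conj_transpose_def algebra_simps)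
  then have "lorentz (- A) *v p = lorentz A *v p" for p by (simp add: lorentz_apply)
  then show ?thesis using matrix_eq by blast
qed

lemma lorentz_entry: "lorentz A $ i $ j = hermitian_coords (A ** hermitian (axis j 1) ** conj_transpose A) $ i"
  by (simp add: lorentz_def matrix_def)

lemma hermitian_axis:
  "hermitian (axis 1 1) = vector [vector [0, 1], vector [1, 0]]"
  "hermitian (axis 2 1) = vector [vector [0, - \<i>], vector [\<i>, 0]]"
  "hermitian (axis 3 1) = vector [vector [1, 0], vector [0, - 1]]"
  "hermitian (axis 4 1) = vector [vector [1, 0], vector [0, 1]]"
  by (simp_all add: hermitian_def vec_eq_iff forall_2 axis_def complex_eq_iff)

text \<open>The trace on the right is the polarization of the determinant on Hermitian matrices.\<close>

lemma minkowski_form: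
  "p \<bullet> (minkowski *v q) = - Re (trace (hermitian p ** adj2 (hermitian q))) / 2"
proof -
  have J: "(minkowski *v q) $ i = (if i = 4 then - q $ i else q $ i)" for i
    by (simp add: matrix_vector_mult_def minkowski_def if_distribR if_distrib[of "\<lambda>x. x * _"] cong: if_cong)
  have t: "trace (hermitian p ** adj2 (hermitian q)) =
     hermitian p $ 1 $ 1 * hermitian q $ 2 $ 2 - hermitian p $ 1 $ 2 * hermitian q $ 2 $ 1
     - hermitian p $ 2 $ 1 * hermitian q $ 1 $ 2 + hermitian p $ 2 $ 2 * hermitian q $ 1 $ 1"
    by (simp add: trace_def matrix2_simps)
  show ?thesis unfolding t
    by (simp add: inner_vec_def sum_4 J hermitian_def algebra_simps)
qed

lemma adj2_mult_rev: "adj2 (A ** B) = adj2 B ** adj2 A"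
  by (simp add: matrix2_simps algebra_simps)

text \<open>The determinant form pairs \<open>A H A\<^sup>*\<close> with \<open>K\<close> as it pairs \<open>H\<close> with the image of \<open>K\<close> under
  the adjugate of \<open>A\<close>.\<close>

lemma lorentz_adjoint: "(lorentz A *v p) \<bullet> (minkowski *v q) = p \<bullet> (minkowski *v (lorentz (adj2 A) *v q))"
proof -
  have c: "adj2 (conj_transpose (adj2 A)) = conj_transpose A"
    by (simp add: matrix2_simps conj_transpose_def)
  have "trace (A ** hermitian p ** conj_transpose A ** adj2 (hermitian q))
      = trace (hermitian p ** (conj_transpose A ** adj2 (hermitian q) ** A))"
    using trace_mul_sym[of A "hermitian p ** conj_transpose A ** adj2 (hermitian q)"] by (simp add: matrix_mul_assoc)
  then show ?thesis
    unfolding minkowski_form hermitian_lorentz by (simp add: adj2_mult_rev c matrix_mul_assoc)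
qed

lemma lorentz_adj2: "transpose (lorentz A) ** minkowski = minkowski ** lorentz (adj2 A)"
proof -
  have "p \<bullet> ((transpose (lorentz A) ** minkowski) *v q) = p \<bullet> ((minkowski ** lorentz (adj2 A)) *v q)" for p q
  proof -
    have "p \<bullet> ((transpose (lorentz A) ** minkowski) *v q) = (lorentz A *v p) \<bullet> (minkowski *v q)"
      by (simp add: transpose_matrix_vector dot_lmul_matrix inner_commute[of p] inner_commute[of _ "minkowski *v q"]
         flip: matrix_vector_mul_assoc)
    then show ?thesis by (simp add: lorentz_adjoint matrix_vector_mul_assoc)
  qed
  then have "(transpose (lorentz A) ** minkowski) *v q = (minkowski ** lorentz (adj2 A)) *v q" for q
    using vector_eq_ldot by blast
  then show ?thesis using matrix_eq by blast
qed

lemma lorentz_inverse: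
  assumes "det A = 1"
  shows "lorentz A ** lorentz (adj2 A) = mat 1" "lorentz (adj2 A) ** lorentz A = mat 1"
    "matrix_inv (lorentz A) = lorentz (adj2 A)"
proof -
  show 1: "lorentz A ** lorentz (adj2 A) = mat 1" "lorentz (adj2 A) ** lorentz A = mat 1"
    using assms by (simp_all add: lorentz_mult[symmetric] adj2_mult)
  show "matrix_inv (lorentz A) = lorentz (adj2 A)" by (rule matrix_inv_eqI[OF 1(1)])
qed

text \<open>In general the trace of \<open>H \<mapsto> A H A\<^sup>*\<close> is the squared modulus of the trace of \<open>A\<close>.\<close>

lemma trace_lorentz:
  assumes "A $ 2 $ 2 = - A $ 1 $ 1"
  shows "trace (lorentz A) = 0"
  unfolding trace_def sum_4 lorentz_entry hermitian_axis hermitian_coords_def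
  using assms by (simp add: matrix_matrix_mult_def sum_2 conj_transpose_def) (simp add: field_simps)

section \<open>The complement of the Lorentz algebra\<close>

lemma sum_matrix_basis:
  fixes f :: "real^'n^'m \<Rightarrow> real"
  shows "(\<Sum>E\<in>Basis. f E) = (\<Sum>i\<in>UNIV. \<Sum>j\<in>UNIV. f (axis i (axis j 1)))"
proof -
  have "Basis = (\<lambda>(i, j). axis i (axis j 1) :: real^'n^'m) ` (UNIV \<times> UNIV)"
    by (auto simp: Basis_vec_def)
  then have B: "Basis = (\<lambda>p. axis (fst p) (axis (snd p) 1) :: real^'n^'m) ` (UNIV \<times> UNIV)"
    by (simp add: case_prod_unfold)
  have inj: "inj_on (\<lambda>p. axis (fst p) (axis (snd p) 1) :: real^'n^'m) (UNIV \<times> UNIV)"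
    by (auto simp: inj_on_def axis_eq_axis)
  show ?thesis unfolding B sum.reindex[OF inj] o_def sum.cartesian_product by (simp add: case_prod_unfold)
qed

text \<open>The operator \<open>E \<mapsto> X Y E - X E Y - Y E X + E Y X\<close> is traced over the matrix units.\<close>

lemma killing_form_eq: "killing_form X Y = 8 * trace (X ** Y) - 2 * trace X * trace Y"
proof -
  have ax: "axis i (axis j 1) $ k $ l = (if k = i then if l = j then 1 else 0 else (0::real))" for i j k l :: 4
    by (simp add: axis_def)
  have delta: "c * (if P then 1 else 0) = (if P then c else 0)" "(if P then 1 else 0) * c = (if P then c else 0)"
    "c * (if P then d else 0) = (if P then c * d else 0)" "(if P then d else 0) * c = (if P then d * c else 0)"
    for c d :: real and P by simp_all
  have 1: "(M ** axis i (axis j 1)) $ i $ j = M $ i $ i" for M :: "real^4^4" and i j :: 4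
    by (simp add: matrix_matrix_mult_def ax delta)
  have 2: "(axis i (axis j 1) ** M) $ i $ j = M $ j $ j" for M :: "real^4^4" and i j :: 4
    by (simp add: matrix_matrix_mult_def ax delta)
  have 3: "(M ** axis i (axis j 1) ** N) $ i $ j = M $ i $ i * N $ j $ j" for M N :: "real^4^4" and i j :: 4
    by (simp add: matrix_matrix_mult_def ax delta)
  have "lie_bracket X (lie_bracket Y E) = X ** Y ** E - X ** E ** Y - Y ** E ** X + E ** (Y ** X)" for E
    by (simp add: lie_bracket_def matrix_sub_distrib matrix_mul_assoc)
  then have "lie_bracket X (lie_bracket Y (axis i (axis j 1))) \<bullet> axis i (axis j 1)
      = (X ** Y) $ i $ i - X $ i $ i * Y $ j $ j - Y $ i $ i * X $ j $ j + (Y ** X) $ j $ j" for i j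
    by (simp add: inner_axis 1 2 3)
  then have "killing_form X Y = (\<Sum>i\<in>UNIV. \<Sum>j\<in>UNIV. (X ** Y) $ i $ i - X $ i $ i * Y $ j $ j - Y $ i $ i * X $ j $ j + (Y ** X) $ j $ j)"
    unfolding killing_form_def sum_matrix_basis by simp
  also have "\<dots> = 4 * trace (X ** Y) - trace X * trace Y - trace Y * trace X + 4 * trace (Y ** X)"
  proof -
    have "(\<Sum>i\<in>UNIV. \<Sum>j\<in>UNIV. X $ i $ i * Y $ j $ j) = trace X * trace Y"
      "(\<Sum>i\<in>UNIV. \<Sum>j\<in>UNIV. Y $ i $ i * X $ j $ j) = trace Y * trace X"
      by (simp_all add: trace_def sum_product)
    then show ?thesis by (simp add: sum.distrib sum_subtractf) (simp add: trace_def sum_distrib_left)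
  qed
  finally show ?thesis by (simp add: trace_mul_sym[of Y X])
qed

lemma minkowski_mult_entries:
  "(minkowski ** X) $ i $ j = (if i = 4 then - X $ i $ j else X $ i $ j)"
  "(X ** minkowski) $ i $ j = (if j = 4 then - X $ i $ j else X $ i $ j)"
proof -
  have m: "minkowski $ i $ k * c = (if k = i then (if i = 4 then - c else c) else 0)"
    "c * minkowski $ k $ j = (if k = j then (if j = 4 then - c else c) else 0)" for k c
    by (simp_all add: minkowski_def)
  show "(minkowski ** X) $ i $ j = (if i = 4 then - X $ i $ j else X $ i $ j)"
    "(X ** minkowski) $ i $ j = (if j = 4 then - X $ i $ j else X $ i $ j)"
    by (simp_all add: matrix_matrix_mult_def m)
qed

lemma minkowski_square [simp]: "minkowski ** minkowski = mat 1"
  unfolding vec_eq_iff minkowski_mult_entries by (auto simp: minkowski_def mat_def)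

lemma minkowski_transpose [simp]: "transpose minkowski = minkowski"
  by (auto simp: transpose_def minkowski_def vec_eq_iff)

lemma trace_transpose_mult: "trace (transpose X ** Y) = X \<bullet> Y" for X Y :: "real^'n^'n"
  unfolding trace_def inner_vec_def matrix_matrix_mult_def transpose_def
  by (simp, subst sum.swap, simp)

lemma matrix_mult_minus:
  "(- A) ** B = - (A ** B)" "A ** (- B) = - (A ** B)" for A B :: "'a::ring_1^'n^'n"
  by (simp_all add: vec_eq_iff matrix_matrix_mult_def sum_negf)

lemma trace_minus: "trace (- A) = - trace A" for A :: "'a::ring_1^'n^'n"
  by (simp add: trace_def sum_negf)

lemma trace_transpose: "trace (transpose A) = trace A"
  by (simp add: trace_def transpose_def)

lemma minkowski_cancel [simp]: "minkowski ** (minkowski ** X) = X" "X ** minkowski ** minkowski = X"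
  by (simp add: matrix_mul_assoc) (simp flip: matrix_mul_assoc)

text \<open>Multiplication by the Minkowski form \<open>J\<close> turns \<open>so(3,1)\<close> into the antisymmetric matrices.  Accordingly
  its complement consists of the trace-free \<open>X\<close> for which \<open>X J\<close> is symmetric.\<close>

lemma v_space_iff: "X \<in> v_space \<longleftrightarrow> trace X = 0 \<and> transpose X ** minkowski = minkowski ** X"
proof
  assume X: "X \<in> v_space"
  then have tr: "trace X = 0" by (simp add: v_space_def sl4_def)
  define S where "S = X ** minkowski"
  define W where "W = S - transpose S"
  have W: "transpose W = - W" unfolding W_def by (simp add: transpose_def vec_eq_iff)
  \<comment> \<open>\<open>minkowski ** W\<close> lies in \<open>so31\<close>, and pairing it with \<open>X\<close> gives a multiple of the
  squared norm of \<open>W\<close>\<close>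
  have "transpose (minkowski ** W) = - (W ** minkowski)" by (simp add: matrix_transpose_mul W matrix_mult_minus)
  then have "minkowski ** W \<in> so31" unfolding so31_def by (simp add: matrix_mult_minus)
  then have "trace (X ** (minkowski ** W)) = 0" using X tr by (simp add: v_space_def killing_form_eq)
  then have SW: "trace (S ** W) = 0" by (simp add: S_def matrix_mul_assoc)
  have "trace (transpose S ** W) = trace (transpose (transpose S ** W))" by (simp add: trace_transpose)
  also have "\<dots> = - trace (S ** W)"
    by (simp add: matrix_transpose_mul W matrix_mult_minus trace_minus trace_mul_sym[of S])
  finally have "trace ((S - transpose S) ** W) = 0" using SW
    by (simp add: matrix_sub_distrib trace_sub)
  then have "trace (transpose W ** W) = 0" by (simp add: W matrix_mult_minus trace_minus flip: W_def)
  then have "W = 0" by (simp add: trace_transpose_mult)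
  then have "X ** minkowski = minkowski ** transpose X"
    by (simp add: W_def S_def matrix_transpose_mul)
  then have "minkowski ** (X ** minkowski) ** minkowski = minkowski ** (minkowski ** transpose X) ** minkowski" by simp
  then have "minkowski ** X = transpose X ** minkowski" by (simp add: matrix_mul_assoc)
  then show "trace X = 0 \<and> transpose X ** minkowski = minkowski ** X" using tr by simp
next
  assume *: "trace X = 0 \<and> transpose X ** minkowski = minkowski ** X"
  have "trace (X ** Y) = 0" if "Y \<in> so31" for Y
  proof -
    have Y: "transpose Y ** minkowski = - (minkowski ** Y)" using that by (simp add: so31_def eq_neg_iff_add_eq_0)
    have "trace (X ** Y) = trace (transpose Y ** transpose X)"
      using trace_transpose[of "X ** Y"] by (simp add: matrix_transpose_mul)
    also have "\<dots> = trace ((transpose Y ** minkowski) ** (minkowski ** transpose X ** minkowski ** minkowski))"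
      by (simp add: matrix_mul_assoc)
    also have "\<dots> = - trace (minkowski ** Y ** (minkowski ** (transpose X ** minkowski) ** minkowski))"
      by (simp add: Y matrix_mult_minus trace_minus matrix_mul_assoc)
    also have "\<dots> = - trace (minkowski ** (Y ** X ** minkowski))" using * by (simp add: matrix_mul_assoc)
    also have "\<dots> = - trace (Y ** X)" by (subst trace_mul_sym) simp
    finally show ?thesis by (simp add: trace_mul_sym[of Y])
  qed
  then show "X \<in> v_space" using * by (simp add: v_space_def sl4_def killing_form_eq)
qed

lemma matrix_mult_scaleR:
  "(c *\<^sub>R A) ** B = c *\<^sub>R (A ** B)" "A ** (c *\<^sub>R B) = c *\<^sub>R (A ** B)" for A B :: "'a::real_algebra_1^'n^'n"
  by (simp_all add: vec_eq_iff matrix_matrix_mult_def scaleR_sum_right)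

lemma v_space_subspace: "Real_Vector_Spaces.subspace v_space"
proof -
  have t: "transpose (X + Y) = transpose X + transpose Y" "transpose (c *\<^sub>R X) = c *\<^sub>R transpose X"
    "trace (c *\<^sub>R X) = c * trace X" "transpose (0 :: real^4^4) = 0"
    for X Y :: "real^4^4" and c
    by (simp_all add: transpose_def vec_eq_iff trace_def sum_distrib_left)
  show ?thesis
    unfolding real_vector.subspace_def Ball_def v_space_iff
    by (simp add: t matrix_add_ldistrib matrix_add_rdistrib' matrix_mult_scaleR trace_add)
       (simp add: trace_def)
qed

text \<open>In determinant \<open>1\<close> this is conjugation by the Lorentz transformation of \<open>A\<close>.  Written with the adjugate
  it is visibly continuous in \<open>A\<close>.\<close>

definition Ad :: "complex^2^2 \<Rightarrow> real^4^4 \<Rightarrow> real^4^4" where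
  "Ad A X = lorentz A ** X ** lorentz (adj2 A)"

lemma Ad_mult: "Ad (A ** B) X = Ad A (Ad B X)"
  by (simp add: Ad_def adj2_mult_rev lorentz_mult matrix_mul_assoc)

lemma Ad_one: "Ad (mat 1) X = X"
proof -
  have "adj2 (mat 1) = mat 1" by (simp add: matrix2_simps)
  then show ?thesis by (simp add: Ad_def)
qed

lemma Ad_linear: "linear (Ad A)"
  by (rule linearI) (simp_all add: Ad_def matrix_add_ldistrib matrix_add_rdistrib' matrix_mult_scaleR)

lemma Ad_v_space:
  assumes A: "det A = 1" and X: "X \<in> v_space"
  shows "Ad A X \<in> v_space"
proof -
  have X: "trace X = 0" "transpose X ** minkowski = minkowski ** X" using X by (auto simp: v_space_iff)
  have "trace (Ad A X) = trace (lorentz (adj2 A) ** lorentz A ** X)"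
    unfolding Ad_def by (subst trace_mul_sym) (simp add: matrix_mul_assoc)
  then have "trace (Ad A X) = 0" using X by (simp add: lorentz_inverse[OF A])
  moreover have "transpose (Ad A X) ** minkowski = minkowski ** Ad A X"
  proof -
    have "transpose (Ad A X) ** minkowski =
       transpose (lorentz (adj2 A)) ** (transpose X ** (transpose (lorentz A) ** minkowski))"
      by (simp add: Ad_def matrix_transpose_mul matrix_mul_assoc)
    also have "\<dots> = transpose (lorentz (adj2 A)) ** (transpose X ** minkowski) ** lorentz (adj2 A)"
      by (simp add: lorentz_adj2 matrix_mul_assoc)
    also have "\<dots> = (transpose (lorentz (adj2 A)) ** minkowski) ** X ** lorentz (adj2 A)"
      by (simp add: X matrix_mul_assoc)
    also have "\<dots> = minkowski ** Ad A X" by (simp add: lorentz_adj2 Ad_def matrix_mul_assoc)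
    finally show ?thesis .
  qed
  ultimately show ?thesis by (simp add: v_space_iff)
qed

section \<open>The representations of the knot group\<close>

text \<open>For \<open>z = z\<^sub>2\<close> and \<open>k = exp u\<close> this is the relation left when \<open>z\<^sub>1\<close> is eliminated from the gluing equation.\<close>

definition shape_relation :: "complex \<Rightarrow> complex \<Rightarrow> bool" where
  "shape_relation u z \<longleftrightarrow> (z - (exp u)\<^sup>2) * (1 - z) = exp u * z"

lemma det_mat_x: "det (mat_x u) = 1" and det_mat_y: "det (mat_y u z) = 1"
  by (simp_all add: mat_x_def mat_y_def det_2 flip: exp_add)

lemma det_mat_letter: "det (mat_letter u z c) = 1"
  by (cases "(u, z, c)" rule: mat_letter.cases) (simp_all add: matrix_inv_det_1 det_mat_x det_mat_y)

lemma mat_word_Nil: "mat_word u z [] = mat 1"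
  and mat_word_Cons: "mat_word u z (c # w) = mat_letter u z c ** mat_word u z w"
  by (simp_all add: mat_word_def)

lemma mat_word_append: "mat_word u z (v @ w) = mat_word u z v ** mat_word u z w"
  by (induction v) (simp_all add: mat_word_Nil mat_word_Cons matrix_mul_assoc)

lemma det_mat_word: "det (mat_word u z w) = 1"
  by (induction w) (simp_all add: mat_word_Nil mat_word_Cons det_mul det_mat_letter)

lemma mat_letter_cancel: "mat_letter u z (g, e) ** mat_letter u z (g, \<not> e) = mat 1"
  by (cases g; cases e) (simp_all add: matrix_inv_det_1 det_mat_x det_mat_y adj2_mult)

lemma mat_word_inv: "mat_word u z (word_inv w) = adj2 (mat_word u z w)"
proof -
  have "mat_word u z w ** mat_word u z (word_inv w) = mat 1"
  proof (induction w)
    case (Cons c w)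
    obtain g e where c: "c = (g, e)" by force
    have "mat_word u z (c # w) ** mat_word u z (word_inv (c # w)) =
       mat_letter u z c ** (mat_word u z w ** mat_word u z (word_inv w)) ** mat_letter u z (g, \<not> e)"
      by (simp add: c word_inv_simps mat_word_append mat_word_Cons mat_word_Nil matrix_mul_assoc)
    then show ?case using Cons by (simp add: c mat_letter_cancel)
  qed (simp add: word_inv_simps mat_word_Nil)
  then have "adj2 (mat_word u z w) ** (mat_word u z w ** mat_word u z (word_inv w)) = adj2 (mat_word u z w)" by simp
  then show ?thesis by (simp add: matrix_mul_assoc adj2_mult det_mat_word)
qed

context
  fixes u z :: complex
  assumes rel: "shape_relation u z"
begin

lemma half_exp: "exp (u / 2) * exp (- (u / 2)) = 1" "exp (u / 2) * exp (u / 2) = exp u"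
  "exp (- (u / 2)) * exp (- (u / 2)) = exp (- u)" "exp u * exp (- u) = 1"
  by (simp_all flip: exp_add)

lemma shape_polynomial: "(z - exp u * exp u) * (1 - z) = exp u * z"
  using rel by (simp add: shape_relation_def power2_eq_square)

lemma mat_b: "mat_word u z word_b = vector [vector [(1 - z) * exp (- u), - 1], vector [z, exp u]]"
proof -
  have eq: "mat_word u z word_b = mat_x u ** adj2 (mat_y u z)"
    by (simp add: word_b_def word_x_def word_y_def word_inv_def mat_word_Cons mat_word_Nil matrix_inv_det_1 det_mat_y)
  show ?thesis unfolding eq
    by (simp add: vec_eq_iff forall_2 matrix_matrix_mult_def sum_2 adj2_def mat_x_def mat_y_def)
      (intro conjI; use half_exp in Groebner_Basis.algebra)
qed

lemma mat_a: "mat_word u z word_a =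
  vector [vector [0, (1 - z) * exp (- u) * exp (- u) - exp (- u)],
          vector [z * (exp u - z * exp (- u) - 1), 1 + z * exp (- u)]]"
proof -
  have eq: "mat_word u z word_a = mat_word u z word_b ** adj2 (mat_x u) ** mat_y u z"
    by (simp add: word_a_def word_b_def word_x_def word_y_def word_inv_def mat_word_append mat_word_Cons mat_word_Nil
      matrix_inv_det_1 det_mat_x matrix_mul_assoc)
  show ?thesis unfolding eq mat_b
    by (simp add: vec_eq_iff forall_2 matrix_matrix_mult_def sum_2 adj2_def mat_x_def mat_y_def)
      (intro conjI; use half_exp shape_polynomial in Groebner_Basis.algebra)
qed

text \<open>The relation of the knot group holds for the matrices themselves and not just up to sign, so the
  representation lifts to \<open>SL(2,\<complex>)\<close>.\<close>

lemma mat_relation: "mat_word u z (word_a @ word_x) = mat_word u z (word_y @ word_a)"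
proof -
  have s: "exp (u / 2) = exp (- (u / 2)) * exp u" using half_exp by Groebner_Basis.algebra
  have "z * exp (- u) * (exp u + exp (- u) + 1) = (1 + z * exp (- u)) * (1 + z * exp (- u))"
    using half_exp(4) shape_polynomial by Groebner_Basis.algebra
  then have r: "(1 + z * exp (- u)) * exp u - z * (exp u - z * exp (- u) - 1)
      = (1 + z * exp (- u)) - z * ((1 - z) * exp (- u) * exp (- u) - exp (- u))"
    using half_exp(4) by Groebner_Basis.algebra
  have e: "(1 + z * exp (- u)) * exp (u / 2) - z * (exp u - z * exp (- u) - 1) * exp (- (u / 2)) =
      exp (- (u / 2)) * (1 + z * exp (- u)) - z * exp (- (u / 2)) * ((1 - z) * exp (- u) * exp (- u) - exp (- u))"
  proof -
    have "(1 + z * exp (- u)) * exp (u / 2) - z * (exp u - z * exp (- u) - 1) * exp (- (u / 2)) =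
       exp (- (u / 2)) * ((1 + z * exp (- u)) * exp u - z * (exp u - z * exp (- u) - 1))"
      unfolding s by (simp only: algebra_simps)
    also have "\<dots> = exp (- (u / 2)) * ((1 + z * exp (- u)) - z * ((1 - z) * exp (- u) * exp (- u) - exp (- u)))"
      by (simp only: r)
    finally show ?thesis by (simp only: algebra_simps)
  qed
  show ?thesis
    unfolding mat_word_append mat_a
    by (simp add: vec_eq_iff forall_2 matrix_matrix_mult_def sum_2 mat_x_def mat_y_def
        word_x_def word_y_def mat_word_Cons mat_word_Nil mat_def)
      (rule e)
qed

lemma mat_word_eq:
  assumes "word_eq fig8_relators v w" shows "mat_word u z v = mat_word u z w"
  unfolding mat_word_def
proof (rule word_eq_foldr[OF assms])
  fix g e and s :: "complex^2^2"
  show "mat_letter u z (g, e) ** (mat_letter u z (g, \<not> e) ** s) = s"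
    by (simp add: matrix_mul_assoc mat_letter_cancel)
next
  fix r and s :: "complex^2^2" assume "r \<in> fig8_relators"
  then have r: "r = (word_a @ word_x) @ word_inv (word_y @ word_a)" by (simp add: fig8_relators_def)
  have "foldr (\<lambda>c. (**) (mat_letter u z c)) v s = mat_word u z v ** s" for v
    by (induction v) (simp_all add: mat_word_Nil mat_word_Cons matrix_mul_assoc)
  moreover have "mat_word u z r = mat 1"
    unfolding r mat_word_append[of _ _ "word_a @ word_x"] mat_relation mat_word_inv
    by (simp add: adj2_mult det_mat_word)
  ultimately show "foldr (\<lambda>c. (**) (mat_letter u z c)) r s = s" by simp
qed

lemma PSL2C_class: "PSL2C_class A = {A, - A}"
proof -
  have "- mat 1 ** A = - A" by (simp add: matrix_mult_minus)
  then show ?thesis by (auto simp: PSL2C_class_def r_coset_def SL2C_def)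
qed

lemma rho_class: "rho u z (\<pi>M_class w) = {mat_word u z w, - mat_word u z w}"
proof -
  have "mat_word u z v = mat_word u z w" if "v \<in> \<pi>M_class w" for v
    using that mat_word_eq[of w v] by (simp add: mem_\<pi>M_class)
  then have "(\<lambda>v. PSL2C_class (mat_word u z v)) ` \<pi>M_class w = (\<lambda>v. PSL2C_class (mat_word u z w)) ` \<pi>M_class w"
    by (intro image_cong) auto
  also have "\<dots> = {PSL2C_class (mat_word u z w)}"
    by (rule image_constant[of w]) (simp add: mem_\<pi>M_class word_eq.refl)
  finally have "(\<lambda>v. PSL2C_class (mat_word u z v)) ` \<pi>M_class w = {PSL2C_class (mat_word u z w)}" .
  then show ?thesis by (simp add: rho_def PSL2C_class)
qed

lemma Ad_rho_class: "Ad_rho u z (\<pi>M_class w) X = Ad (mat_word u z w) X"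
proof -
  have "lorentz ` rho u z (\<pi>M_class w) = {lorentz (mat_word u z w)}"
    by (simp add: rho_class lorentz_minus)
  then show ?thesis
    by (simp add: Ad_rho_def Ad_def lorentz_inverse(3)[OF det_mat_word])
qed

lemma fig8_action_v_space: "fig8_action v_space (Ad_rho u z)"
  unfolding fig8_action_def
proof (rule linear_action.intro[OF \<pi>M_group linear_action_axioms.intro], goal_cases)
  case 1
  show ?case by (rule v_space_subspace)
next
  case (2 g)
  then obtain w where w: "g = \<pi>M_class w" by (auto simp: \<pi>M_carrier)
  have "Ad_rho u z g = Ad (mat_word u z w)" unfolding w by (rule ext) (rule Ad_rho_class)
  then show ?case by (simp add: Ad_linear)
next
  case (3 g v)
  then show ?case by (auto simp: \<pi>M_carrier Ad_rho_class Ad_v_space[OF det_mat_word])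
next
  case (4 g h v)
  then show ?case by (auto simp: \<pi>M_carrier Ad_rho_class \<pi>M_class_mult mat_word_append Ad_mult)
next
  case (5 v)
  show ?case unfolding \<pi>M_class_one by (simp add: Ad_rho_class mat_word_Nil Ad_one)
qed

end

section \<open>The commutant of the fiber group\<close>

definition cscale :: "complex \<Rightarrow> complex^2^2 \<Rightarrow> complex^2^2" where
  "cscale c A = (\<chi> i j. c * A $ i $ j)"

text \<open>The derivative at the identity of \<open>H \<mapsto> A H A\<^sup>*\<close>, in coordinates.\<close>

definition lie_action :: "complex^2^2 \<Rightarrow> real^4 \<Rightarrow> real^4" where
  "lie_action N p = hermitian_coords (N ** hermitian p + hermitian p ** conj_transpose N)"

lemma conj_transpose_add: "conj_transpose (A + B) = conj_transpose A + conj_transpose B"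
  by (simp add: conj_transpose_def vec_eq_iff)

lemma hermitian_lie_action: "hermitian (lie_action N p) = N ** hermitian p + hermitian p ** conj_transpose N"
  unfolding lie_action_def
  by (rule hermitian_hermitian_coords) (simp add: conj_transpose_add conj_transpose_mult add.commute)

lemma hermitian_eq_iff: "hermitian p = hermitian q \<longleftrightarrow> p = q"
  using hermitian_coords_hermitian by metis

lemma hermitian_diff: "hermitian (p - q) = hermitian p - hermitian q"
  using hermitian_linear(1)[of p "- q"] hermitian_linear(2)[of "- 1" q] by simp

definition commutes_lie :: "real^4^4 \<Rightarrow> complex^2^2 \<Rightarrow> bool" where
  "commutes_lie X N \<longleftrightarrow> (\<forall>p. X *v lie_action N p = lie_action N (X *v p))"

lemma lie_action_simps:
  "lie_action (N + N') p = lie_action N p + lie_action N' p"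
  "lie_action (r *\<^sub>R N) p = r *\<^sub>R lie_action N p"
  "lie_action N (p - q) = lie_action N p - lie_action N q"
  "lie_action (N ** N' - N' ** N) p = lie_action N (lie_action N' p) - lie_action N' (lie_action N p)"
  "lie_action (cscale c (mat 1)) p = (2 * Re c) *\<^sub>R p"
  unfolding hermitian_eq_iff[symmetric] hermitian_linear hermitian_lie_action hermitian_diff
  by (simp_all add: vec_eq_iff forall_2 matrix_matrix_mult_def sum_2 conj_transpose_def mat_def
      cscale_def)
    (simp_all add: algebra_simps complex_eq_iff)

lemma commutes_lie_add: "commutes_lie X N \<Longrightarrow> commutes_lie X N' \<Longrightarrow> commutes_lie X (N + N')"
  by (simp add: commutes_lie_def lie_action_simps matrix_vector_right_distrib)

lemma commutes_lie_scaleR: "commutes_lie X N \<Longrightarrow> commutes_lie X (r *\<^sub>R N)"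
  by (simp add: commutes_lie_def lie_action_simps matrix_vector_mult_scaleR)

lemma commutes_lie_bracket: "commutes_lie X N \<Longrightarrow> commutes_lie X N' \<Longrightarrow> commutes_lie X (N ** N' - N' ** N)"
  by (simp add: commutes_lie_def lie_action_simps matrix_vector_mult_diff_distrib)

lemma commutes_lie_scalar: "commutes_lie X (cscale c (mat 1))"
  by (simp add: commutes_lie_def lie_action_simps matrix_vector_mult_scaleR)

text \<open>Let \<open>\<tau>\<close> be the trace of \<open>g\<close> and \<open>L\<close> its Lorentz transformation.  By the theorem of Cayley and Hamilton
  \<open>L - L\<inverse> + \<bar>\<tau>\<bar>\<^sup>2\<close> is the infinitesimal action of \<open>\<tau>\<^sup>* g\<close>, where \<open>\<tau>\<^sup>*\<close> is the complex conjugate, and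
  from \<open>L\<close> and this operator one obtains the action of \<open>\<tau> g\<close>.  If \<open>\<tau>\<^sup>2\<close> is not real, then \<open>\<tau>\<close> and \<open>\<tau>\<^sup>*\<close>
  span \<open>\<complex>\<close> over \<open>\<real>\<close>, so whatever commutes with \<open>L\<close> commutes with the action of all complex multiples of \<open>g\<close>.\<close>

lemma commutes_lie_lorentz:
  assumes det: "det g = 1" and tr: "Im ((trace g)\<^sup>2) \<noteq> 0"
    and X: "X ** lorentz g = lorentz g ** X"
  shows "commutes_lie X (cscale c g)"
proof -
  define \<tau> where "\<tau> = trace g"
  have Xg: "X *v (lorentz g *v p) = lorentz g *v (X *v p)" for p
    using X by (simp add: matrix_vector_mul_assoc)
  have "X ** lorentz (adj2 g) = lorentz (adj2 g) ** (lorentz g ** X) ** lorentz (adj2 g)"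
    by (simp add: matrix_mul_assoc lorentz_inverse[OF det])
  also have "\<dots> = lorentz (adj2 g) ** X"
    by (simp add: X[symmetric] lorentz_inverse[OF det] flip: matrix_mul_assoc)
  finally have Xa: "X *v (lorentz (adj2 g) *v p) = lorentz (adj2 g) *v (X *v p)" for p
    by (simp add: matrix_vector_mul_assoc)
  have d: "g $ 1 $ 1 * g $ 2 $ 2 = 1 + g $ 1 $ 2 * g $ 2 $ 1" using det by (simp add: det_2 algebra_simps)
  have d': "cnj (g $ 1 $ 1) * cnj (g $ 2 $ 2) = 1 + cnj (g $ 1 $ 2) * cnj (g $ 2 $ 1)"
    using arg_cong[OF d, of cnj] by simp
  have n: "(cmod \<tau>)\<^sup>2 *\<^sub>R M = cscale (\<tau> * cnj \<tau>) M" "(2 * (cmod \<tau>)\<^sup>2) *\<^sub>R M = cscale (2 * (\<tau> * cnj \<tau>)) M" for M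
    by (simp_all add: vec_eq_iff cscale_def scaleR_conv_of_real[where 'a=complex] complex_norm_square[symmetric])
  have 1: "lie_action (cscale (cnj \<tau>) g) p = lorentz g *v p - lorentz (adj2 g) *v p + (cmod \<tau>)\<^sup>2 *\<^sub>R p" for p
    unfolding hermitian_eq_iff[symmetric] hermitian_linear hermitian_lie_action hermitian_diff hermitian_lorentz n
    by (simp add: vec_eq_iff forall_2 matrix_matrix_mult_def sum_2 conj_transpose_def adj2_def
      cscale_def \<tau>_def trace_def)
     (intro conjI; Groebner_Basis.algebra)
  have 2: "lie_action (cscale \<tau> g) p = (2 * (cmod \<tau>)\<^sup>2) *\<^sub>R (lorentz g *v p) - lorentz g *v lie_action (cscale (cnj \<tau>) g) p" for p
    unfolding hermitian_eq_iff[symmetric] hermitian_linear hermitian_lie_action hermitian_diff hermitian_lorentz n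
    by (simp add: vec_eq_iff forall_2 matrix_matrix_mult_def sum_2 conj_transpose_def
      cscale_def \<tau>_def trace_def)
     (intro conjI; use d d' in Groebner_Basis.algebra)
  have c1: "commutes_lie X (cscale (cnj \<tau>) g)"
    by (simp add: commutes_lie_def 1 Xg Xa matrix_vector_mult_diff_distrib matrix_vector_right_distrib matrix_vector_mult_scaleR)
  then have c2: "commutes_lie X (cscale \<tau> g)"
    by (simp add: commutes_lie_def 2 Xg matrix_vector_mult_diff_distrib matrix_vector_mult_scaleR)
  have nz: "Re \<tau> \<noteq> 0" "Im \<tau> \<noteq> 0" using tr by (auto simp: \<tau>_def power2_eq_square)
  \<comment> \<open>the coordinates of \<open>c\<close> with respect to \<open>cnj \<tau>\<close> and \<open>\<tau>\<close>\<close>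
  define \<alpha> \<beta> where "\<alpha> = (Re c / Re \<tau> - Im c / Im \<tau>) / 2" and "\<beta> = (Re c / Re \<tau> + Im c / Im \<tau>) / 2"
  have "c = of_real \<alpha> * cnj \<tau> + of_real \<beta> * \<tau>"
    using nz by (simp add: complex_eq_iff \<alpha>_def \<beta>_def field_simps)
  then have "cscale c g = \<alpha> *\<^sub>R (cscale (cnj \<tau>) g) + \<beta> *\<^sub>R (cscale \<tau> g)"
    by (simp only:) (simp add: vec_eq_iff cscale_def scaleR_conv_of_real[where 'a=complex] algebra_simps)
  then show ?thesis using c1 c2 by (simp add: commutes_lie_add commutes_lie_scaleR)
qed

text \<open>If \<open>C = g h - h g\<close> is invertible then \<open>1\<close>, \<open>g\<close>, \<open>h\<close> and \<open>C\<close> form a basis of the \<open>2 \<times> 2\<close> matrices.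
  The coefficients of \<open>N\<close> are its pairings with the dual basis under the trace form; that of \<open>g\<close>, for
  example, is the pairing with a multiple of \<open>h C - C h\<close>, which is orthogonal to \<open>1\<close>, \<open>h\<close> and \<open>C\<close>.\<close>

lemma matrix_from_commutator:
  fixes g h N :: "complex^2^2"
  defines "C \<equiv> g ** h - h ** g"
  shows "cscale (- 2 * det C) N =
     cscale (- det C * trace N - trace (N ** (h ** C - C ** h)) * trace g / 2 - trace (N ** (C ** g - g ** C)) * trace h / 2) (mat 1)
     + cscale (trace (N ** (h ** C - C ** h))) g + cscale (trace (N ** (C ** g - g ** C))) h + cscale (trace (N ** C)) C"
  unfolding C_def
  by (simp add: vec_eq_iff forall_2 matrix_matrix_mult_def sum_2 trace_def det_2 cscale_def mat_def)
     (intro conjI; Groebner_Basis.algebra)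

text \<open>The complex multiples of \<open>g\<close>, \<open>h\<close> and of their commutator, together with the scalars, make up all of
  \<open>gl(2,\<complex>)\<close>.  So \<open>X\<close> commutes with the whole Lie algebra of the Lorentz group, which acts irreducibly.\<close>

lemma commutant_scalar:
  assumes g: "det g = 1" "Im ((trace g)\<^sup>2) \<noteq> 0" "X ** lorentz g = lorentz g ** X"
    and h: "det h = 1" "Im ((trace h)\<^sup>2) \<noteq> 0" "X ** lorentz h = lorentz h ** X"
    and C: "det (g ** h - h ** g) \<noteq> 0"
  shows "X = X $ 4 $ 4 *\<^sub>R mat 1"
proof -
  define C where "C = g ** h - h ** g"
  have gh: "commutes_lie X (cscale c g)" "commutes_lie X (cscale c h)" for c
    using commutes_lie_lorentz[OF g] commutes_lie_lorentz[OF h] by auto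
  have CC: "commutes_lie X (cscale c C)" for c
  proof -
    have "cscale c C = (cscale c g) ** (cscale 1 h) - (cscale 1 h) ** (cscale c g)"
      by (simp add: C_def vec_eq_iff matrix_matrix_mult_def cscale_def sum_distrib_left algebra_simps)
    then show ?thesis using commutes_lie_bracket gh by metis
  qed
  have all: "commutes_lie X N" for N
  proof -
    have "det C \<noteq> 0" using C by (simp add: C_def)
    then have "N = cscale (1 / (- 2 * det C)) (cscale (- 2 * det C) N)"
      by (simp add: vec_eq_iff cscale_def)
    also have "\<dots> = (cscale c1 (mat 1) + cscale c2 g) + (cscale c3 h + cscale c4 C)"
      if "c1 = (1 / (- 2 * det C)) * (- det C * trace N - trace (N ** (h ** C - C ** h)) * trace g / 2 - trace (N ** (C ** g - g ** C)) * trace h / 2)"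
      "c2 = (1 / (- 2 * det C)) * trace (N ** (h ** C - C ** h))"
      "c3 = (1 / (- 2 * det C)) * trace (N ** (C ** g - g ** C))" "c4 = (1 / (- 2 * det C)) * trace (N ** C)" for c1 c2 c3 c4
      unfolding matrix_from_commutator[of g h N, folded C_def] that
      by (simp add: vec_eq_iff cscale_def algebra_simps)
    finally have "\<exists>c1 c2 c3 c4. N = (cscale c1 (mat 1) + cscale c2 g) + (cscale c3 h + cscale c4 C)" by blast
    then show ?thesis using gh CC commutes_lie_add commutes_lie_scalar by metis
  qed
  \<comment> \<open>The Pauli matrices act as the boosts, which generate the full matrix algebra.\<close>
  define boost where "boost j = lie_action (hermitian (axis j 1))" for j :: 4
  have b: "X *v boost j p = boost j (X *v p)" for j p using all by (simp add: boost_def commutes_lie_def)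
  have b1: "boost 1 p = vector [2 * p $ 4, 0, 0, 2 * p $ 1]" for p
    unfolding boost_def lie_action_def hermitian_axis
    by (simp add: hermitian_def hermitian_coords_def vec_eq_iff forall_4 matrix_matrix_mult_def sum_2 conj_transpose_def)
  have b2: "boost 2 p = vector [0, 2 * p $ 4, 0, 2 * p $ 2]" for p
    unfolding boost_def lie_action_def hermitian_axis
    by (simp add: hermitian_def hermitian_coords_def vec_eq_iff forall_4 matrix_matrix_mult_def sum_2 conj_transpose_def)
  have b3: "boost 3 p = vector [0, 0, 2 * p $ 4, 2 * p $ 3]" for p
    unfolding boost_def lie_action_def hermitian_axis
    by (simp add: hermitian_def hermitian_coords_def vec_eq_iff forall_4 matrix_matrix_mult_def sum_2 conj_transpose_def)
  have e: "(X *v vector [w, x, y, z]) $ i = X $ i $ 1 * w + X $ i $ 2 * x + X $ i $ 3 * y + X $ i $ 4 * z" for i w x y z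
    by (simp add: matrix_vector_mult_def sum_4)
  have ax: "axis j (1::real) $ i = (if i = j then 1 else 0)" for i j :: 4 by (simp add: axis_def)
  have Xa: "(X *v axis j 1) $ i = X $ i $ j" for i j by (simp add: matrix_vector_mult_basis column_def)
  have E: "(X *v boost k (axis j 1)) $ i = boost k (X *v axis j 1) $ i" for i j k by (simp add: b)
  have z0: "X $ 2 $ 4 = 0" using E[where i = 2 and j = 1 and k = 1] by (simp add: b1 b2 b3 e ax Xa)
  have z1: "X $ 2 $ 1 = 0" using E[where i = 2 and j = 4 and k = 1] by (simp add: b1 b2 b3 e ax Xa)
  have z2: "X $ 3 $ 4 = 0" using E[where i = 3 and j = 1 and k = 1] by (simp add: b1 b2 b3 e ax Xa)
  have z3: "X $ 3 $ 1 = 0" using E[where i = 3 and j = 4 and k = 1] by (simp add: b1 b2 b3 e ax Xa)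
  have z4: "X $ 4 $ 2 = 0" using E[where i = 1 and j = 2 and k = 1] by (simp add: b1 b2 b3 e ax Xa)
  have z5: "X $ 4 $ 3 = 0" using E[where i = 1 and j = 3 and k = 1] by (simp add: b1 b2 b3 e ax Xa)
  have z6: "X $ 1 $ 2 = 0" using E[where i = 4 and j = 2 and k = 1] by (simp add: b1 b2 b3 e ax Xa)
  have z7: "X $ 1 $ 3 = 0" using E[where i = 4 and j = 3 and k = 1] by (simp add: b1 b2 b3 e ax Xa)
  have z8: "X $ 1 $ 4 = 0" using E[where i = 1 and j = 2 and k = 2] by (simp add: b1 b2 b3 e ax Xa)
  have z9: "X $ 4 $ 1 = 0" using E[where i = 2 and j = 1 and k = 2] by (simp add: b1 b2 b3 e ax Xa)
  have z10: "X $ 3 $ 2 = 0" using E[where i = 3 and j = 4 and k = 2] by (simp add: b1 b2 b3 e ax Xa)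
  have z11: "X $ 2 $ 3 = 0" using E[where i = 4 and j = 3 and k = 2] by (simp add: b1 b2 b3 e ax Xa)
  have z12: "X $ 1 $ 1 = X $ 4 $ 4" using E[where i = 1 and j = 4 and k = 1] by (simp add: b1 b2 b3 e ax Xa)
  have z13: "X $ 2 $ 2 = X $ 4 $ 4" using E[where i = 2 and j = 4 and k = 2] by (simp add: b1 b2 b3 e ax Xa)
  have z14: "X $ 3 $ 3 = X $ 4 $ 4" using E[where i = 3 and j = 4 and k = 3] by (simp add: b1 b2 b3 e ax Xa)
  have "\<forall>i j. X $ i $ j = (if i = j then X $ 4 $ 4 else 0)"
    unfolding forall_4 by (simp add: z0 z1 z2 z3 z4 z5 z6 z7 z8 z9 z10 z11 z12 z13 z14)
  moreover define c where "c = X $ 4 $ 4"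
  ultimately have "X = c *\<^sub>R mat 1" unfolding c_def[symmetric] by (simp add: vec_eq_iff mat_def)
  then show ?thesis by (simp only: c_def)
qed

lemma Ad_fixed_iff:
  assumes "det A = 1"
  shows "Ad A X = X \<longleftrightarrow> X ** lorentz A = lorentz A ** X"
proof
  assume "Ad A X = X"
  then have "X ** lorentz A = lorentz A ** X ** lorentz (adj2 A) ** lorentz A" by (simp add: Ad_def)
  also have "\<dots> = lorentz A ** X" by (simp add: lorentz_inverse[OF assms] flip: matrix_mul_assoc)
  finally show "X ** lorentz A = lorentz A ** X" .
next
  assume "X ** lorentz A = lorentz A ** X"
  then have "Ad A X = X ** (lorentz A ** lorentz (adj2 A))" by (simp add: Ad_def matrix_mul_assoc)
  then show "Ad A X = X" by (simp add: lorentz_inverse[OF assms])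
qed

lemma commute_lorentz_mult:
  "X ** lorentz A = lorentz A ** X \<Longrightarrow> X ** lorentz B = lorentz B ** X \<Longrightarrow>
   X ** lorentz (A ** B) = lorentz (A ** B) ** X"
  unfolding lorentz_mult by (metis matrix_mul_assoc)

lemma commute_lorentz_adj2:
  assumes "det A = 1" "X ** lorentz A = lorentz A ** X"
  shows "X ** lorentz (adj2 A) = lorentz (adj2 A) ** X"
proof -
  have "X ** lorentz (adj2 A) = lorentz (adj2 A) ** (lorentz A ** X) ** lorentz (adj2 A)"
    by (simp add: matrix_mul_assoc lorentz_inverse[OF assms(1)])
  also have "\<dots> = lorentz (adj2 A) ** X"
    by (simp add: assms(2)[symmetric] lorentz_inverse[OF assms(1)] flip: matrix_mul_assoc)
  finally show ?thesis .
qed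

context
  fixes u z :: complex
  assumes rel: "shape_relation u z" and nonreal: "Im (z * exp (- u)) \<noteq> 0"
begin

lemma fiber_traces:
  "trace (mat_word u z word_a) = 1 + z * exp (- u)"
  "(z * exp (- u)) * trace (mat_word u z word_b) = 1 + z * exp (- u)"
  "trace (mat_word u z word_b ** mat_word u z word_a) = 1 + z * exp (- u)"
  "(z * exp (- u)) * trace (mat_word u z word_a ** adj2 (mat_word u z word_b)) = 1 + z * exp (- u)"
  unfolding mat_a[OF rel] mat_b[OF rel]
  by (simp_all add: trace_def sum_2 matrix_matrix_mult_def adj2_def)
    (use half_exp(4)[OF rel] shape_polynomial[OF rel] in Groebner_Basis.algebra)+

lemma fiber_commutator:
  "(z * exp (- u))\<^sup>2 * det (mat_word u z word_a ** mat_word u z word_b - mat_word u z word_b ** mat_word u z word_a)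
   = - (z * exp (- u) - 1)\<^sup>2 * ((z * exp (- u))\<^sup>2 + 3 * (z * exp (- u)) + 1)"
  unfolding mat_a[OF rel] mat_b[OF rel]
  by (simp add: det_2 sum_2 matrix_matrix_mult_def)
    (use half_exp(4)[OF rel] shape_polynomial[OF rel] in Groebner_Basis.algebra)

text \<open>Let \<open>t = z / k\<close>, so that \<open>a\<close> and \<open>b a\<close> have trace \<open>1 + t\<close>, and \<open>b\<close> and \<open>a b\<inverse>\<close> have trace \<open>1 + 1 / t\<close>.
  Two generators of the fiber group are needed whose traces have nonreal squares.  As \<open>t\<close> is not real, \<open>(1 + t)\<^sup>2\<close>
  is real only if \<open>Re t = - 1\<close>; otherwise \<open>a\<close> and \<open>b a\<close> will do.  In the exceptional case \<open>(1 + 1 / t)\<^sup>2\<close> is not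
  real, and \<open>b\<close> and \<open>a b\<inverse>\<close> will do.  The commutator is invertible because the roots of
  \<open>(t - 1)\<^sup>2 (t\<^sup>2 + 3 t + 1)\<close> are real.\<close>

lemma fiber_commutant:
  assumes a: "X ** lorentz (mat_word u z word_a) = lorentz (mat_word u z word_a) ** X"
    and b: "X ** lorentz (mat_word u z word_b) = lorentz (mat_word u z word_b) ** X"
  shows "X = X $ 4 $ 4 *\<^sub>R mat 1"
proof -
  define t where "t = z * exp (- u)"
  define A B where "A = mat_word u z word_a" and "B = mat_word u z word_b"
  have d: "det A = 1" "det B = 1" by (simp_all add: A_def B_def det_mat_word)
  have t: "Im t \<noteq> 0" using nonreal by (simp add: t_def)
  then have "t \<noteq> 0" by auto
  have tr: "trace A = 1 + t" "t * trace B = 1 + t" "trace (B ** A) = 1 + t" "t * trace (A ** adj2 B) = 1 + t"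
    using fiber_traces by (simp_all add: A_def B_def t_def)
  have "(t - 1)\<^sup>2 * (t\<^sup>2 + 3 * t + 1) \<noteq> 0"
  proof -
    have "Im (t\<^sup>2 + 3 * t + 1) \<noteq> 0 \<or> Re (t\<^sup>2 + 3 * t + 1) \<noteq> 0"
    proof (rule ccontr)
      assume "\<not> ?thesis"
      then have 1: "2 * Re t * Im t + 3 * Im t = 0" and 2: "(Re t)\<^sup>2 - (Im t)\<^sup>2 + 3 * Re t + 1 = 0"
        by (simp_all add: power2_eq_square mult.commute mult.left_commute)
      from 1 have "Im t * (2 * Re t + 3) = 0" by (simp add: algebra_simps)
      then have "Re t = - 3 / 2" using t by simp
      with 2 have "(Im t)\<^sup>2 = - 5 / 4" by (simp add: power2_eq_square)
      then show False using zero_le_power2[of "Im t"] by linarith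
    qed
    moreover have "t \<noteq> 1" using t by auto
    moreover have "t\<^sup>2 + 3 * t + 1 \<noteq> 0" using calculation(1) by (metis zero_complex.sel)
    ultimately show ?thesis by simp
  qed
  then have C: "det (A ** B - B ** A) \<noteq> 0"
    using fiber_commutator[folded t_def, folded A_def B_def] by auto
  note ca = a[folded A_def] and cb = b[folded B_def]
  show ?thesis
  proof (cases "Re t = - 1")
    case False
    then have i: "Im ((1 + t)\<^sup>2) \<noteq> 0" using t by (simp add: power2_eq_square)
    have "A ** (B ** A) - (B ** A) ** A = (A ** B - B ** A) ** A" by (simp add: matrix_sub_distrib matrix_mul_assoc)
    then have "det (A ** (B ** A) - (B ** A) ** A) \<noteq> 0" using C d by (simp add: det_mul)
    then show ?thesis using commutant_scalar[OF d(1) _ ca _ _ commute_lorentz_mult[OF cb ca]] tr i d by (simp add: det_mul)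
  next
    case True
    define s where "s = trace B"
    have s: "t * s = 1 + t" using tr by (simp add: s_def)
    have "Re t * Re s - Im t * Im s = 1 + Re t" "Re t * Im s + Im t * Re s = Im t"
      using arg_cong[OF s, of Re] arg_cong[OF s, of Im] by simp_all
    then have *: "Re s + Im t * Im s = 0" "Im t * Re s = Im t + Im s" using True by simp_all
    have "Im s \<noteq> 0" "Re s \<noteq> 0"
    proof -
      show "Im s \<noteq> 0" using * t by auto
      then show "Re s \<noteq> 0" using * t by auto
    qed
    then have i: "Im (s\<^sup>2) \<noteq> 0" by (simp add: power2_eq_square)
    have "trace (A ** adj2 B) = s" using tr(2,4) \<open>t \<noteq> 0\<close> s_def by (metis mult_left_cancel)
    have "B ** (A ** adj2 B) - (A ** adj2 B) ** B = (B ** A - A ** B) ** adj2 B"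
    proof -
      have "(A ** adj2 B) ** B = A ** B ** adj2 B"
        by (simp add: adj2_mult d flip: matrix_mul_assoc)
      then show ?thesis by (simp add: matrix_sub_distrib matrix_mul_assoc)
    qed
    then have "det (B ** (A ** adj2 B) - (A ** adj2 B) ** B) = det (B ** A - A ** B)"
      by (simp add: det_mul d)
    also have "\<dots> = det (A ** B - B ** A)" by (simp add: det_2 algebra_simps)
    finally have "det (B ** (A ** adj2 B) - (A ** adj2 B) ** B) \<noteq> 0" using C by simp
    then show ?thesis
      using commutant_scalar[OF d(2) _ cb _ _ commute_lorentz_mult[OF ca commute_lorentz_adj2[OF d(2) cb]]] i d
        \<open>trace (A ** adj2 B) = s\<close> by (simp add: det_mul s_def)
  qed
qed

lemma fiber_invariants_zero:
  assumes X: "X \<in> v_space" and "Ad (mat_word u z word_a) X = X" "Ad (mat_word u z word_b) X = X"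
  shows "X = 0"
proof -
  have "X = X $ 4 $ 4 *\<^sub>R mat 1" using assms fiber_commutant by (simp add: Ad_fixed_iff det_mat_word)
  then obtain c where c: "X = c *\<^sub>R mat 1" by blast
  have "trace X = 4 * c" unfolding c by (simp add: trace_def mat_def)
  then show ?thesis using X c by (simp add: v_space_iff)
qed

end

section \<open>Duality\<close>

lemma v_space_transpose: "X \<in> v_space \<Longrightarrow> transpose X \<in> v_space"
proof -
  assume "X \<in> v_space"
  then have X: "trace X = 0" "transpose X ** minkowski = minkowski ** X" by (auto simp: v_space_iff)
  have "X ** minkowski = minkowski ** (minkowski ** X) ** minkowski" by simp
  also have "\<dots> = minkowski ** transpose X" by (simp add: X(2)[symmetric] matrix_mul_assoc)
  finally show ?thesis using X by (simp add: v_space_iff trace_transpose)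
qed

text \<open>The module is stable under transposition, and pairing \<open>R\<close> with its transpose gives the Euclidean norm.\<close>

lemma trace_pairing_nondegenerate:
  assumes "R \<in> v_space" "\<And>X. X \<in> v_space \<Longrightarrow> trace (R ** X) = 0"
  shows "R = 0"
proof -
  have "trace (R ** transpose R) = 0" using assms v_space_transpose by blast
  then show ?thesis using trace_transpose_mult[of R R] trace_mul_sym[of R "transpose R"] by simp
qed

lemma trace_Ad: "trace (P ** Ad A X) = trace (Ad (adj2 A) P ** X)"
proof -
  have "trace (P ** Ad A X) = trace ((P ** lorentz A ** X) ** lorentz (adj2 A))"
    by (simp add: Ad_def matrix_mul_assoc)
  also have "\<dots> = trace (Ad (adj2 A) P ** X)" by (subst trace_mul_sym) (simp add: Ad_def matrix_mul_assoc)
  finally show ?thesis .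
qed

lemma Ad_inverse: "det A = 1 \<Longrightarrow> Ad A (Ad (adj2 A) X) = X" "det A = 1 \<Longrightarrow> Ad (adj2 A) (Ad A X) = X"
  by (simp_all add: adj2_mult Ad_one flip: Ad_mult)

text \<open>A matrix that annihilates \<open>(b - 1) V + (1 - a) V\<close> under the trace form is fixed by \<open>a\<close> and \<open>b\<close>, hence
  zero.\<close>

lemma fiber_coinvariants_zero:
  assumes rel: "shape_relation u z" and nonreal: "Im (z * exp (- u)) \<noteq> 0" and v: "v \<in> v_space"
  shows "\<exists>A\<in>v_space. \<exists>B\<in>v_space.
     v = (Ad (mat_word u z word_b) A - A) + (B - Ad (mat_word u z word_a) B)"
proof -
  define a b where "a = mat_word u z word_a" and "b = mat_word u z word_b"
  have d: "det a = 1" "det b = 1" by (simp_all add: a_def b_def det_mat_word)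
  define S where "S = (\<lambda>(A, B). (Ad b A - A) + (B - Ad a B)) ` (v_space \<times> v_space)"
  note lin = Ad_linear[THEN linear_add] Ad_linear[THEN linear_cmul] Ad_linear[THEN linear_0]
  have VV: "Real_Vector_Spaces.subspace (v_space \<times> v_space)" by (rule subspace_Times[OF v_space_subspace v_space_subspace])
  have "linear (\<lambda>(A, B). (Ad b A - A) + (B - Ad a B))"
    by (rule linearI) (auto simp: lin algebra_simps)
  then have S: "Real_Vector_Spaces.subspace S" unfolding S_def by (rule linear_subspace_image[OF _ VV])
  have SV: "S \<subseteq> v_space"
    using v_space_subspace Ad_v_space d by (auto simp: S_def real_vector.subspace_add real_vector.subspace_diff)
  have "S = v_space"
  proof (rule ccontr)
    assume "S \<noteq> v_space"
    then have "Real_Vector_Spaces.span S \<subset> Real_Vector_Spaces.span v_space"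
      using SV S v_space_subspace by (metis real_vector.span_eq_iff psubsetI)
    then obtain Z where Z: "Z \<noteq> 0" "Z \<in> v_space" "\<And>y. y \<in> S \<Longrightarrow> orthogonal Z y"
      using orthogonal_to_subspace_exists_gen S v_space_subspace by (metis real_vector.span_eq_iff)
    define P where "P = transpose Z"
    have P: "P \<in> v_space" "P \<noteq> 0"
      using Z v_space_transpose by (auto simp: P_def transpose_def vec_eq_iff)
    have tr: "trace (P ** y) = 0" if "y \<in> S" for y
      using Z(3)[OF that] by (simp add: P_def trace_transpose_mult orthogonal_def)
    have z: "(0 :: real^4^4) \<in> v_space" using v_space_subspace by (simp add: real_vector.subspace_0)
    have fix_: "Ad g P = P" if g: "det g = 1" and gS: "\<And>X. X \<in> v_space \<Longrightarrow> trace (P ** (Ad g X - X)) = 0" for g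
    proof -
      have da: "det (adj2 g) = 1" using g by simp
      have "trace ((Ad (adj2 g) P - P) ** X) = 0" if "X \<in> v_space" for X
        using gS[OF that] by (simp add: matrix_sub_distrib trace_sub trace_Ad)
      then have "Ad (adj2 g) P - P = 0"
        using Ad_v_space[OF da P(1)] P(1) v_space_subspace
        by (intro trace_pairing_nondegenerate) (auto simp: real_vector.subspace_diff)
      then show ?thesis using Ad_inverse(1)[OF g, of P] by simp
    qed
    have "Ad b P = P"
    proof (rule fix_[OF d(2)])
      fix X :: "real^4^4" assume "X \<in> v_space"
      then have "(Ad b X - X) + (0 - Ad a 0) \<in> S" unfolding S_def
        using z by (intro image_eqI[of _ _ "(X, 0)"]) auto
      then show "trace (P ** (Ad b X - X)) = 0" using tr by (simp add: lin)
    qed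
    moreover have "Ad a P = P"
    proof (rule fix_[OF d(1)])
      fix X :: "real^4^4" assume "X \<in> v_space"
      then have "(Ad b 0 - 0) + (X - Ad a X) \<in> S" unfolding S_def
        using z by (intro image_eqI[of _ _ "(0, X)"]) auto
      then have "trace (P ** (X - Ad a X)) = 0" using tr by (simp add: lin)
      then show "trace (P ** (Ad a X - X)) = 0" by (simp add: matrix_sub_distrib trace_sub)
    qed
    ultimately have "P = 0" using fiber_invariants_zero[OF rel nonreal P(1)] by (simp add: a_def b_def)
    then show False using P by simp
  qed
  then have "v \<in> S" using v by simp
  then show ?thesis by (auto simp: S_def a_def b_def)
qed

section \<open>Counting dimensions\<close>

lemma dim_image_plus_kernel:
  fixes f :: "'e::euclidean_space \<Rightarrow> 'f::euclidean_space"
  assumes S: "Real_Vector_Spaces.subspace S" and f: "linear f"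
  shows "Real_Vector_Spaces.dim (f ` S) + Real_Vector_Spaces.dim {x \<in> S. f x = 0} = Real_Vector_Spaces.dim S"
proof -
  define K where "K = {x \<in> S. f x = 0}"
  have K: "Real_Vector_Spaces.subspace K" "K \<subseteq> S"
    using S by (auto simp: K_def real_vector.subspace_def linear_0[OF f] linear_add[OF f] linear_cmul[OF f])
  define C where "C = {y \<in> S. \<forall>x\<in>K. orthogonal x y}"
  have C: "Real_Vector_Spaces.subspace C"
    using S by (auto simp: C_def real_vector.subspace_def orthogonal_def inner_add_right)
  have "inj_on f C"
  proof (rule inj_onI)
    fix x y assume xy: "x \<in> C" "y \<in> C" "f x = f y"
    then have d: "x - y \<in> C" using C by (simp add: real_vector.subspace_diff)
    then have "x - y \<in> K" using xy(3) by (simp add: C_def K_def linear_diff[OF f])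
    then have "orthogonal (x - y) (x - y)" using d by (simp add: C_def)
    then show "x = y" by (simp add: orthogonal_def)
  qed
  then have "Real_Vector_Spaces.dim (f ` C) = Real_Vector_Spaces.dim C"
    using dim_image_eq[OF f] C by (metis real_vector.span_eq_iff)
  moreover have "f ` C = f ` S"
  proof
    show "f ` S \<subseteq> f ` C"
    proof
      fix v assume "v \<in> f ` S"
      then obtain s where s: "s \<in> S" "v = f s" by blast
      obtain y z where yz: "y \<in> Real_Vector_Spaces.span K" "\<And>w. w \<in> Real_Vector_Spaces.span K \<Longrightarrow> orthogonal z w" "s = y + z"
        using orthogonal_subspace_decomp_exists[of K s] by blast
      have y: "y \<in> K" using yz(1) K by (metis real_vector.span_eq_iff)
      then have "z \<in> S" using yz(3) s(1) K(2) S by (metis add_diff_cancel_left' real_vector.subspace_diff subsetD)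
      then have "z \<in> C" using yz(2) by (auto simp: C_def orthogonal_commute real_vector.span_base)
      moreover have "f z = v" using y yz(3) s(2) by (simp add: K_def linear_add[OF f])
      ultimately show "v \<in> f ` C" by blast
    qed
  qed (auto simp: C_def)
  ultimately show ?thesis
    using dim_subspace_orthogonal_to_vectors[OF K(1) S K(2)] by (simp add: C_def K_def)
qed

lemma line_over_subspace:
  fixes B K :: "'e::euclidean_space set"
  assumes B: "Real_Vector_Spaces.subspace B" and K: "Real_Vector_Spaces.subspace K" and BK: "B \<subseteq> K"
    and dim: "Real_Vector_Spaces.dim K = Suc (Real_Vector_Spaces.dim B)"
  shows "\<exists>p0\<in>K. p0 \<notin> B \<and> (\<forall>p\<in>K. \<exists>r. p - r *\<^sub>R p0 \<in> B)"
proof -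
  have "B \<noteq> K" using dim by auto
  then obtain p0 where p0: "p0 \<in> K" "p0 \<notin> B" using BK by blast
  have nB: "p0 \<notin> Real_Vector_Spaces.span B" using p0 B by (metis real_vector.span_eq_iff)
  have "Real_Vector_Spaces.dim (insert p0 B) = Suc (Real_Vector_Spaces.dim B)"
    using dim_insert[of p0 B] nB by simp
  then have "Real_Vector_Spaces.dim (Real_Vector_Spaces.span (insert p0 B)) = Real_Vector_Spaces.dim K" using dim by simp
  moreover have "Real_Vector_Spaces.span (insert p0 B) \<subseteq> K"
    using p0 BK K by (intro real_vector.span_minimal) auto
  ultimately have "Real_Vector_Spaces.span (insert p0 B) = K"
    using K by (intro subspace_dim_equal) (auto simp: real_vector.subspace_span)
  then have "\<forall>p\<in>K. \<exists>r. p - r *\<^sub>R p0 \<in> B"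
    using B real_vector.span_breakdown_eq[of _ p0 B] by (metis real_vector.span_eq_iff)
  then show ?thesis using p0 by blast
qed

text \<open>The kernel and the cokernel of \<open>T - 1\<close> on \<open>E / B\<close> have the same dimension, and the cokernel is
  \<open>E / S\<close>.\<close>

lemma fixed_classes_line:
  fixes T :: "'e::euclidean_space \<Rightarrow> 'e" and B E :: "'e set"
  assumes E: "Real_Vector_Spaces.subspace E" and B: "Real_Vector_Spaces.subspace B" and BE: "B \<subseteq> E"
    and T: "linear T" "T ` E \<subseteq> E" "T ` B \<subseteq> B"
  defines "S \<equiv> {(T e - e) + \<beta> | e \<beta>. e \<in> E \<and> \<beta> \<in> B}"
  assumes dim: "Real_Vector_Spaces.dim E = Suc (Real_Vector_Spaces.dim S)"
  shows "\<exists>p0\<in>E. p0 \<notin> B \<and> T p0 - p0 \<in> B \<and> (\<forall>p\<in>E. T p - p \<in> B \<longrightarrow> (\<exists>r. p - r *\<^sub>R p0 \<in> B))"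
proof -
  define \<phi> where "\<phi> p = T p - p" for p
  have \<phi>: "linear \<phi>" unfolding \<phi>_def by (rule linearI) (simp_all add: linear_add[OF T(1)] linear_cmul[OF T(1)] algebra_simps)
  define K where "K = {p \<in> E. \<phi> p \<in> B}"
  have "Real_Vector_Spaces.subspace (\<phi> -` B)" by (rule linear_subspace_vimage[OF \<phi> B])
  moreover have "K = E \<inter> (\<phi> -` B)" by (auto simp: K_def)
  ultimately have K: "Real_Vector_Spaces.subspace K" using real_vector.subspace_inter[OF E] by simp
  have BK: "B \<subseteq> K"
  proof
    fix \<beta> assume "\<beta> \<in> B"
    then show "\<beta> \<in> K" using BE T(3) B by (auto simp: K_def \<phi>_def intro!: real_vector.subspace_diff)
  qed
  have ker: "{p \<in> K. \<phi> p = 0} = {p \<in> E. \<phi> p = 0}" using B by (auto simp: K_def real_vector.subspace_0)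
  have im: "\<phi> ` K = \<phi> ` E \<inter> B" by (auto simp: K_def)
  have S: "S = {x + y | x y. x \<in> \<phi> ` E \<and> y \<in> B}" by (auto simp: S_def \<phi>_def)
  have "Real_Vector_Spaces.dim (\<phi> ` K) + Real_Vector_Spaces.dim {p \<in> K. \<phi> p = 0} = Real_Vector_Spaces.dim K"
    "Real_Vector_Spaces.dim (\<phi> ` E) + Real_Vector_Spaces.dim {p \<in> E. \<phi> p = 0} = Real_Vector_Spaces.dim E"
    using dim_image_plus_kernel[OF K \<phi>] dim_image_plus_kernel[OF E \<phi>] by auto
  moreover have "Real_Vector_Spaces.dim S + Real_Vector_Spaces.dim (\<phi> ` E \<inter> B) = Real_Vector_Spaces.dim (\<phi> ` E) + Real_Vector_Spaces.dim B"
    unfolding S by (rule dim_sums_Int[OF linear_subspace_image[OF \<phi> E] B])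
  ultimately have "Real_Vector_Spaces.dim K = Suc (Real_Vector_Spaces.dim B)" using dim by (simp add: ker im)
  from line_over_subspace[OF B K BK this] show ?thesis by (auto simp: K_def \<phi>_def)
qed

text \<open>Under a surjection codimensions cannot grow, so \<open>1 \<le> codim S' \<le> codim S \<le> 1\<close>.\<close>

lemma codimension_one_image:
  fixes \<rho> :: "'e::euclidean_space \<Rightarrow> 'f::euclidean_space"
  assumes E: "Real_Vector_Spaces.subspace E" and S: "Real_Vector_Spaces.subspace S" "S \<subseteq> E" and V: "Real_Vector_Spaces.subspace V"
    and S': "Real_Vector_Spaces.subspace S'" "S' \<subseteq> V" "S' \<noteq> V"
    and \<rho>: "linear \<rho>" "\<rho> ` E = V" "\<rho> ` S \<subseteq> S'"
    and dim: "Real_Vector_Spaces.dim E \<le> Suc (Real_Vector_Spaces.dim S)"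
  shows "Real_Vector_Spaces.dim E = Suc (Real_Vector_Spaces.dim S)" "Real_Vector_Spaces.dim V = Suc (Real_Vector_Spaces.dim S')"
proof -
  have dS: "Real_Vector_Spaces.dim (\<rho> ` S) + Real_Vector_Spaces.dim {x \<in> S. \<rho> x = 0} = Real_Vector_Spaces.dim S"
    and dE: "Real_Vector_Spaces.dim V + Real_Vector_Spaces.dim {x \<in> E. \<rho> x = 0} = Real_Vector_Spaces.dim E"
    using dim_image_plus_kernel[OF S(1) \<rho>(1)] dim_image_plus_kernel[OF E \<rho>(1)] \<rho>(2) by auto
  have "Real_Vector_Spaces.dim {x \<in> S. \<rho> x = 0} \<le> Real_Vector_Spaces.dim {x \<in> E. \<rho> x = 0}"
    using S(2) by (intro dim_subset) auto
  moreover have "Real_Vector_Spaces.dim (\<rho> ` S) \<le> Real_Vector_Spaces.dim S'" by (rule dim_subset[OF \<rho>(3)])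
  moreover have lt: "Real_Vector_Spaces.dim S' < Real_Vector_Spaces.dim V"
    using S' V by (meson dim_subset le_neq_implies_less subspace_dim_equal order.refl linorder_not_less)
  ultimately show "Real_Vector_Spaces.dim E = Suc (Real_Vector_Spaces.dim S)" "Real_Vector_Spaces.dim V = Suc (Real_Vector_Spaces.dim S')"
    using dS dE dim by linarith+
qed

text \<open>For a linear system that depends continuously on \<open>u\<close>, having only the trivial solution is an open condition:
  otherwise solutions of norm \<open>1\<close> along a sequence tending to \<open>u0\<close> would accumulate at a solution of norm \<open>1\<close>
  at \<open>u0\<close>.\<close>

lemma eventually_trivial_annihilator:
  fixes \<Psi> :: "'t::metric_space \<Rightarrow> 'i \<Rightarrow> 'e::euclidean_space" and g :: "'e \<Rightarrow> real"
  assumes E: "Real_Vector_Spaces.subspace E" and g: "linear g"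
    and cont: "\<And>i. i \<in> I \<Longrightarrow> isCont (\<lambda>u. \<Psi> u i) u0"
    and triv: "\<And>y. y \<in> E \<Longrightarrow> (\<And>i. i \<in> I \<Longrightarrow> y \<bullet> \<Psi> u0 i = 0) \<Longrightarrow> g y = 0 \<Longrightarrow> y = 0"
  shows "\<exists>d>0. \<forall>u. dist u u0 < d \<longrightarrow> (\<forall>y\<in>E. (\<forall>i\<in>I. y \<bullet> \<Psi> u i = 0) \<longrightarrow> g y = 0 \<longrightarrow> y = 0)"
proof (rule ccontr)
  assume "\<not> ?thesis"
  then have "\<forall>n. \<exists>u y. dist u u0 < inverse (Suc n) \<and> y \<in> E \<and> (\<forall>i\<in>I. y \<bullet> \<Psi> u i = 0) \<and> g y = 0 \<and> y \<noteq> 0"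
    by (metis of_nat_0_less_iff positive_imp_inverse_positive zero_less_Suc)
  then obtain u y where uy: "\<And>n. dist (u n) u0 < inverse (Suc n)" "\<And>n. y n \<in> E"
     "\<And>n i. i \<in> I \<Longrightarrow> y n \<bullet> \<Psi> (u n) i = 0" "\<And>n. g (y n) = 0" "\<And>n. y n \<noteq> 0" by metis
  define w where "w n = (1 / norm (y n)) *\<^sub>R y n" for n
  have w: "w n \<in> E \<inter> sphere 0 1" "g (w n) = 0" "i \<in> I \<Longrightarrow> w n \<bullet> \<Psi> (u n) i = 0" for n i
    using uy E linear_cmul[OF g] by (auto simp: w_def real_vector.subspace_scale)
  have "compact (E \<inter> sphere 0 1)" using closed_subspace[OF E] by (intro closed_Int_compact) auto
  then obtain l r where lr: "l \<in> E \<inter> sphere 0 1" "strict_mono r" "(w \<circ> r) \<longlonglongrightarrow> l"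
    using w(1) unfolding compact_def by metis
  have "u \<longlonglongrightarrow> u0"
  proof (rule metric_tendsto_imp_tendsto[OF LIMSEQ_inverse_real_of_nat])
    show "\<forall>\<^sub>F n in sequentially. dist (u n) u0 \<le> dist (inverse (real (Suc n))) 0"
      using uy(1) by (intro always_eventually allI) (simp add: less_imp_le)
  qed
  then have ur: "(\<lambda>n. u (r n)) \<longlonglongrightarrow> u0" using LIMSEQ_subseq_LIMSEQ[OF _ lr(2)] by (simp add: o_def)
  have "l \<bullet> \<Psi> u0 i = 0" if i: "i \<in> I" for i
  proof -
    have "(\<lambda>n. \<Psi> (u (r n)) i) \<longlonglongrightarrow> \<Psi> u0 i" by (rule isCont_tendsto_compose[OF cont[OF i] ur])
    then have "(\<lambda>n. (w \<circ> r) n \<bullet> \<Psi> (u (r n)) i) \<longlonglongrightarrow> l \<bullet> \<Psi> u0 i" by (rule tendsto_inner[OF lr(3)])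
    then have "(\<lambda>n. 0 :: real) \<longlonglongrightarrow> l \<bullet> \<Psi> u0 i" using w(3)[OF i] by simp
    then show ?thesis using LIMSEQ_const_iff by metis
  qed
  moreover have "g l = 0"
  proof -
    have "isCont g l" using linear_continuous_at[OF linear_conv_bounded_linear[THEN iffD1, OF g]] by simp
    then have "(\<lambda>n. g ((w \<circ> r) n)) \<longlonglongrightarrow> g l" by (rule isCont_tendsto_compose[OF _ lr(3)])
    then have "(\<lambda>n. 0 :: real) \<longlonglongrightarrow> g l" using w(2) by simp
    then show ?thesis using LIMSEQ_const_iff by metis
  qed
  ultimately have "l = 0" using triv lr(1) by blast
  then show False using lr(1) by simp
qed

text \<open>The functional \<open>g\<close> is injective on the orthogonal complement of \<open>S\<close> in \<open>E\<close>.\<close>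

lemma codimension_le_one:
  fixes g :: "'e::euclidean_space \<Rightarrow> real"
  assumes E: "Real_Vector_Spaces.subspace E" and S: "Real_Vector_Spaces.subspace S" "S \<subseteq> E" and g: "linear g"
    and triv: "\<And>y. y \<in> E \<Longrightarrow> (\<And>s. s \<in> S \<Longrightarrow> y \<bullet> s = 0) \<Longrightarrow> g y = 0 \<Longrightarrow> y = 0"
  shows "Real_Vector_Spaces.dim E \<le> Suc (Real_Vector_Spaces.dim S)"
proof -
  define C where "C = {y \<in> E. \<forall>s\<in>S. orthogonal s y}"
  have dC: "Real_Vector_Spaces.dim C + Real_Vector_Spaces.dim S = Real_Vector_Spaces.dim E"
    unfolding C_def by (rule dim_subspace_orthogonal_to_vectors[OF S(1) E S(2)])
  have C: "Real_Vector_Spaces.subspace C"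
    using E by (auto simp: C_def real_vector.subspace_def orthogonal_def inner_add_right)
  have "{y \<in> C. g y = 0} \<subseteq> {0}" using triv by (auto simp: C_def orthogonal_def inner_commute)
  then have "Real_Vector_Spaces.dim {y \<in> C. g y = 0} \<le> 0" using dim_subset[of _ "{0}"] by (metis dim_singleton)
  moreover have "Real_Vector_Spaces.dim (g ` C) \<le> 1" using dim_subset_UNIV[of "g ` C"] by simp
  ultimately show ?thesis using dim_image_plus_kernel[OF C g] dC by linarith
qed

lemma image_plus_Collect:
  "{\<phi> e + \<beta> | e \<beta>. e \<in> W \<and> \<beta> \<in> B} = {x + y | x y. x \<in> \<phi> ` W \<and> y \<in> B}"
  by blast

locale fig8_euclidean = fig8_action V act for V :: "'v::euclidean_space set" and act
begin

text \<open>The value at \<open>l\<close> of the crossed homomorphism with values \<open>A\<close> and \<open>B\<close> at \<open>a\<close> and \<open>b\<close>.\<close>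

definition boundary_value :: "'v \<times> 'v \<Rightarrow> 'v" where
  "boundary_value = (\<lambda>(A, B). bi (ai (b A - A + B - a B)))"

definition fiber_coboundaries :: "('v \<times> 'v) set" where
  "fiber_coboundaries = (\<lambda>w. (a w - w, b w - w)) ` V"

lemma act_l: "act elt_l v = bi (ai (b (a v)))"
  unfolding elt_l_eq by (simp add: act_mult)

lemma twist_linear: "linear twist"
  by (rule linearI) (auto simp: twist_def act_simps algebra_simps)

lemma boundary_value_linear: "linear boundary_value"
  by (rule linearI) (auto simp: boundary_value_def act_simps algebra_simps)

lemma boundary_value_twist: "boundary_value (twist p) = x (boundary_value p)"
  by (cases p) (simp add: boundary_value_def twist_def op.normalize algebra_simps)

lemma boundary_value_coboundary: "boundary_value (a w - w, b w - w) = act elt_l w - w"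
  by (simp add: boundary_value_def act_l op.linear_simps op.cancel)

lemma VV_subspace: "Real_Vector_Spaces.subspace (V \<times> V)"
  by (rule subspace_Times[OF V V])

lemma fiber_coboundaries_subspace:
  "Real_Vector_Spaces.subspace fiber_coboundaries" "fiber_coboundaries \<subseteq> V \<times> V"
proof -
  have "linear (\<lambda>w. (a w - w, b w - w))"
    by (rule linearI; auto simp: act_simps algebra_simps)
  then show "Real_Vector_Spaces.subspace fiber_coboundaries" "fiber_coboundaries \<subseteq> V \<times> V"
    unfolding fiber_coboundaries_def using linear_subspace_image[OF _ V]
    by (auto simp: V_closed act_closed)
qed

lemma twist_closed: "twist ` (V \<times> V) \<subseteq> V \<times> V"
  by (auto simp: twist_def V_closed act_closed)

lemma codimension_subspace:
  defines "S \<equiv> {(twist e - e) + \<beta> | e \<beta>. e \<in> V \<times> V \<and> \<beta> \<in> fiber_coboundaries}"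
  shows "Real_Vector_Spaces.subspace S" "S \<subseteq> V \<times> V"
proof -
  have l1: "linear (\<lambda>e. twist e - e)"
    by (rule linearI; simp add: linear_add[OF twist_linear] linear_cmul[OF twist_linear] algebra_simps)
  have "S = {x + y | x y. x \<in> (\<lambda>e. twist e - e) ` (V \<times> V) \<and> y \<in> fiber_coboundaries}"
    unfolding S_def by (rule image_plus_Collect)
  then show "Real_Vector_Spaces.subspace S"
    using real_vector.subspace_sums[OF linear_subspace_image[OF l1 VV_subspace] fiber_coboundaries_subspace(1)] by simp
  show "S \<subseteq> V \<times> V"
  proof
    fix s assume "s \<in> S"
    then obtain e \<beta> where s: "s = (twist e - e) + \<beta>" "e \<in> V \<times> V" "\<beta> \<in> fiber_coboundaries"
      unfolding S_def by blast
    then have "twist e \<in> V \<times> V" "\<beta> \<in> V \<times> V" using twist_closed fiber_coboundaries_subspace(2) by blast+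
    then show "s \<in> V \<times> V" unfolding s(1) using s(2) VV_subspace
      by (intro real_vector.subspace_add real_vector.subspace_diff)
  qed
qed

text \<open>The upper bound on the codimension is an assumption here; the lower bound comes from the boundary, by
  comparing the two cokernels of \<open>x - 1\<close> through the boundary value.  As the codimensions are then both \<open>1\<close>,
  both spaces of invariants are lines.\<close>

lemma invariants_one_dimensional:
  assumes coinv: "\<And>v. v \<in> V \<Longrightarrow> \<exists>A\<in>V. \<exists>B\<in>V. v = (b A - A) + (B - a B)"
    and boundary: "{(x v - v) + (act elt_l w - w) | v w. v \<in> V \<and> w \<in> V} \<noteq> V"
    and codim: "Real_Vector_Spaces.dim (V \<times> V) \<le>
       Suc (Real_Vector_Spaces.dim {(twist e - e) + \<beta> | e \<beta>. e \<in> V \<times> V \<and> \<beta> \<in> fiber_coboundaries})"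
  defines "IF \<equiv> x_invariants (H1 \<pi>M \<pi>F V act) (x_class \<pi>F elt_x)"
    and "IdF \<equiv> x_invariants (H1 \<pi>M \<pi>dF V act) (x_class \<pi>dF elt_x)"
  shows "isomorphic_spaces IF IdF \<and> vectorspace.fin_dim real_ring IF \<and> vectorspace.dim real_ring IF = 1"
proof -
  define Bl where "Bl = (\<lambda>w. act elt_l w - w) ` V"
  define S where "S = {(twist e - e) + \<beta> | e \<beta>. e \<in> V \<times> V \<and> \<beta> \<in> fiber_coboundaries}"
  \<comment> \<open>\<open>S\<close> and \<open>S'\<close> are the preimages in \<open>V \<times> V\<close> and in \<open>V\<close> of the images of \<open>x - 1\<close> on the cohomology of the
    fiber and of its boundary\<close>
  define S' where "S' = {(x v - v) + \<beta> | v \<beta>. v \<in> V \<and> \<beta> \<in> Bl}"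
  have lB: "linear (\<lambda>w. act elt_l w - w)"
    by (rule linearI; auto simp: act_simps algebra_simps)
  note BF = fiber_coboundaries_subspace and tw = twist_closed
  have BL: "Real_Vector_Spaces.subspace Bl" "Bl \<subseteq> V"
    unfolding Bl_def using linear_subspace_image[OF lB V]
    by (auto simp: V_closed act_closed)
  have twB: "twist ` fiber_coboundaries \<subseteq> fiber_coboundaries"
  proof -
    have "twist (a w - w, b w - w) = (a (x w) - x w, b (x w) - x w)" for w
      by (simp add: twist_def op.normalize algebra_simps)
    then show ?thesis by (auto simp: fiber_coboundaries_def act_closed)
  qed
  have xB: "x ` Bl \<subseteq> Bl"
  proof -
    have "x (act elt_l w - w) = act elt_l (x w) - x w" for w
      using arg_cong[OF elt_relations(3), of "\<lambda>g. act g w"] by (simp add: act_mult act_simps)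
    then show ?thesis by (auto simp: Bl_def act_closed)
  qed
  have l1: "linear (\<lambda>v. x v - v)"
    by (rule linearI; simp add: act_simps algebra_simps)
  note S = codimension_subspace[folded S_def]
  have S': "Real_Vector_Spaces.subspace S'" "S' \<subseteq> V"
  proof -
    have "S' = {y + z | y z. y \<in> (\<lambda>v. x v - v) ` V \<and> z \<in> Bl}"
      unfolding S'_def by (rule image_plus_Collect)
    then show "Real_Vector_Spaces.subspace S'"
      using real_vector.subspace_sums[OF linear_subspace_image[OF l1 V] BL(1)] by simp
    show "S' \<subseteq> V" using BL(2) by (auto simp: S'_def V_closed act_closed)
  qed
  have "S' = {(x v - v) + (act elt_l w - w) | v w. v \<in> V \<and> w \<in> V}"
    unfolding S'_def Bl_def by blast
  then have nS': "S' \<noteq> V" using boundary by simp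
  have im: "boundary_value ` (V \<times> V) = V"
  proof (rule equalityI)
    show "boundary_value ` (V \<times> V) \<subseteq> V" by (auto simp: boundary_value_def V_closed act_closed)
    show "V \<subseteq> boundary_value ` (V \<times> V)"
    proof
      fix v assume "v \<in> V"
      then have "a (b v) \<in> V" by (simp add: act_closed)
      then obtain A B where AB: "A \<in> V" "B \<in> V" "a (b v) = (b A - A) + (B - a B)" using coinv by blast
      have "b A - A + B - a B = a (b v)" unfolding AB(3) by simp
      then have "boundary_value (A, B) = bi (ai (a (b v)))" by (simp add: boundary_value_def)
      then have "v = boundary_value (A, B)" by (simp add: op.cancel)
      then show "v \<in> boundary_value ` (V \<times> V)" using AB by blast
    qed
  qed
  have imS: "boundary_value ` S \<subseteq> S'"
  proof
    fix y assume "y \<in> boundary_value ` S"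
    then obtain e w where e: "e \<in> V \<times> V" "w \<in> V" "y = boundary_value ((twist e - e) + (a w - w, b w - w))"
      by (auto simp: S_def fiber_coboundaries_def)
    then have "y = (x (boundary_value e) - boundary_value e) + (act elt_l w - w)"
      using boundary_value_linear by (simp add: linear_add linear_diff boundary_value_twist boundary_value_coboundary)
    moreover have "boundary_value e \<in> V" using im e(1) by blast
    ultimately show "y \<in> S'" using e(2) by (auto simp: S'_def Bl_def)
  qed
  note dims = codimension_one_image[OF VV_subspace S V S' nS' boundary_value_linear im imS codim[folded S_def]]
  obtain p0 where p0: "p0 \<in> V \<times> V" "p0 \<notin> fiber_coboundaries" "twist p0 - p0 \<in> fiber_coboundaries"
    "\<And>p. p \<in> V \<times> V \<Longrightarrow> twist p - p \<in> fiber_coboundaries \<Longrightarrow> \<exists>r. p - r *\<^sub>R p0 \<in> fiber_coboundaries"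
    using fixed_classes_line[OF VV_subspace BF twist_linear tw twB] dims(1) unfolding S_def by blast
  obtain v0 where v0: "v0 \<in> V" "v0 \<notin> Bl" "x v0 - v0 \<in> Bl"
    "\<And>v. v \<in> V \<Longrightarrow> x v - v \<in> Bl \<Longrightarrow> \<exists>r. v - r *\<^sub>R v0 \<in> Bl"
    using fixed_classes_line[OF V BL act_linear[OF elt_x_carrier] _ xB] dims(2) act_closed[OF elt_x_carrier]
    unfolding S'_def by blast
  note F = fiber_invariants_line[folded fiber_coboundaries_def, OF p0, folded IF_def]
  note dF = boundary_invariants_line[OF coinv, folded Bl_def, OF _ v0, folded IdF_def]
  obtain c where c: "c \<in> carrier IF" "c \<noteq> \<zero>\<^bsub>IF\<^esub>" "\<And>m. m \<in> carrier IF \<Longrightarrow> \<exists>r. m = r \<odot>\<^bsub>IF\<^esub> c" using F(2) by blast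
  obtain d where d: "d \<in> carrier IdF" "d \<noteq> \<zero>\<^bsub>IdF\<^esub>" "\<And>m. m \<in> carrier IdF \<Longrightarrow> \<exists>r. m = r \<odot>\<^bsub>IdF\<^esub> d" using dF(2) by blast
  show ?thesis
    using one_dimensional[OF F(1) c] one_dimensional_isomorphic[OF F(1) c dF(1) d] by blast
qed

end

section \<open>The complete structure\<close>

definition omega :: complex where "omega = cis (pi / 3)"

lemma omega_simps: "omega = Complex (1 / 2) (sqrt 3 / 2)" "omega * omega = omega - 1" "cnj omega = 1 - omega"
proof -
  show 1: "omega = Complex (1 / 2) (sqrt 3 / 2)"
    by (simp add: omega_def cis.ctr cos_60 sin_60)
  show "omega * omega = omega - 1" "cnj omega = 1 - omega" by (simp_all add: 1 complex_eq_iff)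
qed

lemma shape_relation_complete: "shape_relation 0 omega"
  using omega_simps(2) by (simp add: shape_relation_def algebra_simps)

text \<open>The columns are a basis of the lattice of Hermitian matrices with diagonal entries in \<open>\<int>\<close> and off-diagonal
  entries in \<open>\<int>[\<omega>]\<close>; see \<open>hermitian_eisenstein\<close>.\<close>

definition eisenstein_basis :: "real^4^4" where
  "eisenstein_basis = vector [vector [0, 0, 1, 1 / 2], vector [0, 0, 0, sqrt 3 / 2],
                              vector [1 / 2, - 1 / 2, 0, 0], vector [1 / 2, 1 / 2, 0, 0]]"

definition eisenstein_dual :: "real^4^4" where
  "eisenstein_dual = vector [vector [0, 0, 1, 1], vector [0, 0, - 1, 1],
                             vector [1, - 1 / sqrt 3, 0, 0], vector [0, 2 / sqrt 3, 0, 0]]"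

lemmas matrix4_simps = vec_eq_iff forall_4 matrix_matrix_mult_def sum_4 transpose_def

lemma eisenstein_dual: "eisenstein_dual ** eisenstein_basis = mat 1" "eisenstein_basis ** eisenstein_dual = mat 1"
proof -
  show 1: "eisenstein_dual ** eisenstein_basis = mat 1"
    by (simp add: matrix4_simps eisenstein_basis_def eisenstein_dual_def mat_def)
  show "eisenstein_basis ** eisenstein_dual = mat 1" using 1 matrix_left_right_inverse by metis
qed

lemma hermitian_eisenstein:
  "hermitian (eisenstein_basis *v p) =
     vector [vector [of_real (p $ 1), of_real (p $ 3) + (1 - omega) * of_real (p $ 4)],
             vector [of_real (p $ 3) + omega * of_real (p $ 4), of_real (p $ 2)]]"
  by (simp add: hermitian_def vec_eq_iff forall_2 matrix_vector_mult_def sum_4 eisenstein_basis_def omega_simps(1)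
     complex_eq_iff algebra_simps)

text \<open>\<open>L\<close> is the matrix of \<open>H \<mapsto> M H M\<^sup>*\<close> with respect to the lattice basis; it is integral if the entries of
  \<open>M\<close> lie in \<open>\<int>[\<omega>]\<close>.\<close>

definition integral_form :: "complex^2^2 \<Rightarrow> real^4^4 \<Rightarrow> bool" where
  "integral_form M L \<longleftrightarrow> lorentz M ** eisenstein_basis = eisenstein_basis ** L"

lemma integral_formI:
  assumes "\<And>p. M ** hermitian (eisenstein_basis *v p) ** conj_transpose M = hermitian (eisenstein_basis *v (L *v p))"
  shows "integral_form M L"
proof -
  have "lorentz M *v (eisenstein_basis *v p) = eisenstein_basis *v (L *v p)" for p
    using assms[of p] hermitian_eq_iff by (simp add: hermitian_lorentz[symmetric])
  then have "(lorentz M ** eisenstein_basis) *v p = (eisenstein_basis ** L) *v p" for p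
    by (simp add: matrix_vector_mul_assoc)
  then show ?thesis using matrix_eq unfolding integral_form_def by blast
qed

lemma integral_form_mult:
  assumes "integral_form M L" "integral_form M' L'" shows "integral_form (M ** M') (L ** L')"
proof -
  have "lorentz (M ** M') ** eisenstein_basis = lorentz M ** (lorentz M' ** eisenstein_basis)"
    by (simp add: lorentz_mult matrix_mul_assoc)
  also have "\<dots> = (lorentz M ** eisenstein_basis) ** L'" using assms by (simp add: integral_form_def matrix_mul_assoc)
  also have "\<dots> = eisenstein_basis ** (L ** L')" using assms by (simp add: integral_form_def matrix_mul_assoc)
  finally show ?thesis by (simp add: integral_form_def)
qed

text \<open>The actions of \<open>a\<close>, \<open>x\<close> and \<open>b\<inverse>\<close> on the lattice, for the complete structure.\<close>

definition La :: "real^4^4" where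
  "La = vector [vector [0, 1, 0, 0], vector [1, 3, 0, - 3], vector [0, - 2, 0, 1], vector [0, 1, 1, 0]]"
definition Lx :: "real^4^4" where
  "Lx = vector [vector [1, 1, - 2, - 1], vector [0, 1, 0, 0], vector [0, - 1, 1, 0], vector [0, 0, 0, 1]]"
definition Lbi :: "real^4^4" where
  "Lbi = vector [vector [1, 1, 2, 1], vector [1, 1, 1, - 1], vector [0, 1, 1, 0], vector [- 1, - 1, - 2, 0]]"

abbreviation "a0 \<equiv> mat_word 0 omega word_a"
abbreviation "b0 \<equiv> mat_word 0 omega word_b"
abbreviation "x0 \<equiv> mat_x 0"

lemma a0: "a0 = vector [vector [0, - omega], vector [1 - omega, 1 + omega]]"
  unfolding mat_a[OF shape_relation_complete] using omega_simps(2) by (simp add: vec_eq_iff forall_2 algebra_simps)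

lemma b0: "b0 = vector [vector [1 - omega, - 1], vector [omega, 1]]"
  unfolding mat_b[OF shape_relation_complete] by simp

lemma x0: "x0 = vector [vector [1, - 1], vector [0, 1]]" by (simp add: mat_x_def)

lemma omega_square: "omega * (omega * c) = omega * c - c"
  using omega_simps(2) by Groebner_Basis.algebra

lemma integral_forms: "integral_form a0 La" "integral_form x0 Lx" "integral_form (adj2 b0) Lbi"
proof -
  note simps = a0 b0 x0 adj2_def La_def Lx_def Lbi_def vec_eq_iff forall_2 matrix_matrix_mult_def sum_2
       matrix_vector_mult_def sum_4 conj_transpose_def omega_simps(3)
  show "integral_form a0 La"
    by (rule integral_formI, unfold hermitian_eisenstein, simp add: simps) (intro conjI; use omega_simps(2) in Groebner_Basis.algebra)
  show "integral_form x0 Lx"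
    by (rule integral_formI, unfold hermitian_eisenstein, simp add: simps) (simp add: algebra_simps)
  show "integral_form (adj2 b0) Lbi"
    by (rule integral_formI, unfold hermitian_eisenstein, simp add: simps) (simp add: algebra_simps omega_simps(2) omega_square)
qed

text \<open>The bilinear form with matrix \<open>X J\<close>, in lattice coordinates.  On these symmetric matrices a group element
  with lattice matrix \<open>L\<close> acts by \<open>G \<mapsto> L G L\<^sup>T\<close>, so equations between group elements become integral linear
  equations.\<close>

definition gram :: "real^4^4 \<Rightarrow> real^4^4" where
  "gram X = eisenstein_dual ** (X ** minkowski) ** transpose eisenstein_dual"

lemma gram_zero_iff: "gram X = 0 \<longleftrightarrow> X = 0"
proof
  assume "gram X = 0"
  then have "eisenstein_basis ** gram X ** transpose eisenstein_basis ** minkowski = 0" by simp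
  also have "eisenstein_basis ** gram X ** transpose eisenstein_basis =
     (eisenstein_basis ** eisenstein_dual) ** (X ** minkowski) ** transpose (eisenstein_basis ** eisenstein_dual)"
    by (simp add: gram_def matrix_transpose_mul matrix_mul_assoc)
  finally show "X = 0" by (simp add: eisenstein_dual transpose_mat)
qed (simp add: gram_def)

lemma gram_linear: "gram (X + Y) = gram X + gram Y" "gram (X - Y) = gram X - gram Y" "gram (c *\<^sub>R X) = c *\<^sub>R gram X"
  by (simp_all add: gram_def matrix_add_ldistrib matrix_add_rdistrib' matrix_sub_distrib matrix_mult_scaleR)

lemma gram_Ad:
  assumes "integral_form M L"
  shows "gram (Ad M X) = L ** gram X ** transpose L"
proof -
  have L: "eisenstein_dual ** lorentz M = L ** eisenstein_dual"
  proof -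
    have "eisenstein_dual ** lorentz M = eisenstein_dual ** (lorentz M ** eisenstein_basis) ** eisenstein_dual"
      by (simp add: eisenstein_dual flip: matrix_mul_assoc)
    also have "\<dots> = (eisenstein_dual ** eisenstein_basis) ** L ** eisenstein_dual"
      using assms by (simp add: integral_form_def matrix_mul_assoc)
    finally show ?thesis by (simp add: eisenstein_dual)
  qed
  have "lorentz (adj2 M) ** minkowski = minkowski ** (minkowski ** lorentz (adj2 M)) ** minkowski" by simp
  also have "\<dots> = minkowski ** transpose (lorentz M)" by (simp add: lorentz_adj2[symmetric] matrix_mul_assoc)
  finally have "Ad M X ** minkowski = lorentz M ** (X ** minkowski) ** transpose (lorentz M)"
    by (simp add: Ad_def flip: matrix_mul_assoc)
  then have "gram (Ad M X) = (eisenstein_dual ** lorentz M) ** (X ** minkowski) ** transpose (eisenstein_dual ** lorentz M)"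
    by (simp add: gram_def matrix_transpose_mul matrix_mul_assoc)
  then show ?thesis unfolding L by (simp add: gram_def matrix_transpose_mul matrix_mul_assoc)
qed

text \<open>The second equation is the vanishing of the trace of \<open>X\<close>.\<close>

lemma gram_v_space:
  assumes "X \<in> v_space"
  shows "transpose (gram X) = gram X" "gram X $ 1 $ 2 = gram X $ 3 $ 3 + gram X $ 3 $ 4 + gram X $ 4 $ 4"
proof -
  have X: "trace X = 0" "transpose X ** minkowski = minkowski ** X" using assms by (auto simp: v_space_iff)
  have "X ** minkowski = minkowski ** (minkowski ** X) ** minkowski" by simp
  also have "\<dots> = minkowski ** transpose X" by (simp add: X(2)[symmetric] matrix_mul_assoc)
  finally have s: "X ** minkowski = minkowski ** transpose X" .
  show sym: "transpose (gram X) = gram X"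
    by (simp add: gram_def matrix_transpose_mul matrix_mul_assoc) (simp add: s flip: matrix_mul_assoc)
  have "X = eisenstein_basis ** gram X ** transpose eisenstein_basis ** minkowski"
  proof -
    have "eisenstein_basis ** gram X ** transpose eisenstein_basis =
       (eisenstein_basis ** eisenstein_dual) ** (X ** minkowski) ** transpose (eisenstein_basis ** eisenstein_dual)"
      by (simp add: gram_def matrix_transpose_mul matrix_mul_assoc)
    then show ?thesis by (simp add: eisenstein_dual transpose_mat)
  qed
  moreover have "trace (eisenstein_basis ** G ** transpose eisenstein_basis ** minkowski) =
     G $ 3 $ 3 + (G $ 3 $ 4 + G $ 4 $ 3) / 2 + G $ 4 $ 4 - (G $ 1 $ 2 + G $ 2 $ 1) / 2" for G
    unfolding trace_def sum_4 minkowski_mult_entries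
    by (simp add: matrix_matrix_mult_def sum_4 transpose_def eisenstein_basis_def field_simps)
  ultimately have "gram X $ 3 $ 3 + (gram X $ 3 $ 4 + gram X $ 4 $ 3) / 2 + gram X $ 4 $ 4 - (gram X $ 1 $ 2 + gram X $ 2 $ 1) / 2 = 0"
    using X(1) by metis
  moreover have "gram X $ 4 $ 3 = gram X $ 3 $ 4" "gram X $ 2 $ 1 = gram X $ 1 $ 2"
    using arg_cong[OF sym, of "\<lambda>G. G $ 3 $ 4"] arg_cong[OF sym, of "\<lambda>G. G $ 1 $ 2"] by (simp_all add: transpose_def)
  ultimately show "gram X $ 1 $ 2 = gram X $ 3 $ 3 + gram X $ 3 $ 4 + gram X $ 4 $ 4" by simp
qed

text \<open>A symmetric matrix with the given trace condition has nine free entries.  The two matrix equations determine it up to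
  a factor, which the condition \<open>M $ 4 $ 4 = 0\<close> fixes.\<close>

lemma integral_linear_system:
  fixes M :: "real^4^4"
  assumes sym: "transpose M = M" and tr: "M $ 1 $ 2 = M $ 3 $ 3 + M $ 3 $ 4 + M $ 4 $ 4" and z: "M $ 4 $ 4 = 0"
    and 1: "(Lx ** Lbi ** La) ** M ** transpose (Lx ** Lbi ** La) - (Lx ** Lbi ** Lx) ** M ** transpose (Lx ** Lbi ** Lx)
       + (La ** Lbi ** Lx) ** M ** transpose (La ** Lbi ** Lx) = La ** M ** transpose La - Lx ** M ** transpose Lx"
    and 2: "(La ** Lx ** Lbi ** La) ** M ** transpose (La ** Lx ** Lbi ** La)
       - (La ** Lx ** Lbi ** Lx) ** M ** transpose (La ** Lx ** Lbi ** Lx)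
       + (La ** Lx) ** M ** transpose (La ** Lx) = La ** M ** transpose La - Lx ** M ** transpose Lx"
  shows "M = 0"
proof -
  have L:
    "Lx ** Lbi ** La = vector [vector [1, 0, 0, 0], vector [1, 1, -1, -2], vector [0, 0, 1, 0], vector [-1, 0, 0, 1]]"
    "Lx ** Lbi ** Lx = vector [vector [3, 1, -3, -3], vector [1, 1, -1, -2], vector [-1, -1, 2, 2], vector [-1, 0, 0, 1]]"
    "La ** Lbi ** Lx = vector [vector [1, 1, -1, -2], vector [7, 3, -3, -9], vector [-3, -2, 2, 5], vector [1, 1, 0, -2]]"
    "La ** Lx ** Lbi ** La = vector [vector [1, 1, -1, -2], vector [7, 3, -3, -9], vector [-3, -2, 2, 5], vector [1, 1, 0, -2]]"
    "La ** Lx ** Lbi ** Lx = vector [vector [1, 1, -1, -2], vector [9, 4, -6, -12], vector [-3, -2, 2, 5], vector [0, 0, 1, 0]]"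
    "La ** Lx = vector [vector [0, 1, 0, 0], vector [1, 4, -2, -4], vector [0, -2, 0, 1], vector [0, 0, 1, 0]]"
    by (simp_all add: matrix4_simps La_def Lx_def Lbi_def)
  have s: "M $ 2 $ 1 = M $ 1 $ 2" "M $ 3 $ 1 = M $ 1 $ 3" "M $ 4 $ 1 = M $ 1 $ 4"
     "M $ 3 $ 2 = M $ 2 $ 3" "M $ 4 $ 2 = M $ 2 $ 4" "M $ 4 $ 3 = M $ 3 $ 4"
    using sym by (simp_all add: vec_eq_iff transpose_def)
  have e: "(L ** M ** transpose L) $ i $ j = (\<Sum>k\<in>UNIV. \<Sum>l\<in>UNIV. L $ i $ l * M $ l $ k * L $ j $ k)" for L i j
    by (simp add: matrix_matrix_mult_def transpose_def sum_distrib_right)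
  note simps = vector_add_component vector_minus_component e sum_4 vector_4 s z
  \<comment> \<open>\<open>e213\<close>, for example, is the entry \<open>(1, 3)\<close> of the second matrix equation; these eight entries, the trace condition
  and \<open>M $ 4 $ 4 = 0\<close> already have only the trivial solution\<close>
  have e233: "(1) * M $ 2 $ 2 + (- 2) * M $ 2 $ 3 + (1) * M $ 3 $ 3 = 0"
    using arg_cong[OF 2[unfolded L(4,5), unfolded L(6), unfolded La_def Lx_def], of "\<lambda>N. N $ 3 $ 3"] tr z
    by (simp add: simps)
  have e113: "(- 2) * M $ 1 $ 3 + (2) * M $ 1 $ 4 + (2) * M $ 2 $ 3 + (4) * M $ 2 $ 4 = 0"
    using arg_cong[OF 1[unfolded L(1-3), unfolded La_def Lx_def], of "\<lambda>N. N $ 1 $ 3"] tr z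
    by (simp add: simps)
  have e111: "(- 6) * M $ 1 $ 1 + (12) * M $ 1 $ 3 + (12) * M $ 1 $ 4 + (- 6) * M $ 3 $ 3 + (- 12) * M $ 3 $ 4 = 0"
    using arg_cong[OF 1[unfolded L(1-3), unfolded La_def Lx_def], of "\<lambda>N. N $ 1 $ 1"] tr z
    by (simp add: simps)
  have e213: "(1) * M $ 1 $ 3 + (- 1) * M $ 2 $ 2 + (3) * M $ 2 $ 3 + (1) * M $ 2 $ 4 + (- 3) * M $ 3 $ 3 + (- 2) * M $ 3 $ 4 = 0"
    using arg_cong[OF 2[unfolded L(4,5), unfolded L(6), unfolded La_def Lx_def], of "\<lambda>N. N $ 1 $ 3"] tr z
    by (simp add: simps)
  have e112: "(5) * M $ 1 $ 1 + (- 5) * M $ 1 $ 3 + (- 16) * M $ 1 $ 4 + (- 4) * M $ 2 $ 3 + (- 8) * M $ 2 $ 4 + (7) * M $ 3 $ 3 + (13) * M $ 3 $ 4 = 0"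
    using arg_cong[OF 1[unfolded L(1-3), unfolded La_def Lx_def], of "\<lambda>N. N $ 1 $ 2"] tr z
    by (simp add: simps)
  have e123: "(- 20) * M $ 1 $ 1 + (21) * M $ 1 $ 3 + (57) * M $ 1 $ 4 + (11) * M $ 2 $ 3 + (20) * M $ 2 $ 4 + (- 24) * M $ 3 $ 3 + (- 48) * M $ 3 $ 4 = 0"
    using arg_cong[OF 1[unfolded L(1-3), unfolded La_def Lx_def], of "\<lambda>N. N $ 2 $ 3"] tr z
    by (simp add: simps)
  have e212: "(- 2) * M $ 1 $ 1 + (5) * M $ 1 $ 3 + (7) * M $ 1 $ 4 + (1) * M $ 2 $ 2 + (3) * M $ 2 $ 4 + (- 5) * M $ 3 $ 3 + (- 11) * M $ 3 $ 4 = 0"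
    using arg_cong[OF 2[unfolded L(4,5), unfolded L(6), unfolded La_def Lx_def], of "\<lambda>N. N $ 1 $ 2"] tr z
    by (simp add: simps)
  have e122: "(48) * M $ 1 $ 1 + (- 42) * M $ 1 $ 3 + (- 120) * M $ 1 $ 4 + (1) * M $ 2 $ 2 + (- 18) * M $ 2 $ 3 + (- 36) * M $ 2 $ 4 + (45) * M $ 3 $ 3 + (90) * M $ 3 $ 4 = 0"
    using arg_cong[OF 1[unfolded L(1-3), unfolded La_def Lx_def], of "\<lambda>N. N $ 2 $ 2"] tr z
    by (simp add: simps)
  have "M $ 1 $ 1 = 0" "M $ 1 $ 2 = 0" "M $ 1 $ 3 = 0" "M $ 1 $ 4 = 0" "M $ 2 $ 2 = 0"
    "M $ 2 $ 3 = 0" "M $ 2 $ 4 = 0" "M $ 3 $ 3 = 0" "M $ 3 $ 4 = 0"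
    using tr z e233 e113 e111 e213 e112 e123 e212 e122
    by Groebner_Basis.algebra+
  then show ?thesis by (simp add: vec_eq_iff forall_4 s z)
qed

text \<open>Dually to the operators \<open>x - 1\<close> and \<open>w \<mapsto> (a w - w, b w - w)\<close>, the condition on \<open>(P, Q)\<close> consists of three
  equations in \<open>V\<close>, one for each of \<open>A\<close>, \<open>B\<close>, \<open>w\<close>.  The second one expresses \<open>P\<close> by \<open>Q\<close>, and the other two become a
  linear system for \<open>q = x\<inverse> Q\<close>.\<close>

lemma complete_annihilator:
  assumes P: "P \<in> v_space" and Q: "Q \<in> v_space"
    and hyp: "\<And>A B w. A \<in> v_space \<Longrightarrow> B \<in> v_space \<Longrightarrow> w \<in> v_space \<Longrightarrow>
      trace (P ** (Ad x0 (Ad (adj2 b0) (A + Ad a0 A - B)) - A + (Ad a0 w - w)))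
      + trace (Q ** (Ad x0 (Ad (adj2 a0) (B - A)) - B + (Ad b0 w - w))) = 0"
    and gz: "gram (Ad (adj2 x0) Q) $ 4 $ 4 = 0"
  shows "P = 0 \<and> Q = 0"
proof -
  note lin = Ad_linear[THEN linear_add] Ad_linear[THEN linear_diff] Ad_linear[THEN linear_0] Ad_linear[THEN linear_neg]
  have d: "det a0 = 1" "det b0 = 1" "det x0 = 1" "det (adj2 a0) = 1" "det (adj2 b0) = 1" "det (adj2 x0) = 1"
    by (simp_all add: det_mat_word det_mat_x)
  note cl = d[THEN Ad_v_space] and vs = real_vector.subspace_add[OF v_space_subspace] real_vector.subspace_diff[OF v_space_subspace]
  note inv = d(1-3)[THEN Ad_inverse(1)] d(1-3)[THEN Ad_inverse(2)]
  have z: "(0 :: real^4^4) \<in> v_space" using v_space_subspace by (simp add: real_vector.subspace_0)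
  define p q where "p = Ad (adj2 x0) P" and "q = Ad (adj2 x0) Q"
  have V: "p \<in> v_space" "q \<in> v_space" using P Q by (simp_all add: p_def q_def cl)
  have PQ: "P = Ad x0 p" "Q = Ad x0 q" by (simp_all add: p_def q_def inv)
  note tr = matrix_sub_distrib matrix_add_ldistrib matrix_add_rdistrib' trace_sub trace_add trace_minus matrix_mult_minus trace_Ad
  \<comment> \<open>the coefficients of \<open>A\<close>, \<open>B\<close> and \<open>w\<close> in \<open>hyp\<close>\<close>
  have E1: "Ad b0 p + Ad (adj2 a0) (Ad b0 p) - P - Ad a0 q = 0"
  proof (rule trace_pairing_nondegenerate)
    fix A :: "real^4^4" assume A: "A \<in> v_space"
    show "trace ((Ad b0 p + Ad (adj2 a0) (Ad b0 p) - P - Ad a0 q) ** A) = 0"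
      using hyp[OF A z z] by (simp add: lin tr p_def q_def)
  qed (use V P in \<open>simp add: cl vs\<close>)
  have E2: "Ad a0 q - Ad b0 p - Q = 0"
  proof (rule trace_pairing_nondegenerate)
    fix A :: "real^4^4" assume A: "A \<in> v_space"
    show "trace ((Ad a0 q - Ad b0 p - Q) ** A) = 0"
      using hyp[OF z A z] by (simp add: lin tr p_def q_def)
  qed (use V Q in \<open>simp add: cl vs\<close>)
  have E3: "(Ad (adj2 a0) P - P) + (Ad (adj2 b0) Q - Q) = 0"
  proof (rule trace_pairing_nondegenerate)
    fix A :: "real^4^4" assume A: "A \<in> v_space"
    show "trace (((Ad (adj2 a0) P - P) + (Ad (adj2 b0) Q - Q)) ** A) = 0"
      using hyp[OF z z A] by (simp add: lin tr)
  qed (use P Q in \<open>simp add: cl vs\<close>)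
  have Qe: "Ad a0 q - Ad b0 p = Ad x0 q" using E2 unfolding PQ(2) by (metis eq_iff_diff_eq_0)
  then have 1: "Ad b0 p = Ad a0 q - Ad x0 q" by (simp add: algebra_simps)
  have "Ad (adj2 a0) (Ad b0 p) = P + (Ad a0 q - Ad b0 p)"
  proof -
    have "Ad (adj2 a0) (Ad b0 p) - (P + (Ad a0 q - Ad b0 p)) = 0" using E1 by (simp add: algebra_simps)
    then show ?thesis by (simp only: right_minus_eq)
  qed
  then have 2: "Ad (adj2 a0) (Ad b0 p) = Ad x0 p + Ad x0 q" unfolding Qe PQ(1) .
  have "Ad (adj2 a0) P + Ad (adj2 b0) Q = P + Q"
  proof -
    have "(Ad (adj2 a0) P + Ad (adj2 b0) Q) - (P + Q) = 0" using E3 by (simp add: algebra_simps)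
    then show ?thesis by (simp only: right_minus_eq)
  qed
  then have 3: "Ad (adj2 a0) (Ad x0 p) + Ad (adj2 b0) (Ad x0 q) = Ad (adj2 a0) (Ad b0 p)"
    unfolding 2 PQ .
  have s2: "Ad a0 (Ad x0 p) + Ad a0 (Ad x0 q) = Ad b0 p"
    using arg_cong[OF 2, of "Ad a0"] by (simp add: inv lin)
  have s3: "Ad x0 p + Ad a0 (Ad (adj2 b0) (Ad x0 q)) = Ad b0 p"
    using arg_cong[OF 3, of "Ad a0"] by (simp add: inv lin)
  have p: "p = Ad (adj2 b0) (Ad a0 q) - Ad (adj2 b0) (Ad x0 q)"
    using arg_cong[OF 1, of "Ad (adj2 b0)"] by (simp add: inv lin)
  have I: "Ad (x0 ** adj2 b0 ** a0) q - Ad (x0 ** adj2 b0 ** x0) q + Ad (a0 ** adj2 b0 ** x0) q = Ad a0 q - Ad x0 q"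
    using s3 unfolding 1 by (subst (asm) p) (simp add: lin Ad_mult)
  have II: "Ad (a0 ** x0 ** adj2 b0 ** a0) q - Ad (a0 ** x0 ** adj2 b0 ** x0) q + Ad (a0 ** x0) q = Ad a0 q - Ad x0 q"
    using s2 unfolding 1 by (subst (asm) p) (simp add: lin Ad_mult)
  note fm = integral_form_mult integral_forms
  have "gram q = 0"
  proof (rule integral_linear_system)
    show "gram q $ 4 $ 4 = 0" using gz by (simp add: q_def)
    show "transpose (gram q) = gram q" "gram q $ 1 $ 2 = gram q $ 3 $ 3 + gram q $ 3 $ 4 + gram q $ 4 $ 4"
      by (rule gram_v_space[OF V(2)])+
    have "gram (Ad (x0 ** adj2 b0 ** a0) q) - gram (Ad (x0 ** adj2 b0 ** x0) q) + gram (Ad (a0 ** adj2 b0 ** x0) q)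
       = gram (Ad a0 q) - gram (Ad x0 q)"
      using arg_cong[OF I, of gram] by (simp add: gram_linear)
    then show "(Lx ** Lbi ** La) ** gram q ** transpose (Lx ** Lbi ** La) - (Lx ** Lbi ** Lx) ** gram q ** transpose (Lx ** Lbi ** Lx)
       + (La ** Lbi ** Lx) ** gram q ** transpose (La ** Lbi ** Lx) = La ** gram q ** transpose La - Lx ** gram q ** transpose Lx"
      by (simp add: gram_Ad[OF fm(1)[OF fm(1)[OF fm(3) fm(4)] fm(2)]] gram_Ad[OF fm(1)[OF fm(1)[OF fm(3) fm(4)] fm(3)]]
         gram_Ad[OF fm(1)[OF fm(1)[OF fm(2) fm(4)] fm(3)]] gram_Ad[OF fm(2)] gram_Ad[OF fm(3)])
    have "gram (Ad (a0 ** x0 ** adj2 b0 ** a0) q) - gram (Ad (a0 ** x0 ** adj2 b0 ** x0) q) + gram (Ad (a0 ** x0) q)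
       = gram (Ad a0 q) - gram (Ad x0 q)"
      using arg_cong[OF II, of gram] by (simp add: gram_linear)
    then show "(La ** Lx ** Lbi ** La) ** gram q ** transpose (La ** Lx ** Lbi ** La)
       - (La ** Lx ** Lbi ** Lx) ** gram q ** transpose (La ** Lx ** Lbi ** Lx)
       + (La ** Lx) ** gram q ** transpose (La ** Lx) = La ** gram q ** transpose La - Lx ** gram q ** transpose Lx"
      by (simp add: gram_Ad[OF fm(1)[OF fm(1)[OF fm(1)[OF fm(2,3)] fm(4)] fm(2)]] gram_Ad[OF fm(1)[OF fm(1)[OF fm(1)[OF fm(2,3)] fm(4)] fm(3)]]
         gram_Ad[OF fm(1)[OF fm(2,3)]] gram_Ad[OF fm(2)] gram_Ad[OF fm(3)])
  qed
  then have "q = 0" by (simp add: gram_zero_iff)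
  moreover from this have "p = 0" using p by (simp add: lin)
  ultimately show ?thesis by (simp add: PQ lin)
qed

section \<open>Continuity\<close>

lemma tendsto_matrix_mult:
  fixes f g :: "'t \<Rightarrow> 'a::real_normed_field^'n^'n"
  assumes "(f \<longlongrightarrow> A) F" "(g \<longlongrightarrow> B) F"
  shows "((\<lambda>u. f u ** g u) \<longlongrightarrow> A ** B) F"
  unfolding matrix_matrix_mult_def
  by (intro vec_tendstoI) (simp, intro tendsto_sum tendsto_mult tendsto_vec_nth assms)

lemma tendsto_lorentz:
  assumes f: "(f \<longlongrightarrow> A) F"
  shows "((\<lambda>u. lorentz (f u)) \<longlongrightarrow> lorentz A) F"
proof -
  have "bounded_linear conj_transpose"
    by (rule linear_conv_bounded_linear[THEN iffD1], rule linearI) (simp_all add: conj_transpose_def vec_eq_iff scaleR_conv_of_real[where 'a=complex])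
  then have c: "((\<lambda>u. conj_transpose (f u)) \<longlongrightarrow> conj_transpose A) F" using f by (rule bounded_linear.tendsto)
  have "bounded_linear hermitian_coords"
    by (rule linear_conv_bounded_linear[THEN iffD1], rule linearI) (simp_all add: hermitian_coords_linear)
  then have h: "((\<lambda>u. hermitian_coords (f u ** H ** conj_transpose (f u))) \<longlongrightarrow> hermitian_coords (A ** H ** conj_transpose A)) F" for H
    by (rule bounded_linear.tendsto) (intro tendsto_matrix_mult tendsto_const f c)
  show ?thesis
    by (intro vec_tendstoI) (simp only: lorentz_entry, intro tendsto_vec_nth h)
qed

lemma tendsto_adj2:
  assumes f: "(f \<longlongrightarrow> A) F"
  shows "((\<lambda>u. adj2 (f u)) \<longlongrightarrow> adj2 A) F"
proof -
  have "bounded_linear adj2"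
    by (rule linear_conv_bounded_linear[THEN iffD1], rule linearI) (simp_all add: adj2_def vec_eq_iff forall_2)
  then show ?thesis using f by (rule bounded_linear.tendsto)
qed

lemma tendsto_Ad:
  assumes "(f \<longlongrightarrow> A) F" "(g \<longlongrightarrow> X) F"
  shows "((\<lambda>u. Ad (f u) (g u)) \<longlongrightarrow> Ad A X) F"
  unfolding Ad_def by (intro tendsto_matrix_mult tendsto_lorentz tendsto_adj2 assms)

lemma tendsto_matrix2:
  fixes f :: "'t \<Rightarrow> complex^2^2"
  assumes "((\<lambda>u. f u $ 1 $ 1) \<longlongrightarrow> A $ 1 $ 1) F" "((\<lambda>u. f u $ 1 $ 2) \<longlongrightarrow> A $ 1 $ 2) F"
    "((\<lambda>u. f u $ 2 $ 1) \<longlongrightarrow> A $ 2 $ 1) F" "((\<lambda>u. f u $ 2 $ 2) \<longlongrightarrow> A $ 2 $ 2) F"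
  shows "(f \<longlongrightarrow> A) F"
proof (intro vec_tendstoI)
  fix i j :: 2
  show "((\<lambda>u. f u $ i $ j) \<longlongrightarrow> A $ i $ j) F"
    using assms exhaust_2[of i] exhaust_2[of j] by metis
qed

lemma tendsto_mat_word:
  assumes z: "(z \<longlongrightarrow> z0) F" and u: "(u \<longlongrightarrow> u0) F"
  shows "((\<lambda>t. mat_word (u t) (z t) w) \<longlongrightarrow> mat_word u0 z0 w) F"
proof (induction w)
  case (Cons c w)
  have x: "((\<lambda>t. mat_x (u t)) \<longlongrightarrow> mat_x u0) F"
    by (rule tendsto_matrix2; simp add: mat_x_def; intro tendsto_intros u; simp)
  have y: "((\<lambda>t. mat_y (u t) (z t)) \<longlongrightarrow> mat_y u0 z0) F"
    by (rule tendsto_matrix2; simp add: mat_y_def; intro tendsto_intros u z; simp)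
  obtain g e where "c = (g, e)" by force
  then have "((\<lambda>t. mat_letter (u t) (z t) c) \<longlongrightarrow> mat_letter u0 z0 c) F"
    using x y tendsto_adj2[OF x] tendsto_adj2[OF y]
    by (cases g; cases e) (simp_all add: matrix_inv_det_1 det_mat_x det_mat_y)
  then show ?case using Cons by (simp add: mat_word_Cons tendsto_matrix_mult)
qed (simp add: mat_word_Nil)

section \<open>The invariant of the boundary torus\<close>

context
  fixes u z :: complex
  assumes rel: "shape_relation u z"
begin

text \<open>The operator \<open>H \<mapsto> n H n\<^sup>*\<close> with \<open>n = x - x\<inverse>\<close>.  It is invariant under everything that commutes with \<open>x\<close>,
  and it belongs to the module because \<open>n\<close> has trace zero: this makes it trace-free, and self-adjoint for the
  Minkowski form as the adjugate of \<open>n\<close> is \<open>- n\<close>.\<close>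

definition torus_invariant :: "real^4^4" where
  "torus_invariant = lorentz (mat_x u - adj2 (mat_x u))"

lemma torus_invariant_v_space: "torus_invariant \<in> v_space"
proof -
  let ?N = "mat_x u - adj2 (mat_x u)"
  have "adj2 ?N = - ?N" by (simp add: adj2_def vec_eq_iff forall_2)
  then have "transpose (lorentz ?N) ** minkowski = minkowski ** lorentz ?N"
    using lorentz_adj2[of ?N] by (simp only: \<open>adj2 ?N = - ?N\<close> lorentz_minus)
  moreover have "trace (lorentz ?N) = 0" by (rule trace_lorentz) (simp add: adj2_def)
  ultimately show ?thesis by (simp add: v_space_iff torus_invariant_def)
qed

lemma torus_invariant_nonzero: "torus_invariant \<noteq> 0"
proof
  let ?N = "mat_x u - adj2 (mat_x u)"
  \<comment> \<open>\<open>hermitian p\<close> is the matrix unit with entry \<open>(2, 2)\<close>\<close>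
  define p :: "real^4" where "p = vector [0, 0, - 1 / 2, 1 / 2]"
  assume "torus_invariant = 0"
  then have "lorentz ?N *v p = 0" by (simp add: torus_invariant_def)
  then have "hermitian (lorentz ?N *v p) = 0"
    by (simp add: hermitian_def vec_eq_iff forall_2 complex_eq_iff)
  then have "(?N ** hermitian p ** conj_transpose ?N) $ 1 $ 1 = 0" by (simp add: hermitian_lorentz)
  moreover have "(?N ** hermitian p ** conj_transpose ?N) $ 1 $ 1 = ?N $ 1 $ 2 * cnj (?N $ 1 $ 2)"
    by (simp add: matrix_matrix_mult_def sum_2 hermitian_def p_def conj_transpose_def complex_eq_iff)
  moreover have "?N $ 1 $ 2 = - 2 * exp (- (u / 2))" by (simp add: mat_x_def adj2_def)
  ultimately show False by simp
qed

lemma torus_invariant_fixed: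
  assumes comm: "mat_x u ** M = M ** mat_x u" and M: "det M = 1"
  shows "Ad M torus_invariant = torus_invariant"
proof -
  have "adj2 (mat_x u) ** M = adj2 (mat_x u) ** (M ** mat_x u) ** adj2 (mat_x u)"
    by (simp add: adj2_mult det_mat_x flip: matrix_mul_assoc)
  also have "\<dots> = M ** adj2 (mat_x u)"
    by (simp add: comm[symmetric] adj2_mult det_mat_x matrix_mul_assoc)
  finally have "M ** (mat_x u - adj2 (mat_x u)) = (mat_x u - adj2 (mat_x u)) ** M"
    by (simp add: matrix_sub_distrib comm)
  then have "torus_invariant ** lorentz M = lorentz M ** torus_invariant"
    by (simp add: torus_invariant_def flip: lorentz_mult)
  then show ?thesis using Ad_fixed_iff[OF M] by simp
qed

text \<open>The invariant annihilates every \<open>x v - v\<close> and every \<open>l w - w\<close> under the trace form.\<close>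

lemma boundary_coinvariants_nonzero:
  "{(Ad (mat_x u) v - v) + (Ad (mat_word u z word_l) w - w) | v w. v \<in> v_space \<and> w \<in> v_space} \<noteq> v_space"
proof
  assume eq: "{(Ad (mat_x u) v - v) + (Ad (mat_word u z word_l) w - w) | v w. v \<in> v_space \<and> w \<in> v_space} = v_space"
  have "word_eq fig8_relators (word_x @ word_l) (word_l @ word_x)"
    using elt_relations(3) by (simp add: elt_x_def \<pi>M_class_mult \<pi>M_class_eq_iff)
  moreover have "mat_word u z word_x = mat_x u" by (simp add: word_x_def mat_word_Cons mat_word_Nil)
  ultimately have "mat_x u ** mat_word u z word_l = mat_word u z word_l ** mat_x u"
    using mat_word_eq[OF rel] by (metis mat_word_append)
  then have "Ad (mat_x u) torus_invariant = torus_invariant" "Ad (mat_word u z word_l) torus_invariant = torus_invariant"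
    by (simp_all add: torus_invariant_fixed det_mat_x det_mat_word)
  then have "Ad (adj2 (mat_x u)) torus_invariant = torus_invariant"
    "Ad (adj2 (mat_word u z word_l)) torus_invariant = torus_invariant"
    using Ad_inverse(2)[OF det_mat_x, of u torus_invariant] Ad_inverse(2)[OF det_mat_word, of u z word_l torus_invariant] by simp_all
  then have "trace (torus_invariant ** ((Ad (mat_x u) v - v) + (Ad (mat_word u z word_l) w - w))) = 0" for v w
    by (simp add: matrix_add_ldistrib matrix_sub_distrib trace_add trace_sub trace_Ad)
  moreover have "\<exists>v w. X = (Ad (mat_x u) v - v) + (Ad (mat_word u z word_l) w - w)" if "X \<in> v_space" for X
    using that eq by blast
  ultimately have "trace (torus_invariant ** X) = 0" if "X \<in> v_space" for X
    using that by metis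
  then show False using trace_pairing_nondegenerate[OF torus_invariant_v_space] torus_invariant_nonzero by blast
qed

end

section \<open>The shape parameters\<close>

text \<open>Elimination of \<open>z\<^sub>1\<close> from the first gluing equation gives the shape relation, which reads
  \<open>t + 1 / t + 1 = k + 1 / k\<close> for \<open>t = z\<^sub>2 / k\<close>, and also \<open>1 / z\<^sub>1 = 1 / k - t\<close>.  If \<open>t\<close> were real then
  \<open>1 / k\<close> would have the imaginary part of \<open>1 / z\<^sub>1\<close>, so \<open>k\<close> would lie in the upper half plane, and \<open>t > 0\<close>
  because \<open>z\<^sub>2 = k t\<close> lies there too.  The reality of \<open>k + 1 / k\<close> then forces \<open>\<bar>k\<bar> = 1\<close>, so that
  \<open>k + 1 / k \<le> 2 < t + 1 / t + 1\<close>, a contradiction.\<close>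

lemma gluing_shape_relation:
  assumes gl: "gluing_equations z1 z2" and u: "u_of z1 z2 = u" and im: "Im z1 > 0" "Im z2 > 0"
  shows "shape_relation u z2" "Im (z2 * exp (- u)) \<noteq> 0"
proof -
  have nz: "z1 \<noteq> 0" "z2 \<noteq> 0" "1 - z1 \<noteq> 0" "1 - z2 \<noteq> 0" "z1 * (1 - z2) \<noteq> 0" "1 - 1 / z2 \<noteq> 0" using im by auto
  have k: "exp u = z1 * (1 - z2)" using nz u by (auto simp: u_of_def)
  have "exp (2 * Ln z1 + Ln (1 / (1 - z1)) + Ln z2 + 2 * Ln (1 - 1 / z2)) = 1"
    using gl by (simp add: gluing_equations_def)
  then have "z1\<^sup>2 * (1 / (1 - z1)) * z2 * (1 - 1 / z2)\<^sup>2 = 1"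
    using nz by (simp add: exp_add exp_double)
  then have "z1\<^sup>2 * z2 * (1 - 1 / z2)\<^sup>2 = 1 - z1" using nz by (simp add: field_simps)
  moreover have "z2 * (1 - 1 / z2) = z2 - 1" using nz by (simp add: field_simps)
  ultimately have "z1\<^sup>2 * (z2 - 1)\<^sup>2 = z2 * (1 - z1)" using nz(2) by Groebner_Basis.algebra
  then have k2: "(exp u)\<^sup>2 = z2 * (1 - z1)" unfolding k by Groebner_Basis.algebra
  show rel: "shape_relation u z2"
    unfolding shape_relation_def k2 using k by Groebner_Basis.algebra
  define k where "k = exp u"
  define t where "t = z2 * exp (- u)"
  have kn: "k \<noteq> 0" "exp (- u) = 1 / k" by (simp_all add: k_def exp_minus field_simps)
  have zt: "z2 = k * t" using kn by (simp add: t_def)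
  have t0: "t \<noteq> 0" using nz(2) zt by auto
  have "1 / z1 = (1 - z2) / k" using k nz by (simp add: k_def)
  also have "\<dots> = 1 / k - t" by (simp add: t_def kn diff_divide_distrib)
  finally have z1: "1 / z1 = 1 / k - t" .
  have "(z2 - k\<^sup>2) * (1 - z2) = k * z2" using rel by (simp add: shape_relation_def k_def)
  then have "k * ((t - k) * (1 - k * t)) = k * (k * t)" by (simp add: zt power2_eq_square algebra_simps)
  then have "(t - k) * (1 - k * t) = k * t" using kn(1) by (metis mult_left_cancel)
  then have "(t - k) * (1 - k * t) / (k * t) = 1" using kn(1) t0 by simp
  then have tt: "t + 1 / t + 1 = k + 1 / k" using kn(1) t0 by (simp add: field_simps)
  show "Im (z2 * exp (- u)) \<noteq> 0"
  proof
    assume "Im (z2 * exp (- u)) = 0"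
    then have "Im t = 0" by (simp add: t_def)
    then obtain r where r: "t = of_real r" by (metis complex_is_Real_iff Reals_cases)
    have Im_inverse: "Im (1 / w) = - (Im w / ((Re w)\<^sup>2 + (Im w)\<^sup>2))" for w by (simp add: Im_divide)
    have pos: "(Re w)\<^sup>2 + (Im w)\<^sup>2 > 0" if "w \<noteq> 0" for w
      using that by (metis complex_eq_0 add_nonneg_nonneg le_less zero_le_power2)
    have "Im (1 / z1) < 0" using im pos[OF nz(1)] unfolding Im_inverse by simp
    moreover have "Im (1 / z1) = Im (1 / k)" unfolding z1 r by simp
    ultimately have ik: "Im k > 0" using pos[OF kn(1)] by (simp add: Im_inverse[of k] zero_less_divide_iff)
    have "Im z2 = r * Im k" using zt r by simp
    then have rp: "r > 0" using im ik by (simp add: zero_less_mult_iff)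
    have kk: "k + 1 / k = of_real (r + 1 / r + 1)" using tt r by simp
    have "Im (k + 1 / k) = 0" unfolding kk by (rule Im_complex_of_real)
    then have "Im k = Im k / ((Re k)\<^sup>2 + (Im k)\<^sup>2)" by (simp add: Im_inverse[of k])
    then have n1: "(Re k)\<^sup>2 + (Im k)\<^sup>2 = 1" using ik pos[OF kn(1)] by (simp add: eq_divide_eq)
    then have "Re (k + 1 / k) = 2 * Re k" by (simp add: Re_divide)
    moreover have "(Re k)\<^sup>2 \<le> 1" using n1 zero_le_power2[of "Im k"] by linarith
    then have "Re k \<le> 1" by (simp add: abs_square_le_1)
    moreover have "r + 1 / r + 1 > 2"
    proof (cases "r < 1")
      case True
      then have "1 / r > 1" using rp by simp
      then show ?thesis using rp by linarith
    next
      case False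
      moreover have "1 / r > 0" using rp by simp
      ultimately show ?thesis by linarith
    qed
    ultimately show False by (simp only: kk Re_complex_of_real)
  qed
qed

section \<open>The cohomology of the fiber\<close>

theorem theorem4p2:
  fixes U :: "complex set" and z1 z2 :: "complex \<Rightarrow> complex"
  assumes "hyperbolic_Dehn_filling_space U z1 z2"
  shows "(\<forall>u\<in>U.
            x_module_hom (H1_F_dF u (z2 u)) (x_F_dF u (z2 u)) (H1_F u (z2 u)) (x_F u (z2 u))
              (rel_to_F u (z2 u)) \<and>
            x_short_exact (I_F u (z2 u)) (x_F u (z2 u)) (\<lambda>c. c)
              (H1_F u (z2 u)) (x_F u (z2 u)) (F_to_dF u (z2 u))
              (H1_dF u (z2 u)) (x_dF u (z2 u))) \<and>
         (\<exists>V. open V \<and> 0 \<in> V \<and> V \<subseteq> U \<and>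
            (\<forall>v\<in>V.
               isomorphic_spaces (x_invariants (H1_F v (z2 v)) (x_F v (z2 v)))
                 (x_invariants (H1_dF v (z2 v)) (x_dF v (z2 v))) \<and>
               vectorspace.fin_dim real_ring (x_invariants (H1_F v (z2 v)) (x_F v (z2 v))) \<and>
               vectorspace.dim real_ring (x_invariants (H1_F v (z2 v)) (x_F v (z2 v))) = 1))"
proof (intro conjI)
  have U: "open U" "0 \<in> U" "continuous_on U z2" "z2 0 = omega"
    and gl: "\<And>u. u \<in> U \<Longrightarrow> gluing_equations (z1 u) (z2 u)" "\<And>u. u \<in> U \<Longrightarrow> u_of (z1 u) (z2 u) = u"
      "\<And>u. u \<in> U \<Longrightarrow> Im (z1 u) > 0" "\<And>u. u \<in> U \<Longrightarrow> Im (z2 u) > 0"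
    using assms by (auto simp: hyperbolic_Dehn_filling_space_def omega_def)
  have rel: "shape_relation u (z2 u)" and nonreal: "Im (z2 u * exp (- u)) \<noteq> 0" if "u \<in> U" for u
    using gluing_shape_relation[OF gl(1,2,3,4)] that by auto
  have act: "fig8_action v_space (Ad_rho u (z2 u))" if "u \<in> U" for u by (rule fig8_action_v_space[OF rel[OF that]])
  note Adc = Ad_rho_class[OF rel]
  have coinv: "\<exists>A\<in>v_space. \<exists>B\<in>v_space. v = (Ad_rho u (z2 u) elt_b A - A) + (B - Ad_rho u (z2 u) elt_a B)"
    if "u \<in> U" "v \<in> v_space" for u v
    using fiber_coinvariants_zero[OF rel nonreal] that by (simp add: Adc)
  show "\<forall>u\<in>U.
            x_module_hom (H1_F_dF u (z2 u)) (x_F_dF u (z2 u)) (H1_F u (z2 u)) (x_F u (z2 u))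
              (rel_to_F u (z2 u)) \<and>
            x_short_exact (I_F u (z2 u)) (x_F u (z2 u)) (\<lambda>c. c)
              (H1_F u (z2 u)) (x_F u (z2 u)) (F_to_dF u (z2 u))
              (H1_dF u (z2 u)) (x_dF u (z2 u))"
  proof
    fix u assume u: "u \<in> U"
    interpret fig8_action v_space "Ad_rho u (z2 u)" by (rule act[OF u])
    show "x_module_hom (H1_F_dF u (z2 u)) (x_F_dF u (z2 u)) (H1_F u (z2 u)) (x_F u (z2 u))
              (rel_to_F u (z2 u)) \<and>
            x_short_exact (I_F u (z2 u)) (x_F u (z2 u)) (\<lambda>c. c)
              (H1_F u (z2 u)) (x_F u (z2 u)) (F_to_dF u (z2 u))
              (H1_dF u (z2 u)) (x_dF u (z2 u))"
      unfolding H1_F_dF_def x_F_dF_def H1_F_def x_F_def rel_to_F_def I_F_def F_to_dF_def H1_dF_def x_dF_def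
      using rel_x_module_hom[OF \<pi>F_subgroup x_normalizes(1) \<pi>dF_subgroup x_normalizes(2) \<pi>dF_subset]
        fiber_short_exact[OF coinv[OF u]] by simp
  qed

  \<comment> \<open>for each \<open>u\<close> the values of \<open>T u\<close> on triples \<open>(A, B, w)\<close> in \<open>V\<close> make up the space \<open>S\<close>, and they depend
  continuously on \<open>u\<close>\<close>
  define T where "T u = (\<lambda>(A, B, w).
     (Ad (mat_x u) (Ad (adj2 (mat_word u (z2 u) word_b)) (A + Ad (mat_word u (z2 u) word_a) A - B)) - A + (Ad (mat_word u (z2 u) word_a) w - w),
      Ad (mat_x u) (Ad (adj2 (mat_word u (z2 u) word_a)) (B - A)) - B + (Ad (mat_word u (z2 u) word_b) w - w)))" for u
  define E where "E = v_space \<times> v_space"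
  \<comment> \<open>the normalization that singles out the zero solution of the linear system at \<open>u = 0\<close>; transposition
  passes from the inner product to the trace form\<close>
  define g :: "(real^4^4) \<times> (real^4^4) \<Rightarrow> real" where "g y = gram (Ad (adj2 x0) (transpose (snd y))) $ 4 $ 4" for y
  have E: "Real_Vector_Spaces.subspace E" unfolding E_def by (rule subspace_Times[OF v_space_subspace v_space_subspace])
  have g: "linear g"
  proof (rule linearI)
    have t: "transpose (X + Y) = transpose X + transpose Y" "transpose (c *\<^sub>R X) = c *\<^sub>R transpose X" for X Y :: "real^4^4" and c
      by (simp_all add: transpose_def vec_eq_iff)
    show "g (p + q) = g p + g q" "g (c *\<^sub>R p) = c *\<^sub>R g p" for p q c
      by (simp_all add: g_def t gram_linear Ad_linear[THEN linear_add] Ad_linear[THEN linear_cmul])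
  qed
  have cont: "isCont (\<lambda>u. T u i) 0" for i
  proof -
    obtain A B w where i: "i = (A, B, w)" by (metis prod_cases3)
    have z: "(z2 \<longlongrightarrow> z2 0) (at 0)" using U by (metis continuous_on_eq_continuous_at isCont_def)
    have x: "((\<lambda>t. mat_x t) \<longlongrightarrow> mat_x 0) (at 0)"
      using tendsto_mat_word[OF z tendsto_ident_at, of word_x] by (simp add: word_x_def mat_word_Cons mat_word_Nil)
    note m = tendsto_mat_word[OF z tendsto_ident_at]
    show ?thesis unfolding isCont_def T_def i prod.case
      by (intro tendsto_Pair tendsto_add tendsto_diff tendsto_Ad tendsto_adj2 tendsto_const x m)
  qed
  have triv: "y = 0" if y: "y \<in> E" and ann: "\<And>i. i \<in> v_space \<times> v_space \<times> v_space \<Longrightarrow> y \<bullet> T 0 i = 0" and gy: "g y = 0" for y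
  proof -
    obtain Y1 Y2 where Y: "y = (Y1, Y2)" by force
    have "transpose Y1 = 0 \<and> transpose Y2 = 0"
    proof (rule complete_annihilator)
      show "transpose Y1 \<in> v_space" "transpose Y2 \<in> v_space" using y by (auto simp: Y E_def v_space_transpose)
      show "gram (Ad (adj2 x0) (transpose Y2)) $ 4 $ 4 = 0" using gy by (simp add: g_def Y)
      fix A B w :: "real^4^4" assume "A \<in> v_space" "B \<in> v_space" "w \<in> v_space"
      then have "y \<bullet> T 0 (A, B, w) = 0" by (intro ann) auto
      then show "trace (transpose Y1 ** (Ad x0 (Ad (adj2 b0) (A + Ad a0 A - B)) - A + (Ad a0 w - w)))
        + trace (transpose Y2 ** (Ad x0 (Ad (adj2 a0) (B - A)) - B + (Ad b0 w - w))) = 0"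
        by (simp add: Y T_def inner_prod_def trace_transpose_mult U)
    qed
    then show ?thesis by (simp add: Y transpose_def vec_eq_iff zero_prod_def)
  qed
  have "\<exists>d>0. \<forall>u. dist u 0 < d \<longrightarrow> (\<forall>y\<in>E. (\<forall>i\<in>v_space \<times> v_space \<times> v_space. y \<bullet> T u i = 0) \<longrightarrow> g y = 0 \<longrightarrow> y = 0)"
    by (rule eventually_trivial_annihilator[where \<Psi> = T, OF E g cont]) (rule triv)
  then obtain d where d0: "d > 0" and d: "\<forall>u. dist u 0 < d \<longrightarrow> (\<forall>y\<in>E. (\<forall>i\<in>v_space \<times> v_space \<times> v_space. y \<bullet> T u i = 0) \<longrightarrow> g y = 0 \<longrightarrow> y = 0)"
    by (elim exE conjE)
  show "\<exists>V. open V \<and> 0 \<in> V \<and> V \<subseteq> U \<and>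
            (\<forall>v\<in>V.
               isomorphic_spaces (x_invariants (H1_F v (z2 v)) (x_F v (z2 v)))
                 (x_invariants (H1_dF v (z2 v)) (x_dF v (z2 v))) \<and>
               vectorspace.fin_dim real_ring (x_invariants (H1_F v (z2 v)) (x_F v (z2 v))) \<and>
               vectorspace.dim real_ring (x_invariants (H1_F v (z2 v)) (x_F v (z2 v))) = 1)"
  proof (intro exI[of _ "U \<inter> ball 0 d"] conjI ballI)
    fix u assume "u \<in> U \<inter> ball 0 d"
    then have u: "u \<in> U" "dist u 0 < d" by (auto simp: dist_commute)
    interpret fig8_action v_space "Ad_rho u (z2 u)" by (rule act[OF u(1)])
    interpret fig8_euclidean v_space "Ad_rho u (z2 u)" ..
    have ops: "x = Ad (mat_x u)" "a = Ad (mat_word u (z2 u) word_a)" "b = Ad (mat_word u (z2 u) word_b)"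
      "ai = Ad (adj2 (mat_word u (z2 u) word_a))" "bi = Ad (adj2 (mat_word u (z2 u) word_b))"
      "Ad_rho u (z2 u) elt_l = Ad (mat_word u (z2 u) word_l)"
      by (rule ext, simp add: Adc[OF u(1)] elt_x_def \<pi>M_class_inv mat_word_inv; simp add: word_x_def mat_word_Cons mat_word_Nil)+
    let ?S = "{(twist e - e) + \<beta> | e \<beta>. e \<in> v_space \<times> v_space \<and> \<beta> \<in> fiber_coboundaries}"
    have "Real_Vector_Spaces.dim E \<le> Suc (Real_Vector_Spaces.dim ?S)"
    proof (rule codimension_le_one[OF E _ _ g])
      show "Real_Vector_Spaces.subspace ?S" "?S \<subseteq> E" unfolding E_def by (rule codimension_subspace)+
      fix y assume y: "y \<in> E" "\<And>s. s \<in> ?S \<Longrightarrow> y \<bullet> s = 0" "g y = 0"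
      show "y = 0"
      proof (rule d[rule_format, OF u(2) y(1) _ y(3)])
        fix i assume "i \<in> v_space \<times> v_space \<times> v_space"
        then obtain A B w where i: "i = (A, B, w)" "A \<in> v_space" "B \<in> v_space" "w \<in> v_space" by auto
        have "T u i = (twist (A, B) - (A, B)) + (a w - w, b w - w)"
          unfolding i(1) T_def prod.case twist_def ops by simp
        moreover have "(a w - w, b w - w) \<in> fiber_coboundaries" using i by (auto simp: fiber_coboundaries_def)
        moreover have "(A, B) \<in> v_space \<times> v_space" using i by simp
        ultimately have "T u i \<in> ?S" by blast
        then show "y \<bullet> T u i = 0" by (rule y(2))
      qed
    qed
    moreover have "{(x v - v) + (Ad_rho u (z2 u) elt_l w - w) | v w. v \<in> v_space \<and> w \<in> v_space} \<noteq> v_space"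
      unfolding ops by (rule boundary_coinvariants_nonzero[OF rel[OF u(1)]])
    ultimately have "isomorphic_spaces (x_invariants (H1_F u (z2 u)) (x_F u (z2 u))) (x_invariants (H1_dF u (z2 u)) (x_dF u (z2 u))) \<and>
               vectorspace.fin_dim real_ring (x_invariants (H1_F u (z2 u)) (x_F u (z2 u))) \<and>
               vectorspace.dim real_ring (x_invariants (H1_F u (z2 u)) (x_F u (z2 u))) = 1"
      using invariants_one_dimensional[OF coinv[OF u(1)]] unfolding E_def H1_F_def x_F_def H1_dF_def x_dF_def by blast
    then show "isomorphic_spaces (x_invariants (H1_F u (z2 u)) (x_F u (z2 u))) (x_invariants (H1_dF u (z2 u)) (x_dF u (z2 u)))"
      "vectorspace.fin_dim real_ring (x_invariants (H1_F u (z2 u)) (x_F u (z2 u)))"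
      "vectorspace.dim real_ring (x_invariants (H1_F u (z2 u)) (x_F u (z2 u))) = 1" by blast+
  qed (use U d0 in auto)
qed

end
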